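(* Let $p>1$ and let $q:\mathbb{R}\to\mathbb{R}$ be periodic of period $1$ with $q\in L^1(0,1)$. Consider the equation $-\left(y'^{(p-1)}\right)'=(p-1)(\lambda-q(x))y^{(p-1)}$. (a) If the set of eigenvalues of this equation with periodic boundary conditions $y(0)=y(1)$, $y'(0)=y'(1)$ contains $\{(2n\widehat{\pi})^p: n\in\mathbb{N}\cup\{0\}\}$ and $0$ is the least eigenvalue, then $q=0$ (almost everywhere) on $[0,1]$. (b) If the set of eigenvalues of this equation with anti-periodic boundary conditions $y(0)=-y(1)$, $y'(0)=-y'(1)$ contains $\{((2n-1)\widehat{\pi})^p: n\in\mathbb{N}\}$, $\widehat{\pi}^p$ is the least eigenvalue, and $$\int_0^1 q(t)\left(S_p(\widehat{\pi}t)\,S_p'(\widehat{\pi}t)^{(p-1)}\right)'\,dt=0,$$ then $q=0$ (almost everywhere) on $[0,1]$.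
   Context: For a real-valued $f$, $f^{(p-1)}:=|f|^{p-1}\operatorname{sgn} f$. A solution of the equation is a function $y$ with $y$ and $y'^{(p-1)}$ absolutely continuous satisfying the equation a.e.; an eigenvalue is a real $\lambda$ for which a nontrivial solution satisfying the boundary conditions exists. $\mathbb{N}=\{1,2,\dots\}$. $\widehat{\pi}:=\dfrac{2\pi}{p\sin(\pi/p)}$. $S_p$ is the solution on $\mathbb{R}$ of $-\left(y'^{(p-1)}\right)'=(p-1)y^{(p-1)}$ with $S_p(0)=0$, $S_p'(0)=1$; it is $2\widehat{\pi}$-periodic. In (b) the outer prime denotes the derivative in $t$ of the function $t\mapsto S_p(\widehat{\pi}t)S_p'(\widehat{\pi}t)^{(p-1)}$. *)

theory Defs
  imports "HOL-Analysis.Analysis"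
begin

definition spow :: "real \<Rightarrow> real \<Rightarrow> real" where
  "spow x r = \<bar>x\<bar> powr r * sgn x"

definition pi_hat :: "real \<Rightarrow> real" where
  "pi_hat p = 2 * pi / (p * sin (pi / p))"

text \<open>
  Absolute continuity of a function on a set (the library's absolute continuity is the one of
  measures). Degenerate intervals (with \<open>u i = v i\<close>) are harmless: they contribute 0 to both sums.
\<close>

definition abs_continuous_on :: "real set \<Rightarrow> (real \<Rightarrow> real) \<Rightarrow> bool" where
  "abs_continuous_on S f \<longleftrightarrow>
     (\<forall>\<epsilon>>0. \<exists>\<delta>>0. \<forall>(n::nat) u v.
        (\<forall>i<n. u i \<le> v i \<and> {u i..v i} \<subseteq> S) \<and>
        disjoint_family_on (\<lambda>i. {u i<..<v i}) {..<n} \<and>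
        (\<Sum>i<n. v i - u i) < \<delta>
        \<longrightarrow> (\<Sum>i<n. \<bar>f (v i) - f (u i)\<bar>) < \<epsilon>)"

definition locally_abs_continuous_on :: "real set \<Rightarrow> (real \<Rightarrow> real) \<Rightarrow> bool" where
  "locally_abs_continuous_on I f \<longleftrightarrow> (\<forall>a b. {a..b} \<subseteq> I \<longrightarrow> abs_continuous_on {a..b} f)"

text \<open>
  \<open>y\<close> is a solution, with derivative \<open>y'\<close>, of
  \<open>- (y'\<^sup>(\<^sup>p\<^sup>-\<^sup>1\<^sup>))' = (p - 1) (\<mu> - q) y\<^sup>(\<^sup>p\<^sup>-\<^sup>1\<^sup>)\<close> on a nondegenerate interval \<open>I\<close>.
  Derivatives are taken within \<open>I\<close>, hence are one-sided at end points belonging to \<open>I\<close>;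
  \<open>y'\<close> is determined by \<open>y\<close> on \<open>I\<close>. It is required to be the derivative at every
  point: this is no restriction, because an absolutely continuous \<open>y\<close> whose almost everywhere
  derivative agrees with a continuous function is continuously differentiable.
  On a compact \<open>I\<close> local absolute continuity is absolute continuity.
\<close>

definition half_linear_solution ::
  "real \<Rightarrow> real \<Rightarrow> (real \<Rightarrow> real) \<Rightarrow> real set \<Rightarrow> (real \<Rightarrow> real) \<Rightarrow> (real \<Rightarrow> real) \<Rightarrow> bool" where
  "half_linear_solution p \<mu> q I y y' \<longleftrightarrow>
     (\<forall>x\<in>I. (y has_real_derivative y' x) (at x within I)) \<and>
     locally_abs_continuous_on I y \<and>
     locally_abs_continuous_on I (\<lambda>x. spow (y' x) (p - 1)) \<and>
     (AE x in lebesgue. x \<in> I \<longrightarrow>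
        (\<exists>d. ((\<lambda>t. spow (y' t) (p - 1)) has_real_derivative d) (at x within I) \<and>
             - d = (p - 1) * (\<mu> - q x) * spow (y x) (p - 1)))"

definition periodic_eigenvalues :: "real \<Rightarrow> (real \<Rightarrow> real) \<Rightarrow> real set" where
  "periodic_eigenvalues p q =
     {\<mu>. \<exists>y y'. half_linear_solution p \<mu> q {0..1} y y' \<and> (\<exists>x\<in>{0..1}. y x \<noteq> 0) \<and>
                y 0 = y 1 \<and> y' 0 = y' 1}"

definition antiperiodic_eigenvalues :: "real \<Rightarrow> (real \<Rightarrow> real) \<Rightarrow> real set" where
  "antiperiodic_eigenvalues p q =
     {\<mu>. \<exists>y y'. half_linear_solution p \<mu> q {0..1} y y' \<and> (\<exists>x\<in>{0..1}. y x \<noteq> 0) \<and>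
                y 0 = - y 1 \<and> y' 0 = - y' 1}"

text \<open>
  The generalized sine: the equation \<open>- (y'\<^sup>(\<^sup>p\<^sup>-\<^sup>1\<^sup>))' = (p - 1) y\<^sup>(\<^sup>p\<^sup>-\<^sup>1\<^sup>)\<close> is the one above with
  \<open>\<mu> = 1\<close> and \<open>q = 0\<close>. For \<open>p > 1\<close> its initial value problems are uniquely solvable on
  the whole line.
\<close>

definition S_p :: "real \<Rightarrow> real \<Rightarrow> real" where
  "S_p p = (THE y. \<exists>y'. half_linear_solution p 1 (\<lambda>_. 0) UNIV y y' \<and> y 0 = 0 \<and> y' 0 = 1)"

end

theory Submission
  imports Defs
begin

text \<open>
  Write \<open>\<pi>\<^sub>p\<close> for \<open>pi_hat p\<close>. In the Pruefer coordinates \<open>y = r S\<^sub>p(\<theta>)\<close>, \<open>y' = \<kappa> r S\<^sub>p'(\<theta>)\<close> the equation becomes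
  \<open>\<theta>' = \<kappa> + ((\<lambda> - q) \<kappa>\<^sup>1\<^sup>-\<^sup>p - \<kappa>) |S\<^sub>p(\<theta>)|\<^sup>p\<close>, which is continuously differentiable in \<open>\<theta>\<close> for every
  \<open>p > 1\<close>. Taking \<open>\<kappa> = \<lambda>\<^sup>1\<^sup>/\<^sup>p\<close>, the eigenvalues \<open>(n \<pi>\<^sub>p)\<^sup>p\<close> with \<open>n\<close> large force \<open>\<integral> q = 0\<close>.
  Taking \<open>\<kappa> = 1\<close>, the derivative of \<open>\<theta>(1)\<close> with respect to \<open>\<theta>(0)\<close> is \<open>(r(0) / r(1))\<^sup>p\<close>; hence where
  \<open>\<theta>(1) - \<theta>(0)\<close> has an extremum with value \<open>0\<close> or \<open>\<pi>\<^sub>p\<close>, \<open>\<lambda>\<close> is a periodic or antiperiodic eigenvalue.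
  The largest \<open>\<lambda>\<close> at which \<open>\<theta>(1) - \<theta>(0)\<close> attains \<open>0\<close> is thus an eigenvalue with a positive eigenfunction, and
  integrating the Riccati equation over a period shows that it is at most \<open>\<integral> q = 0\<close>, with equality only
  for \<open>q = 0\<close>. In the antiperiodic case minimality of \<open>\<pi>\<^sub>p\<^sup>p\<close> gives \<open>\<theta>(1) \<le> \<pi>\<^sub>p\<close> for \<open>\<theta>(0) = 0\<close>, while the extra
  hypothesis says \<open>\<integral> q |S\<^sub>p(\<pi>\<^sub>p x)|\<^sup>p = 0\<close>; equality in Picone's identity then yields \<open>q = 0\<close>.
\<close>

section \<open>Absolutely continuous functions\<close>

text \<open>Written as a system for \<open>y\<close> and \<open>w = y'^(p-1)\<close>, the equation
  is not Lipschitz when \<open>p \<noteq> 2\<close>: one of the exponents \<open>p - 1\<close>,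
  \<open>1/(p - 1)\<close> is below 1. The angle equation is better because \<open>|S_p|^p\<close>
  has the continuous derivative \<open>p S_p^(p-1) S_p'\<close>. That derivative need not be
  Lipschitz, so dependence on \<open>\<theta>(0)\<close> is studied through divided differences: the
  difference of two angles solves an exactly linear scalar equation. Its integrating factor gives
  uniqueness, monotonicity, comparison and, in the limit, the derivative, all with \<open>q\<close>
  merely integrable. With \<open>\<kappa> = \<lambda>^(1/p)\<close> the parameter
  \<open>\<lambda>\<close> cancels in front of \<open>|S_p(\<theta>)|^p\<close>. There remains
  \<open>\<theta>' = \<kappa> - \<kappa>^(1-p) q |S_p(\<theta>)|^p\<close>, a small perturbation of
  uniform rotation, and for large \<open>\<kappa>\<close> the number of half turns is forced. The
  extremal \<open>\<lambda>\<close> exists by compactness: \<open>\<theta>(1) - \<theta>(0)\<close>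
  is jointly continuous in \<open>\<lambda>\<close> and \<open>\<theta>(0)\<close> and periodic in
  \<open>\<theta>(0)\<close>. If it passed the critical value there, it would still do so for a
  nearby, more extreme \<open>\<lambda>\<close>; hence the critical value is an extremum.\<close>

lemma abs_continuous_on_finite:
  assumes "abs_continuous_on S f" "\<epsilon> > 0"
  shows "\<exists>\<delta>>0. \<forall>(I :: 'i set) u v. finite I \<and> (\<forall>i\<in>I. u i \<le> v i \<and> {u i..v i} \<subseteq> S) \<and>
       disjoint_family_on (\<lambda>i. {u i<..<v i}) I \<and> (\<Sum>i\<in>I. v i - u i) < \<delta>
       \<longrightarrow> (\<Sum>i\<in>I. \<bar>f (v i) - f (u i)\<bar>) < \<epsilon>"
proof -
  obtain \<delta> where "\<delta> > 0" and \<delta>: "\<And>(n::nat) u v. \<lbrakk>\<And>i. i < n \<Longrightarrow> u i \<le> v i \<and> {u i..v i} \<subseteq> S;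
       disjoint_family_on (\<lambda>i. {u i<..<v i}) {..<n}; (\<Sum>i<n. v i - u i) < \<delta>\<rbrakk>
       \<Longrightarrow> (\<Sum>i<n. \<bar>f (v i) - f (u i)\<bar>) < \<epsilon>"
    using assms unfolding abs_continuous_on_def by meson
  show ?thesis
  proof (intro exI[of _ \<delta>] conjI allI impI)
    fix I :: "'i set" and u v :: "'i \<Rightarrow> real"
    assume "finite I \<and> (\<forall>i\<in>I. u i \<le> v i \<and> {u i..v i} \<subseteq> S) \<and>
       disjoint_family_on (\<lambda>i. {u i<..<v i}) I \<and> (\<Sum>i\<in>I. v i - u i) < \<delta>"
    then have I: "finite I" and uv: "\<And>i. i \<in> I \<Longrightarrow> u i \<le> v i \<and> {u i..v i} \<subseteq> S"
      and disj: "disjoint_family_on (\<lambda>i. {u i<..<v i}) I" and sum: "(\<Sum>i\<in>I. v i - u i) < \<delta>"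
      by blast+
    obtain h where h: "bij_betw h {..<card I} I"
      using ex_bij_betw_nat_finite[OF I] by (auto simp: atLeast0LessThan)
    have inj: "inj_on h {..<card I}" and img: "h ` {..<card I} = I"
      using h by (auto simp: bij_betw_def)
    have "(\<Sum>i<card I. \<bar>f (v (h i)) - f (u (h i))\<bar>) < \<epsilon>"
    proof (rule \<delta>)
      show "u (h i) \<le> v (h i) \<and> {u (h i)..v (h i)} \<subseteq> S" if "i < card I" for i
        using uv[of "h i"] img that by blast
      show "disjoint_family_on (\<lambda>i. {u (h i)<..<v (h i)}) {..<card I}"
        unfolding disjoint_family_on_def
      proof (intro ballI impI)
        fix m n assume mn: "m \<in> {..<card I}" "n \<in> {..<card I}" "m \<noteq> n"
        then have "h m \<noteq> h n" "h m \<in> I" "h n \<in> I"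
          using inj img by (auto simp: inj_on_def)
        then show "{u (h m)<..<v (h m)} \<inter> {u (h n)<..<v (h n)} = {}"
          using disj by (auto simp: disjoint_family_on_def)
      qed
      show "(\<Sum>i<card I. v (h i) - u (h i)) < \<delta>"
        using sum sum.reindex_bij_betw[OF h, of "\<lambda>i. v i - u i"] by simp
    qed
    then show "(\<Sum>i\<in>I. \<bar>f (v i) - f (u i)\<bar>) < \<epsilon>"
      using sum.reindex_bij_betw[OF h, of "\<lambda>i. \<bar>f (v i) - f (u i)\<bar>"] by simp
  qed (rule \<open>\<delta> > 0\<close>)
qed

lemma abs_continuous_on_subset:
  "abs_continuous_on S f \<Longrightarrow> T \<subseteq> S \<Longrightarrow> abs_continuous_on T f"
  unfolding abs_continuous_on_def by (meson order_trans)

text \<open>Sums, products and Lipschitz images are all instances: the increments of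
  \<open>h\<close> are controlled by those of \<open>f\<close> and \<open>g\<close>, so small sums
  for the latter give small sums for \<open>h\<close>.\<close>

lemma abs_continuous_on_dominated:
  assumes "abs_continuous_on S f" "abs_continuous_on S g"
    and "\<And>x y. \<lbrakk>x \<in> S; y \<in> S\<rbrakk> \<Longrightarrow> \<bar>h x - h y\<bar> \<le> L * (\<bar>f x - f y\<bar> + \<bar>g x - g y\<bar>)"
  shows "abs_continuous_on S h"
  unfolding abs_continuous_on_def
proof (intro allI impI)
  fix \<epsilon> :: real assume "\<epsilon> > 0"
  \<comment> \<open>\<open>L\<close> may be zero or negative, hence
    \<open>\<bar>L\<bar> + 1\<close>; the factor 2 splits the error between \<open>f\<close> and
    \<open>g\<close>.\<close>
  define e where "e = \<epsilon> / (2 * (\<bar>L\<bar> + 1))"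
  have "e > 0" using \<open>\<epsilon> > 0\<close> by (simp add: e_def)
  obtain d1 where d1: "d1 > 0" "\<And>(n::nat) u v. \<lbrakk>(\<forall>i<n. u i \<le> v i \<and> {u i..v i} \<subseteq> S) \<and>
       disjoint_family_on (\<lambda>i. {u i<..<v i}) {..<n} \<and> (\<Sum>i<n. v i - u i) < d1\<rbrakk>
       \<Longrightarrow> (\<Sum>i<n. \<bar>f (v i) - f (u i)\<bar>) < e"
    using assms(1) \<open>e > 0\<close> unfolding abs_continuous_on_def by meson
  obtain d2 where d2: "d2 > 0" "\<And>(n::nat) u v. \<lbrakk>(\<forall>i<n. u i \<le> v i \<and> {u i..v i} \<subseteq> S) \<and>
       disjoint_family_on (\<lambda>i. {u i<..<v i}) {..<n} \<and> (\<Sum>i<n. v i - u i) < d2\<rbrakk>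
       \<Longrightarrow> (\<Sum>i<n. \<bar>g (v i) - g (u i)\<bar>) < e"
    using assms(2) \<open>e > 0\<close> unfolding abs_continuous_on_def by meson
  show "\<exists>\<delta>>0. \<forall>(n::nat) u v.
        (\<forall>i<n. u i \<le> v i \<and> {u i..v i} \<subseteq> S) \<and> disjoint_family_on (\<lambda>i. {u i<..<v i}) {..<n} \<and>
        (\<Sum>i<n. v i - u i) < \<delta> \<longrightarrow> (\<Sum>i<n. \<bar>h (v i) - h (u i)\<bar>) < \<epsilon>"
  proof (intro exI[of _ "min d1 d2"] conjI allI impI)
    show "min d1 d2 > 0" using d1 d2 by simp
    fix n :: nat and u v :: "nat \<Rightarrow> real"
    assume *: "(\<forall>i<n. u i \<le> v i \<and> {u i..v i} \<subseteq> S) \<and> disjoint_family_on (\<lambda>i. {u i<..<v i}) {..<n} \<and>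
        (\<Sum>i<n. v i - u i) < min d1 d2"
    have "(\<Sum>i<n. \<bar>h (v i) - h (u i)\<bar>) \<le> (\<Sum>i<n. (\<bar>L\<bar> + 1) * (\<bar>f (v i) - f (u i)\<bar> + \<bar>g (v i) - g (u i)\<bar>))"
    proof (rule sum_mono)
      fix i assume "i \<in> {..<n}"
      with * have "u i \<le> v i" "{u i..v i} \<subseteq> S" by auto
      then have "u i \<in> S" "v i \<in> S" by auto
      then have "\<bar>h (v i) - h (u i)\<bar> \<le> L * (\<bar>f (v i) - f (u i)\<bar> + \<bar>g (v i) - g (u i)\<bar>)"
        using assms(3) by blast
      also have "\<dots> \<le> (\<bar>L\<bar> + 1) * (\<bar>f (v i) - f (u i)\<bar> + \<bar>g (v i) - g (u i)\<bar>)"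
        by (intro mult_right_mono) auto
      finally show "\<bar>h (v i) - h (u i)\<bar> \<le> \<dots>" .
    qed
    also have "\<dots> = (\<bar>L\<bar> + 1) * ((\<Sum>i<n. \<bar>f (v i) - f (u i)\<bar>) + (\<Sum>i<n. \<bar>g (v i) - g (u i)\<bar>))"
      by (simp only: sum_distrib_left[symmetric] sum.distrib)
    also have "\<dots> < (\<bar>L\<bar> + 1) * (e + e)"
    proof (intro mult_strict_left_mono add_strict_mono)
      show "(\<Sum>i<n. \<bar>f (v i) - f (u i)\<bar>) < e" by (rule d1(2)) (use * in simp)
      show "(\<Sum>i<n. \<bar>g (v i) - g (u i)\<bar>) < e" by (rule d2(2)) (use * in simp)
    qed simp
    also have "\<dots> = \<epsilon>"
    proof -
      have "\<bar>L\<bar> + 1 \<noteq> 0" by linarith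
      moreover have "c * (\<epsilon> / (2 * c) + \<epsilon> / (2 * c)) = \<epsilon>" if "c \<noteq> 0" for c
        using that by (simp add: field_simps)
      ultimately show ?thesis unfolding e_def by blast
    qed
    finally show "(\<Sum>i<n. \<bar>h (v i) - h (u i)\<bar>) < \<epsilon>" .
  qed
qed

lemma abs_continuous_on_imp_continuous_on:
  assumes "abs_continuous_on {a..b} f"
  shows "continuous_on {a..b} f"
  unfolding continuous_on_iff
proof (intro ballI allI impI)
  fix x e assume x: "x \<in> {a..b}" and "(e::real) > 0"
  obtain d where "d > 0" and d: "\<And>(n::nat) u v. \<lbrakk>(\<forall>i<n. u i \<le> v i \<and> {u i..v i} \<subseteq> {a..b}) \<and>
       disjoint_family_on (\<lambda>i. {u i<..<v i}) {..<n} \<and> (\<Sum>i<n. v i - u i) < d\<rbrakk>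
       \<Longrightarrow> (\<Sum>i<n. \<bar>f (v i) - f (u i)\<bar>) < e"
    using assms \<open>e > 0\<close> unfolding abs_continuous_on_def by meson
  have *: "\<bar>f v - f u\<bar> < e" if "u \<le> v" "u \<in> {a..b}" "v \<in> {a..b}" "v - u < d" for u v
    using d[of 1 "\<lambda>_. u" "\<lambda>_. v"] that by (auto simp: disjoint_family_on_def)
  then have "dist (f y) (f x) < e" if "y \<in> {a..b}" "dist y x < d" for y
    using that x *[of y x] *[of x y] by (cases "y \<le> x") (simp_all add: dist_real_def abs_minus_commute)
  then show "\<exists>d>0. \<forall>x'\<in>{a..b}. dist x' x < d \<longrightarrow> dist (f x') (f x) < e"
    using \<open>d > 0\<close> by blast
qed

text \<open>Only points of the open interval off a null set are constrained, so the values of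
  \<open>g\<close> at end points and on null sets are free. Integrability of \<open>g\<close> is a
  consequence, through the fundamental theorem of calculus.\<close>

definition ac_deriv :: "real \<Rightarrow> real \<Rightarrow> (real \<Rightarrow> real) \<Rightarrow> (real \<Rightarrow> real) \<Rightarrow> bool" where
  "ac_deriv a b f g \<longleftrightarrow> abs_continuous_on {a..b} f \<and>
     (\<exists>N. negligible N \<and> (\<forall>x\<in>{a<..<b} - N. (f has_real_derivative g x) (at x)))"

lemma ac_deriv_continuous: "ac_deriv a b f g \<Longrightarrow> continuous_on {a..b} f"
  by (auto simp: ac_deriv_def abs_continuous_on_imp_continuous_on)

lemma ac_deriv_subinterval:
  assumes "ac_deriv a b f g" "{c..d} \<subseteq> {a..b}"
  shows "ac_deriv c d f g"
proof (cases "c \<le> d")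
  case True
  then have "{c<..<d} \<subseteq> {a<..<b}" using assms(2) by auto
  moreover obtain N where "negligible N" "\<And>x. x\<in>{a<..<b} - N \<Longrightarrow> (f has_real_derivative g x) (at x)"
    using assms(1) unfolding ac_deriv_def by auto
  ultimately have "negligible N \<and> (\<forall>x\<in>{c<..<d} - N. (f has_real_derivative g x) (at x))" by auto
  moreover have "abs_continuous_on {c..d} f"
    using assms abs_continuous_on_subset unfolding ac_deriv_def by auto
  ultimately show ?thesis unfolding ac_deriv_def by auto
next
  case False
  then have "{c<..<d} = {}" by auto
  moreover have "abs_continuous_on {c..d} f"
    using assms abs_continuous_on_subset unfolding ac_deriv_def by auto
  ultimately show ?thesis unfolding ac_deriv_def by (auto intro: exI[of _ "{}"])
qed

text \<open>Separates the two duties of a calculus rule: the increment bound transfers absolute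
  continuity, and the pointwise rule is applied off the union of the two null sets.\<close>

lemma ac_deriv_dominated:
  assumes "ac_deriv a b f f'" "ac_deriv a b g g'"
    and "\<And>x y. \<lbrakk>x \<in> {a..b}; y \<in> {a..b}\<rbrakk> \<Longrightarrow> \<bar>h x - h y\<bar> \<le> L * (\<bar>f x - f y\<bar> + \<bar>g x - g y\<bar>)"
    and "\<And>x. \<lbrakk>x \<in> {a<..<b}; (f has_real_derivative f' x) (at x); (g has_real_derivative g' x) (at x)\<rbrakk>
          \<Longrightarrow> (h has_real_derivative h' x) (at x)"
  shows "ac_deriv a b h h'"
proof -
  obtain N M where "negligible N" "negligible M"
    "\<And>x. x\<in>{a<..<b} - N \<Longrightarrow> (f has_real_derivative f' x) (at x)"
    "\<And>x. x\<in>{a<..<b} - M \<Longrightarrow> (g has_real_derivative g' x) (at x)"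
    using assms(1,2) unfolding ac_deriv_def by blast
  then have "negligible (N \<union> M)" "\<forall>x\<in>{a<..<b} - (N \<union> M). (h has_real_derivative h' x) (at x)"
    using assms(4) by (auto intro: negligible_Un)
  moreover have "abs_continuous_on {a..b} h"
    by (rule abs_continuous_on_dominated[OF _ _ assms(3)]) (use assms(1,2) in \<open>auto simp: ac_deriv_def\<close>)
  ultimately show ?thesis unfolding ac_deriv_def by blast
qed

lemma ac_deriv_cong:
  assumes "ac_deriv a b f f'" "\<And>x. x \<in> {a..b} \<Longrightarrow> f x = g x" "\<And>x. x \<in> {a<..<b} \<Longrightarrow> f' x = g' x"
  shows "ac_deriv a b g g'"
proof (rule ac_deriv_dominated[OF assms(1,1), where L = 1])
  fix x assume "x \<in> {a<..<b}" "(f has_real_derivative f' x) (at x)"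
  then show "(g has_real_derivative g' x) (at x)"
    using has_field_derivative_transform_within_open[of f "f' x" x "{a<..<b}" g] assms by auto
qed (simp add: assms(2))

lemma ac_deriv_lipschitz:
  assumes "\<And>x y. \<lbrakk>x \<in> {a..b}; y \<in> {a..b}\<rbrakk> \<Longrightarrow> \<bar>f x - f y\<bar> \<le> L * \<bar>x - y\<bar>"
    and "\<And>x. x \<in> {a<..<b} \<Longrightarrow> (f has_real_derivative f' x) (at x)"
  shows "ac_deriv a b f f'"
proof -
  have "abs_continuous_on {a..b} (\<lambda>x. x)"
    unfolding abs_continuous_on_def
  proof (intro allI impI)
    fix \<epsilon> :: real assume "\<epsilon> > 0"
    have "(\<Sum>i<n. \<bar>v i - u i\<bar>) = (\<Sum>i<n. v i - u i)" if "\<forall>i<n. u i \<le> v i" for n and u v :: "nat \<Rightarrow> real"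
      using that by (intro sum.cong) auto
    with \<open>\<epsilon> > 0\<close> show "\<exists>\<delta>>0. \<forall>(n::nat) u v. (\<forall>i<n. u i \<le> v i \<and> {u i..v i} \<subseteq> {a..b}) \<and>
      disjoint_family_on (\<lambda>i. {u i<..<v i}) {..<n} \<and> (\<Sum>i<n. v i - u i) < \<delta> \<longrightarrow> (\<Sum>i<n. \<bar>v i - u i\<bar>) < \<epsilon>"
      by (intro exI[of _ \<epsilon>]) auto
  qed
  then have id: "ac_deriv a b (\<lambda>x. x) (\<lambda>x. 1)"
    unfolding ac_deriv_def by (auto intro!: exI[of _ "{}"] derivative_intros)
  show ?thesis
  proof (rule ac_deriv_dominated[OF id id, where L = "\<bar>L\<bar>"])
    fix x y assume "x \<in> {a..b}" "y \<in> {a..b}"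
    then have "\<bar>f x - f y\<bar> \<le> L * \<bar>x - y\<bar>" using assms(1) by blast
    also have "\<dots> \<le> \<bar>L\<bar> * (\<bar>x - y\<bar> + \<bar>x - y\<bar>)" by (intro mult_mono) auto
    finally show "\<bar>f x - f y\<bar> \<le> \<dots>" .
  qed (use assms in auto)
qed

lemma lipschitz_of_continuous_derivative:
  fixes F F' :: "real \<Rightarrow> real"
  assumes "\<And>u. u \<in> {c..d} \<Longrightarrow> (F has_real_derivative F' u) (at u within {c..d})" "continuous_on {c..d} F'"
  obtains L where "\<And>x y. \<lbrakk>x \<in> {c..d}; y \<in> {c..d}\<rbrakk> \<Longrightarrow> \<bar>F x - F y\<bar> \<le> L * \<bar>x - y\<bar>"
proof -
  have "bounded (F' ` {c..d})"
    using assms(2) by (intro compact_imp_bounded compact_continuous_image) auto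
  then obtain L where L: "\<And>u. u \<in> {c..d} \<Longrightarrow> \<bar>F' u\<bar> \<le> L"
    unfolding bounded_iff by fastforce
  show thesis
  proof (rule that)
    fix x y assume "x \<in> {c..d}" "y \<in> {c..d}"
    then show "\<bar>F x - F y\<bar> \<le> L * \<bar>x - y\<bar>"
      using field_differentiable_bound[of "{c..d}" F F' L x y] assms(1) L by auto
  qed
qed

lemma ac_deriv_C1:
  assumes "\<And>x. x \<in> {a..b} \<Longrightarrow> (f has_real_derivative f' x) (at x)" "continuous_on {a..b} f'"
  shows "ac_deriv a b f f'"
proof -
  obtain L where "\<And>x y. \<lbrakk>x \<in> {a..b}; y \<in> {a..b}\<rbrakk> \<Longrightarrow> \<bar>f x - f y\<bar> \<le> L * \<bar>x - y\<bar>"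
    using lipschitz_of_continuous_derivative[of a b f f'] assms by (metis has_field_derivative_at_within)
  then show ?thesis by (rule ac_deriv_lipschitz) (use assms(1) in auto)
qed

lemma ac_deriv_chain:
  assumes f: "ac_deriv a b f f'" and F: "\<And>u. u \<in> f ` {a..b} \<Longrightarrow> (F has_real_derivative F' u) (at u)"
    and cont: "continuous_on (f ` {a..b}) F'"
  shows "ac_deriv a b (\<lambda>x. F (f x)) (\<lambda>x. F' (f x) * f' x)"
proof -
  obtain c d where cd: "f ` {a..b} = {c..d}"
  proof (cases "a \<le> b")
    case True
    then show ?thesis using continuous_image_closed_interval[OF True ac_deriv_continuous[OF f]] that by blast
  next
    case False
    \<comment> \<open>For \<open>a > b\<close> the image is empty, and so is
      \<open>{1..0}\<close>.\<close>
    then show ?thesis using that[of 1 0] by auto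
  qed
  obtain L where L: "\<And>x y. \<lbrakk>x \<in> {c..d}; y \<in> {c..d}\<rbrakk> \<Longrightarrow> \<bar>F x - F y\<bar> \<le> L * \<bar>x - y\<bar>"
    using lipschitz_of_continuous_derivative[of c d F F'] F cont unfolding cd
    by (metis has_field_derivative_at_within)
  show ?thesis
  proof (rule ac_deriv_dominated[OF f f, where L = "\<bar>L\<bar>"])
    fix x y assume "x \<in> {a..b}" "y \<in> {a..b}"
    then have "\<bar>F (f x) - F (f y)\<bar> \<le> L * \<bar>f x - f y\<bar>" using L cd by blast
    also have "\<dots> \<le> \<bar>L\<bar> * (\<bar>f x - f y\<bar> + \<bar>f x - f y\<bar>)" by (intro mult_mono) auto
    finally show "\<bar>F (f x) - F (f y)\<bar> \<le> \<dots>" .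
  next
    fix x assume "x \<in> {a<..<b}" "(f has_real_derivative f' x) (at x)"
    then show "((\<lambda>x. F (f x)) has_real_derivative F' (f x) * f' x) (at x)"
      using DERIV_chain2[of F "F' (f x)" f x "f' x" UNIV] F by auto
  qed
qed

lemma ac_deriv_add:
  assumes "ac_deriv a b f f'" "ac_deriv a b g g'"
  shows "ac_deriv a b (\<lambda>x. f x + g x) (\<lambda>x. f' x + g' x)"
  by (rule ac_deriv_dominated[OF assms, where L = 1]) (auto intro!: derivative_eq_intros)

lemma ac_deriv_diff:
  assumes "ac_deriv a b f f'" "ac_deriv a b g g'"
  shows "ac_deriv a b (\<lambda>x. f x - g x) (\<lambda>x. f' x - g' x)"
  by (rule ac_deriv_dominated[OF assms, where L = 1]) (auto intro!: derivative_eq_intros)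

lemma ac_deriv_const: "ac_deriv a b (\<lambda>x. c) (\<lambda>x. 0)"
  by (rule ac_deriv_C1) auto

lemma ac_deriv_mult:
  assumes f: "ac_deriv a b f f'" and g: "ac_deriv a b g g'"
  shows "ac_deriv a b (\<lambda>x. f x * g x) (\<lambda>x. f' x * g x + f x * g' x)"
proof -
  have "bounded (f ` {a..b})" "bounded (g ` {a..b})"
    using ac_deriv_continuous f g compact_continuous_image compact_imp_bounded by blast+
  then obtain A B where A: "\<And>x. x \<in> {a..b} \<Longrightarrow> \<bar>f x\<bar> \<le> A" and B: "\<And>x. x \<in> {a..b} \<Longrightarrow> \<bar>g x\<bar> \<le> B"
    unfolding bounded_iff by fastforce
  show ?thesis
  proof (rule ac_deriv_dominated[OF assms, where L = "\<bar>A\<bar> + \<bar>B\<bar>"])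
    fix x y assume "x \<in> {a..b}" "y \<in> {a..b}"
    then have "\<bar>f y\<bar> \<le> \<bar>A\<bar> + \<bar>B\<bar>" "\<bar>g x\<bar> \<le> \<bar>A\<bar> + \<bar>B\<bar>" using A[of y] B[of x] by linarith+
    have "\<bar>f x * g x - f y * g y\<bar> = \<bar>(f x - f y) * g x + f y * (g x - g y)\<bar>" by (simp add: algebra_simps)
    also have "\<dots> \<le> \<bar>f x - f y\<bar> * \<bar>g x\<bar> + \<bar>f y\<bar> * \<bar>g x - g y\<bar>"
      by (metis abs_mult abs_triangle_ineq)
    also have "\<dots> \<le> \<bar>f x - f y\<bar> * (\<bar>A\<bar> + \<bar>B\<bar>) + (\<bar>A\<bar> + \<bar>B\<bar>) * \<bar>g x - g y\<bar>"
      using \<open>\<bar>f y\<bar> \<le> _\<close> \<open>\<bar>g x\<bar> \<le> _\<close> by (intro add_mono mult_mono) auto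
    finally show "\<bar>f x * g x - f y * g y\<bar> \<le> (\<bar>A\<bar> + \<bar>B\<bar>) * (\<bar>f x - f y\<bar> + \<bar>g x - g y\<bar>)"
      by (simp add: algebra_simps)
  qed (auto intro!: derivative_eq_intros)
qed

section \<open>The fundamental theorem of calculus for absolutely continuous functions\<close>

lemma sum_length_le_measure_open:
  fixes u v :: "'i \<Rightarrow> real"
  assumes "finite I" "disjoint_family_on (\<lambda>i. {u i<..<v i}) I" "\<And>i. i \<in> I \<Longrightarrow> u i \<le> v i"
    and "\<And>i. i \<in> I \<Longrightarrow> {u i<..<v i} \<subseteq> U" "U \<in> lmeasurable"
  shows "(\<Sum>i\<in>I. v i - u i) \<le> measure lebesgue U"
proof -
  have "(\<Sum>i\<in>I. v i - u i) = (\<Sum>i\<in>I. measure lebesgue {u i<..<v i})"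
    using assms(3) by (intro sum.cong) simp_all
  also have "\<dots> = measure lebesgue (\<Union>i\<in>I. {u i<..<v i})"
    using assms by (intro measure_finite_Union[symmetric]) (auto simp: emeasure_lborel_Ioo)
  also have "\<dots> \<le> measure lebesgue U"
    using assms(1,4,5) by (intro measure_mono_fmeasurable) auto
  finally show ?thesis .
qed

text \<open>The gauge has two jobs. At a tag outside \<open>N\<close> it makes the increment of
  \<open>f\<close> agree with \<open>g x\<close> times the length, up to \<open>e\<close> times the
  length. At a tag in \<open>N\<close> it confines the interval to an open \<open>U\<close> around
  \<open>N\<close> of measure below \<open>\<delta>\<close>, where absolute continuity makes the sum
  of the increments small.\<close>

lemma abs_continuous_ftc:
  assumes ab: "a \<le> b" and f: "abs_continuous_on {a..b} f" and N: "negligible N"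
    and der: "\<And>x. x \<in> {a..b} - N \<Longrightarrow> (f has_real_derivative g x) (at x within {a..b})"
  shows "(g has_integral (f b - f a)) {a..b}"
proof -
  \<comment> \<open>Zero on \<open>N\<close>, so that intervals tagged there contribute nothing to
    the Riemann sum.\<close>
  define g0 where "g0 x = (if x \<in> N then 0 else g x)" for x
  have "(g0 has_integral (f b - f a)) (cbox a b)"
    unfolding has_integral
  proof (intro allI impI)
    fix \<epsilon> :: real assume "\<epsilon> > 0"
    define e where "e = \<epsilon> / (2 * (b - a + 1))"
    have "e > 0" using \<open>\<epsilon> > 0\<close> ab by (simp add: e_def)
    have "\<exists>d>0. x \<in> {a..b} - N \<longrightarrow> (\<forall>y\<in>{a..b}. \<bar>y - x\<bar> < d \<longrightarrow> \<bar>f y - f x - g x * (y - x)\<bar> \<le> e * \<bar>y - x\<bar>)" for x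
    proof (cases "x \<in> {a..b} - N")
      case True
      then have "(f has_derivative (*) (g x)) (at x within {a..b})"
        using der by (simp add: has_field_derivative_def)
      then show ?thesis
        using \<open>e > 0\<close> unfolding has_derivative_within_alt by fastforce
    qed (auto intro: exI[of _ 1])
    then obtain d where d: "\<And>x. d x > 0"
      "\<And>x y. \<lbrakk>x \<in> {a..b} - N; y \<in> {a..b}; \<bar>y - x\<bar> < d x\<rbrakk> \<Longrightarrow> \<bar>f y - f x - g x * (y - x)\<bar> \<le> e * \<bar>y - x\<bar>"
      by metis
    \<comment> \<open>The intervals are indexed by the elements \<open>(x, K)\<close> of a tagged
      division; hence the form of absolute continuity for arbitrary finite index sets.\<close>
    obtain \<delta> where "\<delta> > 0" and \<delta>: "\<And>(I :: (real \<times> real set) set) u v. finite I \<and> (\<forall>i\<in>I. u i \<le> v i \<and> {u i..v i} \<subseteq> {a..b}) \<and>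
         disjoint_family_on (\<lambda>i. {u i<..<v i}) I \<and> (\<Sum>i\<in>I. v i - u i) < \<delta>
         \<Longrightarrow> (\<Sum>i\<in>I. \<bar>f (v i) - f (u i)\<bar>) < \<epsilon> / 2"
      using abs_continuous_on_finite[OF f half_gt_zero[OF \<open>\<epsilon> > 0\<close>], where 'i = "real \<times> real set"] by meson
    obtain U where U: "open U" "N \<subseteq> U" "U - N \<in> lmeasurable" "emeasure lebesgue (U - N) < ennreal \<delta>"
      using sets_lebesgue_outer_open[of N \<delta>] N \<open>\<delta> > 0\<close> by (metis negligible_imp_sets)
    have Um: "U \<in> lmeasurable" "measure lebesgue U < \<delta>"
    proof -
      have eq: "U = (U - N) \<union> N" using U by auto
      have Nm: "N \<in> lmeasurable" using N negligible_imp_measurable by auto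
      show "U \<in> lmeasurable" using eq U(3) Nm by (metis fmeasurable.Un)
      have "measure lebesgue U \<le> measure lebesgue (U - N) + measure lebesgue N"
        using measure_Un_le[of "U - N" lebesgue N] eq U(3) Nm by (simp add: fmeasurableD)
      also have "measure lebesgue N = 0" using N by (simp add: negligible_imp_measure0)
      also have "measure lebesgue (U - N) < \<delta>"
        using U(3,4) \<open>\<delta> > 0\<close> by (simp add: emeasure_eq_measure2 ennreal_less_iff)
      finally show "measure lebesgue U < \<delta>" by simp
    qed
    have "\<exists>d>0. x \<in> N \<longrightarrow> ball x d \<subseteq> U" for x
      using U(1,2) open_contains_ball[of U] by (metis subsetD zero_less_one)
    then obtain dN where dN: "\<And>x. dN x > 0" "\<And>x. x \<in> N \<Longrightarrow> ball x (dN x) \<subseteq> U" by metis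
    define \<gamma> where "\<gamma> x = ball x (min (d x) (dN x))" for x
    show "\<exists>\<gamma>. gauge \<gamma> \<and> (\<forall>\<D>. \<D> tagged_division_of (cbox a b) \<and> \<gamma> fine \<D> \<longrightarrow>
       norm ((\<Sum>(x,K)\<in>\<D>. measure lborel K *\<^sub>R g0 x) - (f b - f a)) < \<epsilon>)"
    proof (intro exI[of _ \<gamma>] conjI allI impI)
      show "gauge \<gamma>" unfolding \<gamma>_def using d(1) dN(1) by (intro gauge_ball_dependent) auto
      fix p assume "p tagged_division_of (cbox a b) \<and> \<gamma> fine p"
      then have p: "p tagged_division_of {a..b}" and fine: "\<gamma> fine p" by auto
      have finp: "finite p" using p by auto
      define l r where "l = (\<lambda>z::real \<times> real set. Inf (snd z))" and "r = (\<lambda>z::real \<times> real set. Sup (snd z))"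
      have K: "snd z = {l z..r z}" "l z \<le> fst z" "fst z \<le> r z" "a \<le> l z" "r z \<le> b" if z: "z \<in> p" for z
      proof -
        obtain x K where zx: "z = (x, K)" by (cases z)
        obtain u v where uv: "K = cbox u v" "x \<in> K" "K \<subseteq> {a..b}"
          using p z zx by blast
        then have "u \<le> v" by auto
        with uv zx show "snd z = {l z..r z}" "l z \<le> fst z" "fst z \<le> r z" "a \<le> l z" "r z \<le> b"
          by (auto simp: l_def r_def)
      qed
      have rl: "l z \<le> r z" if "z \<in> p" for z using K(2,3)[OF that] by linarith
      have sub: "snd z \<subseteq> \<gamma> (fst z)" if "z \<in> p" for z using fine that by (cases z) auto
      have disj: "disjoint_family_on (\<lambda>i. {l i<..<r i}) p"
        unfolding disjoint_family_on_def
      proof (intro ballI impI)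
        fix z w assume zw: "z \<in> p" "w \<in> p" "z \<noteq> w"
        have "interior (snd z) \<inter> interior (snd w) = {}"
          using tagged_division_ofD(5)[OF p, of "fst z" "snd z" "fst w" "snd w"] zw by simp
        then show "{l z<..<r z} \<inter> {l w<..<r w} = {}"
          using K(1)[OF zw(1)] K(1)[OF zw(2)] by (simp add: interior_atLeastAtMost_real)
      qed
      have b1: "b - a = (\<Sum>z\<in>p. r z - l z)"
        using additive_tagged_division_1[OF ab p, of "\<lambda>x. x"] by (simp add: l_def r_def split_beta)
      have b2: "f b - f a = (\<Sum>z\<in>p. f (r z) - f (l z))"
        using additive_tagged_division_1[OF ab p, of f] by (simp add: l_def r_def split_beta)
      define T where "T z = (r z - l z) * g0 (fst z) - (f (r z) - f (l z))" for z
      have "(\<Sum>(x,K)\<in>p. measure lborel K *\<^sub>R g0 x) = (\<Sum>z\<in>p. (r z - l z) * g0 (fst z))"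
        using K(1) rl by (intro sum.cong) (auto simp: split_beta)
      then have eq: "(\<Sum>(x,K)\<in>p. measure lborel K *\<^sub>R g0 x) - (f b - f a) = (\<Sum>z\<in>p. T z)"
        unfolding b2 T_def by (simp add: sum_subtractf)
      define A where "A = {z \<in> p. fst z \<in> N}"
      have fA: "finite A" "A \<subseteq> p" using finp by (auto simp: A_def)
      have sN: "(\<Sum>z\<in>A. \<bar>T z\<bar>) < \<epsilon> / 2"
      proof -
        have "(\<Sum>z\<in>A. \<bar>T z\<bar>) = (\<Sum>z\<in>A. \<bar>f (r z) - f (l z)\<bar>)"
          by (intro sum.cong) (auto simp: A_def T_def g0_def)
        also have "\<dots> < \<epsilon> / 2"
        proof (intro \<delta> conjI ballI)
          show "finite A" by fact
          show "l z \<le> r z" "{l z..r z} \<subseteq> {a..b}" if "z \<in> A" for z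
            using that fA K[of z] by auto
          show dA: "disjoint_family_on (\<lambda>i. {l i<..<r i}) A"
            using disjoint_family_on_mono[OF fA(2) disj] .
          have "(\<Sum>z\<in>A. r z - l z) \<le> measure lebesgue U"
          proof (rule sum_length_le_measure_open[OF fA(1) dA _ _ Um(1)])
            show "{l z<..<r z} \<subseteq> U" if "z \<in> A" for z
            proof -
              have "z \<in> p" "fst z \<in> N" using that by (auto simp: A_def)
              then have "snd z \<subseteq> ball (fst z) (dN (fst z))" using sub[of z] unfolding \<gamma>_def by auto
              then show ?thesis using dN(2)[OF \<open>fst z \<in> N\<close>] K(1)[OF \<open>z \<in> p\<close>] by fastforce
            qed
          qed (use rl fA in auto)
          then show "(\<Sum>z\<in>A. r z - l z) < \<delta>" using Um(2) by simp
        qed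
        finally show ?thesis .
      qed
      have sR: "(\<Sum>z\<in>p - A. \<bar>T z\<bar>) \<le> \<epsilon> / 2"
      proof -
        have "\<bar>T z\<bar> \<le> e * (r z - l z)" if "z \<in> p - A" for z
        proof -
          have z: "z \<in> p" "fst z \<notin> N" using that by (auto simp: A_def)
          note Kz = K[OF z(1)]
          have x: "fst z \<in> {a..b} - N" using Kz z(2) by auto
          have "l z \<in> snd z" "r z \<in> snd z" using Kz by auto
          then have "l z \<in> ball (fst z) (d (fst z))" "r z \<in> ball (fst z) (d (fst z))"
            using sub[OF z(1)] unfolding \<gamma>_def by auto
          then have "\<bar>f (l z) - f (fst z) - g (fst z) * (l z - fst z)\<bar> \<le> e * \<bar>l z - fst z\<bar>"
            "\<bar>f (r z) - f (fst z) - g (fst z) * (r z - fst z)\<bar> \<le> e * \<bar>r z - fst z\<bar>"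
            using d(2)[OF x, of "l z"] d(2)[OF x, of "r z"] Kz by (auto simp: dist_real_def abs_minus_commute)
          \<comment> \<open>The tag splits the interval in two; the total error is the difference of
            the errors at its end points, and the two lengths add up to
            \<open>r z - l z\<close>.\<close>
          moreover have "T z = (f (l z) - f (fst z) - g (fst z) * (l z - fst z)) - (f (r z) - f (fst z) - g (fst z) * (r z - fst z))"
            using z by (simp add: T_def g0_def algebra_simps)
          ultimately have "\<bar>T z\<bar> \<le> e * \<bar>l z - fst z\<bar> + e * \<bar>r z - fst z\<bar>" by linarith
          also have "\<dots> = e * (r z - l z)" using Kz by (simp add: algebra_simps)
          finally show ?thesis .
        qed
        then have "(\<Sum>z\<in>p - A. \<bar>T z\<bar>) \<le> (\<Sum>z\<in>p - A. e * (r z - l z))" by (intro sum_mono) auto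
        also have "\<dots> \<le> (\<Sum>z\<in>p. e * (r z - l z))"
          using finp rl \<open>e > 0\<close> by (intro sum_mono2) auto
        also have "\<dots> = e * (b - a)" by (simp add: b1 sum_distrib_left)
        also have "\<dots> \<le> \<epsilon> / 2" using ab \<open>\<epsilon> > 0\<close> by (simp add: e_def field_simps)
        finally show ?thesis .
      qed
      have "\<bar>\<Sum>z\<in>p. T z\<bar> \<le> (\<Sum>z\<in>p. \<bar>T z\<bar>)" by (rule sum_abs)
      also have "\<dots> = (\<Sum>z\<in>p - A. \<bar>T z\<bar>) + (\<Sum>z\<in>A. \<bar>T z\<bar>)"
        by (rule sum.subset_diff[OF fA(2) finp])
      also have "\<dots> < \<epsilon>" using sN sR by linarith
      finally show "norm ((\<Sum>(x,K)\<in>p. measure lborel K *\<^sub>R g0 x) - (f b - f a)) < \<epsilon>"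
        by (simp only: eq real_norm_def)
    qed
  qed
  then show ?thesis
    using N by (auto intro: has_integral_spike[of N "{a..b}" g g0] simp: g0_def)
qed

lemma ac_deriv_ftc:
  assumes "ac_deriv a b f g" "a \<le> b"
  shows "(g has_integral (f b - f a)) {a..b}"
proof -
  obtain N where "negligible N" "\<And>x. x\<in>{a<..<b} - N \<Longrightarrow> (f has_real_derivative g x) (at x)"
    using assms(1) unfolding ac_deriv_def by auto
  then have "negligible (N \<union> {a,b})"
    "\<And>x. x\<in>{a..b} - (N \<union> {a,b}) \<Longrightarrow> (f has_real_derivative g x) (at x within {a..b})"
    by (auto intro: has_field_derivative_at_within)
  then show ?thesis using abs_continuous_ftc assms unfolding ac_deriv_def by blast
qed

lemma ac_deriv_integral_eq:
  assumes "ac_deriv a b f g" "a \<le> x" "x \<le> b"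
  shows "integral {a..x} g = f x - f a"
  using ac_deriv_ftc[OF ac_deriv_subinterval[OF assms(1), of a x]] assms by (auto intro: integral_unique)

lemma ac_deriv_mono:
  assumes "ac_deriv a b f g" "\<And>x. x \<in> {a<..<b} \<Longrightarrow> g x \<ge> 0" "a \<le> b"
  shows "f a \<le> f b"
proof -
  have *: "max (g x) 0 = g x" if "x \<in> {a..b} - {a,b}" for x
    using assms(2)[of x] that by auto
  \<comment> \<open>\<open>g\<close> may be negative at the two end points, where nothing is
    assumed; \<open>max (g x) 0\<close> differs from it only there.\<close>
  have "((\<lambda>x. max (g x) 0) has_integral (f b - f a)) {a..b}"
    by (rule has_integral_spike[OF _ _ ac_deriv_ftc[OF assms(1,3)], of "{a,b}"]) (use * in auto)
  then have "0 \<le> f b - f a" by (rule has_integral_nonneg) auto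
  then show ?thesis by simp
qed

text \<open>Truncation: \<open>\<bar>g\<bar>\<close> is at most \<open>m\<close> plus a remainder
  \<open>h\<close> of integral below \<open>\<epsilon> / 2\<close>. On intervals of total length
  below \<open>\<epsilon> / (2 (m + 1))\<close> the part bounded by \<open>m\<close> contributes at
  most \<open>\<epsilon> / 2\<close> as well.\<close>

lemma integral_absolutely_continuous:
  assumes g: "g absolutely_integrable_on {a..b}"
  shows "abs_continuous_on {a..b} (\<lambda>x. integral {a..x} g)"
proof -
  have gi: "(\<lambda>x. \<bar>g x\<bar>) integrable_on {a..b}"
    using g by (simp add: absolutely_integrable_on_def)
  have mi: "(\<lambda>x. min \<bar>g x\<bar> (real m)) absolutely_integrable_on {a..b}" for m
    using absolutely_integrable_min_1[OF absolutely_integrable_abs[OF g] absolutely_integrable_on_const] 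
    by auto
  have lim: "(\<lambda>m. integral {a..b} (\<lambda>x. min \<bar>g x\<bar> (real m))) \<longlonglongrightarrow> integral {a..b} (\<lambda>x. \<bar>g x\<bar>)"
  proof (rule dominated_convergence(2)[OF _ gi])
    fix x assume "x \<in> {a..b}"
    obtain m0 where "\<bar>g x\<bar> \<le> real m0" using real_arch_simple by blast
    then have "\<forall>\<^sub>F m in sequentially. min \<bar>g x\<bar> (real m) = \<bar>g x\<bar>"
      by (intro eventually_sequentiallyI[of m0] min_absorb1) (meson of_nat_le_iff order_trans)
    then show "(\<lambda>m. min \<bar>g x\<bar> (real m)) \<longlonglongrightarrow> \<bar>g x\<bar>" by (rule tendsto_eventually)
  qed (use mi in \<open>auto simp: absolutely_integrable_on_def\<close>)
  show ?thesis
    unfolding abs_continuous_on_def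
  proof (intro allI impI)
    fix \<epsilon> :: real assume "\<epsilon> > 0"
    obtain m where m: "\<bar>integral {a..b} (\<lambda>x. min \<bar>g x\<bar> (real m)) - integral {a..b} (\<lambda>x. \<bar>g x\<bar>)\<bar> < \<epsilon> / 2"
      using lim \<open>\<epsilon> > 0\<close> by (metis LIMSEQ_D half_gt_zero order_refl real_norm_def)
    define h where "h x = \<bar>g x\<bar> - min \<bar>g x\<bar> (real m)" for x
    have hi: "h integrable_on {a..b}" unfolding h_def
      using gi mi[of m] by (intro integrable_diff) (auto simp: absolutely_integrable_on_def)
    have hn: "h x \<ge> 0" for x by (simp add: h_def)
    have hI: "integral {a..b} h < \<epsilon> / 2"
    proof -
      have "integral {a..b} h = integral {a..b} (\<lambda>x. \<bar>g x\<bar>) - integral {a..b} (\<lambda>x. min \<bar>g x\<bar> (real m))"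
        unfolding h_def using integral_diff[OF gi] mi[of m] by (simp add: absolutely_integrable_on_def)
      then show ?thesis using m by linarith
    qed
    show "\<exists>\<delta>>0. \<forall>(n::nat) u v. (\<forall>i<n. u i \<le> v i \<and> {u i..v i} \<subseteq> {a..b}) \<and>
        disjoint_family_on (\<lambda>i. {u i<..<v i}) {..<n} \<and> (\<Sum>i<n. v i - u i) < \<delta> \<longrightarrow>
        (\<Sum>i<n. \<bar>integral {a..v i} g - integral {a..u i} g\<bar>) < \<epsilon>"
    proof (intro exI[of _ "\<epsilon> / (2 * (real m + 1))"] conjI allI impI)
      show "0 < \<epsilon> / (2 * (real m + 1))" using \<open>\<epsilon> > 0\<close> by simp
      fix n :: nat and u v :: "nat \<Rightarrow> real"
      assume asm: "(\<forall>i<n. u i \<le> v i \<and> {u i..v i} \<subseteq> {a..b}) \<and>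
        disjoint_family_on (\<lambda>i. {u i<..<v i}) {..<n} \<and> (\<Sum>i<n. v i - u i) < \<epsilon> / (2 * (real m + 1))"
      have sub: "u i \<le> v i" "a \<le> u i" "v i \<le> b" if "i < n" for i using asm that by auto
      have hsub: "h integrable_on {u i..v i}" if "i < n" for i
        using hi sub[OF that] by (auto intro: integrable_on_subinterval)
      have one: "\<bar>integral {a..v i} g - integral {a..u i} g\<bar> \<le> integral {u i..v i} h + real m * (v i - u i)" if "i < n" for i
      proof -
        have gint: "g integrable_on {a..v i}" "g integrable_on {u i..v i}"
          using g sub[OF that] by (auto intro: integrable_on_subinterval simp: absolutely_integrable_on_def)
        have "integral {a..v i} g - integral {a..u i} g = integral {u i..v i} g"
          using Henstock_Kurzweil_Integration.integral_combine[of a "u i" "v i" g] sub[OF that] gint by simp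
        moreover have "\<bar>integral {u i..v i} g\<bar> \<le> integral {u i..v i} (\<lambda>x. h x + real m)"
        proof -
          have "norm (integral {u i..v i} g) \<le> integral {u i..v i} (\<lambda>x. h x + real m)"
          proof (rule integral_norm_bound_integral)
            show "(\<lambda>x. h x + real m) integrable_on {u i..v i}"
              using hsub[OF that] by (intro integrable_add integrable_const_ivl)
          qed (use gint in \<open>auto simp: h_def\<close>)
          then show ?thesis by simp
        qed
        moreover have "integral {u i..v i} (\<lambda>x. h x + real m) = integral {u i..v i} h + real m * (v i - u i)"
          using integral_add[OF hsub[OF that] integrable_const_ivl[of "real m"]] sub[OF that] by (simp add: mult.commute)
        ultimately show ?thesis by simp
      qed
      have hs: "(\<Sum>i<n. integral {u i..v i} h) \<le> integral {a..b} h"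
      proof -
        have U: "(h has_integral (\<Sum>i<n. integral {u i<..<v i} h)) (\<Union>i\<in>{..<n}. {u i<..<v i})"
        proof (rule has_integral_UN)
          show "(h has_integral integral {u i<..<v i} h) {u i<..<v i}" if "i \<in> {..<n}" for i
            using hsub[of i] that by (auto intro!: integrable_integral simp: integrable_on_open_interval_real)
          show "pairwise (\<lambda>i i'. negligible ({u i<..<v i} \<inter> {u i'<..<v i'})) {..<n}"
            using asm by (auto simp: pairwise_def disjoint_family_on_def)
        qed simp
        have "(\<Sum>i<n. integral {u i..v i} h) = integral (\<Union>i\<in>{..<n}. {u i<..<v i}) h"
          using integral_unique[OF U] by (simp add: integral_open_interval_real)
        also have "\<dots> \<le> integral {a..b} h"
        proof (rule integral_subset_le)
          show "(\<Union>i\<in>{..<n}. {u i<..<v i}) \<subseteq> {a..b}" using sub by fastforce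
          show "h integrable_on (\<Union>i\<in>{..<n}. {u i<..<v i})" using U by blast
        qed (use hi hn in auto)
        finally show ?thesis .
      qed
      have "(\<Sum>i<n. \<bar>integral {a..v i} g - integral {a..u i} g\<bar>)
         \<le> (\<Sum>i<n. integral {u i..v i} h + real m * (v i - u i))"
        using one by (intro sum_mono) auto
      also have "\<dots> = (\<Sum>i<n. integral {u i..v i} h) + real m * (\<Sum>i<n. v i - u i)"
        by (simp add: sum.distrib sum_distrib_left)
      also have "\<dots> < \<epsilon> / 2 + \<epsilon> / 2"
      proof (rule add_less_le_mono)
        show "(\<Sum>i<n. integral {u i..v i} h) < \<epsilon> / 2" using hs hI by simp
        have "real m * (\<Sum>i<n. v i - u i) \<le> real m * (\<epsilon> / (2 * (real m + 1)))"
          using asm by (intro mult_left_mono) auto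
        also have "\<dots> \<le> \<epsilon> / 2" using \<open>\<epsilon> > 0\<close> by (simp add: field_simps)
        finally show "real m * (\<Sum>i<n. v i - u i) \<le> \<epsilon> / 2" .
      qed
      finally show "(\<Sum>i<n. \<bar>integral {a..v i} g - integral {a..u i} g\<bar>) < \<epsilon>" by simp
    qed
  qed
qed


text \<open>Lebesgue differentiation in two halves. Averages over intervals to the right of
  \<open>x\<close> converge almost everywhere; those to the left are right averages of the reflected
  function \<open>\<lambda>x. g1 (-x)\<close>. Extending \<open>g\<close> by zero to
  \<open>g1\<close> makes it integrable on every interval.\<close>

lemma integral_has_derivative_ae:
  fixes g :: "real \<Rightarrow> real"
  assumes "g integrable_on {a..b}"
  shows "\<exists>N. negligible N \<and> (\<forall>x\<in>{a<..<b} - N. ((\<lambda>x. integral {a..x} g) has_real_derivative g x) (at x))"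
proof -
  define g1 where "g1 x = (if x \<in> {a..b} then g x else 0)" for x
  have "g1 integrable_on UNIV"
    using assms unfolding g1_def integrable_restrict_UNIV .
  then have g1: "g1 integrable_on {c..d}" for c d
    using integrable_on_subinterval by blast
  then have g2: "(\<lambda>x. g1 (-x)) integrable_on {c..d}" for c d
    using Henstock_Kurzweil_Integration.integrable_reflect_real[where f = g1 and a = "-d" and b = "-c"] by simp
  obtain N1 where N1: "negligible N1" "\<And>x e. \<lbrakk>x \<notin> N1; 0 < e\<rbrakk> \<Longrightarrow>
     \<exists>d>0. \<forall>h. 0 < h \<and> h < d \<longrightarrow> \<bar>integral {x..x + h} g1 / h - g1 x\<bar> < e"
    using integrable_ccontinuous_explicit[of g1] g1 by (auto simp: divide_inverse mult.commute)
  obtain N2 where N2: "negligible N2" "\<And>x e. \<lbrakk>x \<notin> N2; 0 < e\<rbrakk> \<Longrightarrow>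
     \<exists>d>0. \<forall>h. 0 < h \<and> h < d \<longrightarrow> \<bar>integral {x..x + h} (\<lambda>x. g1 (-x)) / h - g1 (-x)\<bar> < e"
    using integrable_ccontinuous_explicit[of "\<lambda>x. g1 (-x)"] g2 by (auto simp: divide_inverse mult.commute)
  define N where "N = N1 \<union> uminus ` N2"
  have "negligible N" unfolding N_def
    using N1(1) N2(1) by (intro negligible_Un negligible_differentiable_image_negligible) (auto intro!: derivative_intros)
  moreover have "((\<lambda>x. integral {a..x} g) has_real_derivative g x) (at x)" if x: "x \<in> {a<..<b} - N" for x
    unfolding has_field_derivative_def has_derivative_at_alt
  proof (intro conjI allI impI bounded_linear_mult_right)
    fix e :: real assume "e > 0"
    have xN: "x \<notin> N1" "-x \<notin> N2" using x by (force simp: N_def)+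
    obtain d1 where d1: "d1 > 0" "\<And>h. \<lbrakk>0 < h; h < d1\<rbrakk> \<Longrightarrow> \<bar>integral {x..x + h} g1 / h - g1 x\<bar> < e"
      using N1(2)[OF xN(1) \<open>e > 0\<close>] by blast
    obtain d2 where d2: "d2 > 0" "\<And>h. \<lbrakk>0 < h; h < d2\<rbrakk> \<Longrightarrow> \<bar>integral {-x..-x + h} (\<lambda>x. g1 (-x)) / h - g1 x\<bar> < e"
      using N2(2)[OF xN(2) \<open>e > 0\<close>] by auto
    have gx: "g1 x = g x" using x by (simp add: g1_def)
    have diff: "integral {a..v} g - integral {a..u} g = integral {u..v} g1" if "a \<le> u" "u \<le> v" "v \<le> b" for u v
    proof -
      have "integral {a..u} g + integral {u..v} g = integral {a..v} g"
        using that assms by (intro Henstock_Kurzweil_Integration.integral_combine)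
          (auto intro: integrable_on_subinterval)
      moreover have "integral {u..v} g = integral {u..v} g1"
        using that by (intro integral_cong) (auto simp: g1_def)
      ultimately show ?thesis by simp
    qed
    define d where "d = Min {d1, d2, x - a, b - x}"
    have d: "d > 0" "d \<le> d1" "d \<le> d2" "d \<le> x - a" "d \<le> b - x"
      using d1 d2 x by (auto simp: d_def)
    show "\<exists>d>0. \<forall>y. norm (y - x) < d \<longrightarrow>
       norm (integral {a..y} g - integral {a..x} g - g x * (y - x)) \<le> e * norm (y - x)"
    proof (intro exI[of _ d] conjI allI impI)
      fix y assume y: "norm (y - x) < d"
      consider "y = x" | "y > x" | "y < x" by linarith
      then show "norm (integral {a..y} g - integral {a..x} g - g x * (y - x)) \<le> e * norm (y - x)"
      proof cases
        case 2
        define h where "h = y - x"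
        have h: "h > 0" "y = x + h" "h < d" using 2 y by (auto simp: h_def)
        have "\<bar>integral {x..x + h} g1 / h - g x\<bar> < e" using d1(2)[of h] h d gx by simp
        then have "\<bar>integral {x..x + h} g1 - g x * h\<bar> < e * h"
          using h by (simp add: abs_less_iff field_simps)
        moreover have "integral {a..y} g - integral {a..x} g = integral {x..x + h} g1"
          using diff[of x y] h d x by simp
        ultimately show ?thesis using h by simp
      next
        case 3
        define h where "h = x - y"
        have h: "h > 0" "y = x - h" "h < d" using 3 y by (auto simp: h_def)
        have r: "integral {-x..-x + h} (\<lambda>x. g1 (-x)) = integral {x - h..x} g1"
          using Henstock_Kurzweil_Integration.integral_reflect_real[where f = g1 and b = x and a = "x - h"] by simp
        have "\<bar>integral {x - h..x} g1 / h - g x\<bar> < e" using d2(2)[of h] h d gx r by simp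
        then have "\<bar>integral {x - h..x} g1 - g x * h\<bar> < e * h"
          using h by (simp add: abs_less_iff field_simps)
        moreover have "integral {a..x} g - integral {a..y} g = integral {x - h..x} g1"
          using diff[of y x] h d x by simp
        ultimately show ?thesis using h by simp
      qed simp
    qed (rule d(1))
  qed
  ultimately show ?thesis by blast
qed

lemma ac_deriv_integral:
  assumes "g absolutely_integrable_on {a..b}"
  shows "ac_deriv a b (\<lambda>x. integral {a..x} g) g"
  using integral_absolutely_continuous[OF assms] integral_has_derivative_ae[of g a b] assms
  unfolding ac_deriv_def by (auto simp: absolutely_integrable_on_def)

lemma ac_deriv_of_integral:
  assumes "g absolutely_integrable_on {a..b}" "\<And>x. x \<in> {a..b} \<Longrightarrow> f x = f a + integral {a..x} g"
  shows "ac_deriv a b f g"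
proof (rule ac_deriv_cong[OF ac_deriv_add[OF ac_deriv_const[of a b "f a"] ac_deriv_integral[OF assms(1)]]])
  show "f a + integral {a..x} g = f x" if "x \<in> {a..b}" for x using assms(2)[OF that] by simp
qed simp

lemma ac_deriv_eq_integral:
  assumes "ac_deriv a b f g" "x \<in> {a..b}"
  shows "f x = f a + integral {a..x} g"
  using ac_deriv_integral_eq[OF assms(1), of x] assms(2) by simp

text \<open>Leads from the almost everywhere notion back to the definition of a solution, which asks
  for a derivative at every point, one-sided at the ends: \<open>f\<close> is the indefinite
  integral of a continuous function.\<close>

lemma ac_deriv_imp_has_derivative:
  assumes "ac_deriv a b f g" "continuous_on {a..b} g" "x \<in> {a..b}"
  shows "(f has_real_derivative g x) (at x within {a..b})"
proof -
  have "((\<lambda>x. integral {a..x} g) has_real_derivative g x) (at x within {a..b})"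
    using integral_has_vector_derivative[OF assms(2,3)]
    by (simp add: has_real_derivative_iff_has_vector_derivative)
  then have "((\<lambda>x. f a + integral {a..x} g) has_real_derivative g x) (at x within {a..b})"
    by (auto intro!: derivative_eq_intros)
  then show ?thesis
  proof (rule has_field_derivative_transform_within[where d = 1])
    show "f a + integral {a..x'} g = f x'" if "x' \<in> {a..b}" for x'
      using ac_deriv_eq_integral[OF assms(1) that] by simp
  qed (use assms(3) in auto)
qed

lemma absolutely_integrable_continuous_mult:
  fixes m k :: "real \<Rightarrow> real"
  assumes "m absolutely_integrable_on {a..b}" "continuous_on {a..b} k"
  shows "(\<lambda>x. m x * k x) absolutely_integrable_on {a..b}"
proof -
  have "(\<lambda>x. k x * m x) absolutely_integrable_on {a..b}"
  proof (rule absolutely_integrable_bounded_measurable_product_real)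
    show "k \<in> borel_measurable (lebesgue_on {a..b})"
      using assms(2) by (intro continuous_imp_measurable_on_sets_lebesgue) auto
    show "bounded (k ` {a..b})"
      using assms(2) compact_continuous_image compact_imp_bounded by blast
  qed (use assms(1) in auto)
  then show ?thesis by (simp add: mult.commute)
qed

text \<open>Integrating factor for \<open>f' = m f + g\<close> with \<open>m\<close> merely
  integrable. The Gronwall and comparison arguments below consist in reading off the sign or the
  size of the new right-hand side.\<close>

lemma ac_deriv_linear:
  assumes "ac_deriv a b f (\<lambda>x. m x * f x + g x)" "m absolutely_integrable_on {a..b}"
  shows "ac_deriv a b (\<lambda>x. f x * exp (- integral {a..x} m)) (\<lambda>x. g x * exp (- integral {a..x} m))"
proof -
  have "ac_deriv a b (\<lambda>x. exp (- integral {a..x} m)) (\<lambda>x. - exp (- integral {a..x} m) * m x)"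
    by (rule ac_deriv_chain[OF ac_deriv_integral[OF assms(2)], where F = "\<lambda>u. exp (-u)"])
      (auto intro!: derivative_eq_intros continuous_on_minus continuous_on_exp continuous_on_id)
  from ac_deriv_mult[OF assms(1) this] show ?thesis
    by (rule ac_deriv_cong) (simp_all add: algebra_simps)
qed

lemma integral_abs_bound:
  fixes m :: "real \<Rightarrow> real"
  assumes "m absolutely_integrable_on {a..b}" "\<And>x. x \<in> {a..b} \<Longrightarrow> \<bar>k x\<bar> \<le> c * \<bar>m x\<bar>" "k integrable_on {a..b}"
    and "x \<in> {a..b}" "0 \<le> c"
  shows "\<bar>integral {a..x} k\<bar> \<le> c * integral {a..b} (\<lambda>x. \<bar>m x\<bar>)"
proof -
  have mi: "(\<lambda>x. \<bar>m x\<bar>) integrable_on {a..b}" using assms(1) by (simp add: absolutely_integrable_on_def)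
  have mx: "(\<lambda>x. \<bar>m x\<bar>) integrable_on {a..x}" "k integrable_on {a..x}"
    using mi assms by (auto intro: integrable_on_subinterval)
  have "norm (integral {a..x} k) \<le> integral {a..x} (\<lambda>x. c * \<bar>m x\<bar>)"
    using assms mx by (intro integral_norm_bound_integral integrable_on_mult_right) auto
  also have "\<dots> = c * integral {a..x} (\<lambda>x. \<bar>m x\<bar>)" by simp
  also have "\<dots> \<le> c * integral {a..b} (\<lambda>x. \<bar>m x\<bar>)"
    using mi mx assms by (intro mult_left_mono integral_subset_le) auto
  finally show ?thesis by simp
qed

section \<open>Generalized trigonometric functions\<close>

lemma spow_0 [simp]: "spow 0 r = 0"
  by (simp add: spow_def)

lemma spow_minus [simp]: "spow (- x) r = - spow x r"
  by (simp add: spow_def)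

lemma abs_spow: "\<bar>spow x r\<bar> = \<bar>x\<bar> powr r"
  by (cases "x = 0") (auto simp: spow_def abs_mult)

lemma spow_pos: "x > 0 \<Longrightarrow> spow x r = x powr r"
  by (simp add: spow_def)

lemma sgn_spow [simp]: "sgn (spow x r) = sgn x"
  by (auto simp: spow_def sgn_mult sgn_if)

lemma spow_eq_0_iff [simp]: "spow x r = 0 \<longleftrightarrow> x = 0"
  by (auto simp: spow_def sgn_if)

lemma spow_pos_iff [simp]: "spow x r > 0 \<longleftrightarrow> x > 0"
  by (metis sgn_1_pos sgn_spow)

lemma spow_spow: "spow (spow x a) b = spow x (a * b)"
  by (simp add: spow_def[of "spow x a" b] abs_spow powr_powr) (simp add: spow_def)

lemma spow_1 [simp]: "spow x 1 = x"
  by (auto simp: spow_def sgn_if)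

lemma spow_mult: "spow (x * y) r = spow x r * spow y r"
  by (simp add: spow_def abs_mult powr_mult sgn_mult)

lemma mult_spow: "x * spow x r = \<bar>x\<bar> powr (r + 1)"
  by (auto simp: spow_def sgn_if powr_add abs_if)

lemma spow_inj: "r \<noteq> 0 \<Longrightarrow> spow x r = spow y r \<longleftrightarrow> x = y"
  by (metis spow_spow spow_1 nonzero_divide_eq_eq mult.commute)

lemma has_derivative_spow:
  assumes "x \<noteq> 0"
  shows "((\<lambda>x. spow x r) has_real_derivative r * \<bar>x\<bar> powr (r - 1)) (at x)"
proof (cases "x > 0")
  case True
  have "((\<lambda>x. x powr r) has_real_derivative r * x powr (r - 1)) (at x)"
    using has_real_derivative_powr[OF True] .
  then show ?thesis
    by (rule has_field_derivative_transform_within_open[where S = "{0<..}", THEN DERIV_cong])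
      (use True in \<open>auto simp: spow_pos\<close>)
next
  case False
  then have "-x > 0" using assms by simp
  then have "((\<lambda>x. (-x) powr r) has_real_derivative r * (-x) powr (r - 1) * -1) (at x)"
    by (intro DERIV_chain2[OF has_real_derivative_powr]) (auto intro!: derivative_eq_intros)
  then have "((\<lambda>x. - ((-x) powr r)) has_real_derivative r * (-x) powr (r - 1)) (at x)"
    by (rule DERIV_minus[THEN DERIV_cong]) simp
  then show ?thesis
    by (rule has_field_derivative_transform_within_open[where S = "{..<0}", THEN DERIV_cong])
      (use \<open>-x > 0\<close> in \<open>auto simp: spow_def\<close>)
qed

lemma isCont_spow:
  assumes "r > 0"
  shows "isCont (\<lambda>x. spow x r) x"
proof (cases "x = 0")
  case True
  have "((\<lambda>x. \<bar>x\<bar> powr r) \<longlongrightarrow> \<bar>0::real\<bar> powr r) (at 0)"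
    using assms by (intro tendsto_powr' tendsto_intros) auto
  then have "((\<lambda>x. \<bar>spow x r\<bar>) \<longlongrightarrow> 0) (at 0)"
    by (simp add: abs_spow)
  then show ?thesis using True
    by (simp add: isCont_def tendsto_rabs_zero_iff)
next
  case False
  then show ?thesis using has_derivative_spow DERIV_isCont by blast
qed

lemma continuous_on_spow [continuous_intros]:
  assumes "continuous_on A f" "r > 0"
  shows "continuous_on A (\<lambda>x. spow (f x) r)"
  using continuous_on_compose2[of UNIV "\<lambda>x. spow x r" A f] assms isCont_spow
  by (auto intro: continuous_at_imp_continuous_on)

lemma has_derivative_abs_powr:
  assumes "r > 1"
  shows "((\<lambda>x. \<bar>x\<bar> powr r) has_real_derivative r * spow x (r - 1)) (at x)"
proof (cases "x = 0")
  case True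
  have "((\<lambda>h. spow h (r - 1)) \<longlongrightarrow> 0) (at 0)"
    using isCont_spow[of "r - 1" 0] assms by (simp add: isCont_def)
  moreover have "(\<bar>h\<bar> powr r - \<bar>0\<bar> powr r) / (h - 0) = spow h (r - 1)" for h :: real
    using mult_spow[of h "r - 1"] by (cases "h = 0") (auto simp: field_simps)
  ultimately show ?thesis using True by (simp add: has_field_derivative_iff)
next
  case False
  have "((\<lambda>x. x * spow x (r - 1)) has_real_derivative 1 * spow x (r - 1) + x * ((r - 1) * \<bar>x\<bar> powr (r - 1 - 1))) (at x)"
    using has_derivative_spow[OF False, of "r - 1"] by (auto intro!: derivative_eq_intros)
  moreover have "x * \<bar>x\<bar> powr (r - 1 - 1) = spow x (r - 1)"
  proof -
    have "\<bar>x\<bar> powr (r - 1) = \<bar>x\<bar> * \<bar>x\<bar> powr (r - 1 - 1)"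
      using False powr_add[of "\<bar>x\<bar>" 1 "r - 1 - 1"] by simp
    then show ?thesis by (auto simp: spow_def sgn_if)
  qed
  then have "1 * spow x (r - 1) + x * ((r - 1) * \<bar>x\<bar> powr (r - 1 - 1)) = r * spow x (r - 1)"
    by (metis (no_types, opaque_lifting) mult.left_commute diff_add_cancel mult.commute distrib_right add.commute)
  ultimately show ?thesis using mult_spow[of _ "r - 1"] by simp
qed

lemma has_integral_shift_real:
  fixes f :: "real \<Rightarrow> real"
  assumes "(f has_integral i) {a..b}"
  shows "((\<lambda>x. f (x + c)) has_integral i) {a - c..b - c}"
  using has_integral_affinity'[of f i a b 1 c] assms by simp

text \<open>Extends a derivative formula across isolated exceptional points: the integral identity
  survives there, and continuity of \<open>g\<close> turns it back into a derivative.\<close>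

lemma DERIV_of_continuous_integrand:
  fixes f g :: "real \<Rightarrow> real"
  assumes "continuous_on UNIV g" "\<And>a b. a \<le> b \<Longrightarrow> (g has_integral (f b - f a)) {a..b}"
  shows "(f has_real_derivative g x) (at x)"
proof -
  have "((\<lambda>u. integral {x - 1..u} g) has_real_derivative g x) (at x within {x - 1..x + 1})"
    using integral_has_vector_derivative[of "x - 1" "x + 1" g x] assms(1)
    by (auto simp: has_real_derivative_iff_has_vector_derivative intro: continuous_on_subset)
  then have "((\<lambda>u. f (x - 1) + integral {x - 1..u} g) has_real_derivative g x) (at x within {x - 1..x + 1})"
    by (auto intro!: derivative_eq_intros)
  then have "(f has_real_derivative g x) (at x within {x - 1..x + 1})"
  proof (rule has_field_derivative_transform_within[where d = 1])
    show "f (x - 1) + integral {x - 1..x'} g = f x'" if "x' \<in> {x - 1..x + 1}" for x'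
      using assms(2)[of "x - 1" x'] that by (simp add: integral_unique)
  qed auto
  then show ?thesis by (simp add: at_within_Icc_at)
qed

text \<open>The origin of \<open>sin (pi / p)\<close> in \<open>pi_hat p\<close>.\<close>

lemma Beta_reflection:
  fixes x :: real
  assumes "0 < x" "x < 1"
  shows "Beta x (1 - x) = pi / sin (pi * x)"
proof -
  have "complex_of_real (Gamma x * Gamma (1 - x)) = complex_of_real (pi / sin (pi * x))"
    using Gamma_reflection_complex[of "of_real x"] Gamma_complex_of_real[of x] Gamma_complex_of_real[of "1 - x"]
    by (simp add: sin_of_real[symmetric])
  then have "Gamma x * Gamma (1 - x) = pi / sin (pi * x)"
    using of_real_eq_iff by blast
  then show ?thesis by (simp add: Beta_def Gamma_eq_zero_iff)
qed

section \<open>The generalized sine as a reparametrized circle\<close>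

locale half_linear =
  fixes p :: real
  assumes p: "p > 1"
begin

text \<open>
  The curve \<open>|s|\<^sup>p + |v|\<^sup>p\<^sup>/\<^sup>(\<^sup>p\<^sup>-\<^sup>1\<^sup>) = 1\<close> is parametrised by an ordinary angle \<open>\<phi>\<close> through
  \<open>sin \<phi> = s\<^sup>(\<^sup>p\<^sup>/\<^sup>2\<^sup>)\<close>; \<open>angle_speed\<close> is the derivative of the generalized angle with
  respect to \<open>\<phi>\<close>.
\<close>

definition angle_speed :: "real \<Rightarrow> real" where
  "angle_speed \<phi> = 2 / p * \<bar>tan \<phi>\<bar> powr (2 / p - 1)"

lemma angle_speed_nonneg: "angle_speed \<phi> \<ge> 0"
  using p by (simp add: angle_speed_def)

lemma angle_speed_minus: "angle_speed (- \<phi>) = angle_speed \<phi>"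
  by (simp add: angle_speed_def)

lemma angle_speed_periodic_int: "angle_speed (\<phi> + real_of_int n * pi) = angle_speed \<phi>"
  by (simp add: angle_speed_def)

lemma pi_hat_pos: "pi_hat p > 0"
proof -
  have "pi / p < pi / 1" using p by (intro divide_strict_left_mono) auto
  then have "sin (pi / p) > 0" using p by (intro sin_gt_zero) auto
  then show ?thesis unfolding pi_hat_def using p by simp
qed

text \<open>Substituting \<open>t = (sin \<phi>)^2\<close> gives \<open>1 / p\<close> times the Beta
  integral with parameters \<open>1 / p\<close> and \<open>1 - 1 / p\<close>. Unless
  \<open>p = 2\<close> the speed is unbounded at one end of the quarter period (at \<open>0\<close>
  for \<open>p > 2\<close>, at \<open>pi / 2\<close> for \<open>p < 2\<close>), so the
  antiderivative is differentiated in the interior only and is merely continuous at the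
  ends.\<close>

lemma angle_speed_quarter: "(angle_speed has_integral (pi_hat p / 2)) {0..pi/2}"
proof -
  define \<beta> where "\<beta> t = t powr (1/p - 1) * (1 - t) powr ((1 - 1/p) - 1)" for t
  have inv: "0 < 1/p" "1/p < 1" using p by auto
  have \<beta>: "(\<beta> has_integral Beta (1/p) (1 - 1/p)) {0..1}"
    unfolding \<beta>_def using inv by (intro has_integral_Beta_real) auto
  have \<beta>i: "\<beta> integrable_on {0..1}" using \<beta> by blast
  define B where "B t = integral {0..t} \<beta>" for t
  have Bc: "continuous_on {0..1} B" unfolding B_def
    using \<beta>i by (rule indefinite_integral_continuous_1)
  have Bd: "(B has_real_derivative \<beta> t) (at t)" if "0 < t" "t < 1" for t
  proof -
    have "isCont \<beta> t" unfolding \<beta>_def using that by (intro continuous_intros) auto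
    then have "(B has_vector_derivative \<beta> t) (at t within {0..1})"
      unfolding B_def using integral_has_vector_derivative_continuous_at[OF \<beta>i, of t "{}"] that
      by (auto intro: continuous_at_imp_continuous_at_within)
    then show ?thesis using that by (simp add: has_real_derivative_iff_has_vector_derivative at_within_Icc_at)
  qed
  have sc: "0 < sin x" "0 < cos x" "0 < (sin x)\<^sup>2" "(sin x)\<^sup>2 < 1" if "0 < x" "x < pi/2" for x
  proof -
    show s: "0 < sin x" "0 < cos x" using that by (auto intro: sin_gt_zero cos_gt_zero)
    have "(sin x)\<^sup>2 = 1 - (cos x)\<^sup>2" by (simp add: sin_squared_eq)
    then show "(sin x)\<^sup>2 < 1" using s by simp
    show "0 < (sin x)\<^sup>2" using s by simp
  qed
  have "(angle_speed has_integral (1/p * B ((sin (pi/2))\<^sup>2) - 1/p * B ((sin 0)\<^sup>2))) {0..pi/2}"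
  proof (rule fundamental_theorem_of_calculus_interior)
    show "continuous_on {0..pi/2} (\<lambda>x. 1/p * B ((sin x)\<^sup>2))"
    proof (intro continuous_on_mult continuous_on_const continuous_on_compose2[OF Bc])
      show "(\<lambda>x. (sin x)\<^sup>2) ` {0..pi/2} \<subseteq> {0..1}" by (auto simp: power_le_one_iff abs_square_le_1)
    qed (intro continuous_intros)
    fix x assume "x \<in> {0<..<pi/2}"
    then have x: "0 < x" "x < pi/2" by auto
    note s = sc[OF x]
    have "((\<lambda>x. 1/p * B ((sin x)\<^sup>2)) has_real_derivative 1/p * (\<beta> ((sin x)\<^sup>2) * (2 * sin x * cos x))) (at x)"
      by (intro DERIV_cmult DERIV_chain2[OF Bd]) (use s in \<open>auto intro!: derivative_eq_intros\<close>)
    moreover have "1/p * (\<beta> ((sin x)\<^sup>2) * (2 * sin x * cos x)) = angle_speed x"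
    proof -
      have pw: "y\<^sup>2 powr r = y powr (2 * r)" if "y > 0" for y r :: real
        using that by (simp add: powr_powr[symmetric] powr_numeral)
      have c: "1 - (sin x)\<^sup>2 = (cos x)\<^sup>2" by (simp add: cos_squared_eq)
      have "2 * (1/p - 1) = 2/p - 2" "2 * (1 - 1/p - 1) = - (2/p)" by (auto simp: algebra_simps)
      then have "\<beta> ((sin x)\<^sup>2) = sin x powr (2/p - 2) * cos x powr (- (2/p))"
        unfolding \<beta>_def c pw[OF s(1)] pw[OF s(2)] by (simp only:)
      also have "\<dots> * (2 * sin x * cos x) = 2 * sin x powr (2/p - 1) * cos x powr (- (2/p - 1))"
      proof -
        have "sin x powr (2/p - 1) = sin x powr (2/p - 2) * sin x"
          using powr_add[of "sin x" "2/p - 2" 1] s by simp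
        moreover have "cos x powr (- (2/p - 1)) = cos x powr (- (2/p)) * cos x"
          using powr_add[of "cos x" "- (2/p)" 1] s by simp
        ultimately show ?thesis by (simp only: mult_ac)
      qed
      also have "\<dots> = 2 * \<bar>tan x\<bar> powr (2/p - 1)"
      proof -
        have "cos x powr (- (2/p - 1)) = inverse (cos x powr (2/p - 1))" by (rule powr_minus)
        moreover have "\<bar>tan x\<bar> powr (2/p - 1) = sin x powr (2/p - 1) / cos x powr (2/p - 1)"
          using s by (simp add: tan_def powr_divide)
        ultimately show ?thesis by (simp only: divide_inverse mult.assoc)
      qed
      finally show ?thesis by (simp add: angle_speed_def)
    qed
    ultimately show "((\<lambda>x. 1/p * B ((sin x)\<^sup>2)) has_vector_derivative angle_speed x) (at x)"
      by (simp add: has_real_derivative_iff_has_vector_derivative)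
  qed simp
  moreover have "B 1 = pi / sin (pi / p)"
    using integral_unique[OF \<beta>] Beta_reflection[OF inv] by (simp add: B_def)
  moreover have "B 0 = 0" by (simp add: B_def)
  ultimately show ?thesis using p by (simp add: pi_hat_def)
qed

lemma angle_speed_half: "(angle_speed has_integral pi_hat p) {- (pi/2)..pi/2}"
proof -
  have "((\<lambda>x. angle_speed (- x)) has_integral (pi_hat p / 2)) {- (pi/2)..-0}"
    using angle_speed_quarter by (simp only: has_integral_reflect_real)
  then have "(angle_speed has_integral (pi_hat p / 2)) {- (pi/2)..0}"
    by (simp add: angle_speed_minus)
  from has_integral_combine[OF _ _ this angle_speed_quarter] show ?thesis by simp
qed

lemma angle_speed_shift:
  assumes "(angle_speed has_integral I) {a..b}"
  shows "(angle_speed has_integral I) {a + real_of_int n * pi..b + real_of_int n * pi}"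
  using has_integral_shift_real[OF assms, of "real_of_int (-n) * pi"]
  unfolding angle_speed_periodic_int by simp

lemma angle_speed_integrable: "angle_speed integrable_on {a..b}"
proof -
  have "angle_speed integrable_on {- (pi/2) - real n * pi..pi/2 + real n * pi}" for n
  proof (induction n)
    case 0
    then show ?case using angle_speed_half by auto
  next
    case (Suc n)
    have l: "angle_speed integrable_on {- (pi/2) - real (Suc n) * pi..- (pi/2) - real n * pi}"
    proof -
      have "- (pi/2) + real_of_int (- int (Suc n)) * pi = - (pi/2) - real (Suc n) * pi"
        "pi/2 + real_of_int (- int (Suc n)) * pi = - (pi/2) - real n * pi"
        by (simp_all add: algebra_simps)
      then show ?thesis
        using angle_speed_shift[OF angle_speed_half, of "- int (Suc n)"] by (metis has_integral_integrable)
    qed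
    have r: "angle_speed integrable_on {pi/2 + real n * pi..pi/2 + real (Suc n) * pi}"
    proof -
      have "- (pi/2) + real_of_int (int (Suc n)) * pi = pi/2 + real n * pi"
        "pi/2 + real_of_int (int (Suc n)) * pi = pi/2 + real (Suc n) * pi"
        by (simp_all add: algebra_simps)
      then show ?thesis
        using angle_speed_shift[OF angle_speed_half, of "int (Suc n)"] by (metis has_integral_integrable)
    qed
    have "angle_speed integrable_on {- (pi/2) - real (Suc n) * pi..pi/2 + real n * pi}"
      by (rule Henstock_Kurzweil_Integration.integrable_combine[OF _ _ l Suc.IH]) (auto simp: algebra_simps)
    then show ?case
      by (rule Henstock_Kurzweil_Integration.integrable_combine[OF _ _ _ r, rotated 2]) (auto simp: algebra_simps)
  qed
  moreover obtain n where "\<bar>a\<bar> + \<bar>b\<bar> < real n * pi"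
    using reals_Archimedean3[OF pi_gt_zero] by blast
  then have "{a..b} \<subseteq> {- (pi/2) - real n * pi..pi/2 + real n * pi}"
    unfolding atLeastatMost_subset_iff using pi_gt_zero by linarith
  ultimately show ?thesis using integrable_on_subinterval by blast
qed

text \<open>At least one of the two intervals is empty or degenerate, so this is the signed integral
  from \<open>0\<close> to \<open>\<phi>\<close>.\<close>

definition gen_angle :: "real \<Rightarrow> real" where
  "gen_angle \<phi> = integral {0..\<phi>} angle_speed - integral {\<phi>..0} angle_speed"

lemma gen_angle_0 [simp]: "gen_angle 0 = 0"
  by (simp add: gen_angle_def)

lemma gen_angle_diff:
  assumes "c \<le> d"
  shows "gen_angle d - gen_angle c = integral {c..d} angle_speed"
proof -
  have *: "integral {a..b} angle_speed + integral {b..c} angle_speed = integral {a..c} angle_speed"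
    if "a \<le> b" "b \<le> c" for a b c
    using Henstock_Kurzweil_Integration.integral_combine[OF that angle_speed_integrable] .
  have e: "integral {a..b} angle_speed = 0" if "b \<le> a" for a b
    using that by (cases "a = b") auto
  consider "0 \<le> c" | "c \<le> 0" "0 \<le> d" | "d \<le> 0" by linarith
  then show ?thesis
  proof cases
    case 1 then show ?thesis using *[of 0 c d] e[of 0 c] e[of 0 d] assms by (simp add: gen_angle_def)
  next
    case 2 then show ?thesis using *[of c 0 d] e[of c 0] e[of 0 d] assms by (simp add: gen_angle_def)
  next
    case 3 then show ?thesis using *[of c d 0] e[of c 0] e[of d 0] assms by (simp add: gen_angle_def)
  qed
qed

lemma gen_angle_add_pi: "gen_angle (\<phi> + pi) = gen_angle \<phi> + pi_hat p"
proof -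
  have sh: "integral {c + pi..d + pi} angle_speed = integral {c..d} angle_speed" for c d
    using angle_speed_shift[OF integrable_integral[OF angle_speed_integrable], of c d 1]
    by (auto intro: integral_unique)
  have "gen_angle pi - gen_angle (pi/2) = pi_hat p / 2"
  proof -
    have "((\<lambda>x. angle_speed (- x)) has_integral (pi_hat p / 2)) {- (pi/2)..-0}"
      using angle_speed_quarter by (simp only: has_integral_reflect_real)
    then have "integral {-(pi/2)..0} angle_speed = pi_hat p / 2"
      by (simp add: angle_speed_minus integral_unique)
    then show ?thesis using gen_angle_diff[of "pi/2" pi] sh[of "-(pi/2)" 0] by simp
  qed
  moreover have "gen_angle (pi/2) = pi_hat p / 2"
    using gen_angle_diff[of 0 "pi/2"] integral_unique[OF angle_speed_quarter] by simp
  ultimately have pi: "gen_angle pi = pi_hat p" by simp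
  show ?thesis
  proof (cases "\<phi> \<ge> 0")
    case True
    then show ?thesis using gen_angle_diff[of pi "\<phi> + pi"] gen_angle_diff[of 0 \<phi>] sh[of 0 \<phi>] pi by simp
  next
    case False
    then show ?thesis using gen_angle_diff[of "\<phi> + pi" pi] gen_angle_diff[of \<phi> 0] sh[of \<phi> 0] pi by simp
  qed
qed

text \<open>The hypothesis excludes the multiples of \<open>pi / 2\<close>, the only points at which
  \<open>angle_speed\<close> can be discontinuous.\<close>

lemma gen_angle_has_derivative:
  assumes "sin (2 * \<phi>) \<noteq> 0"
  shows "(gen_angle has_real_derivative angle_speed \<phi>) (at \<phi>)"
proof -
  have "sin \<phi> \<noteq> 0" "cos \<phi> \<noteq> 0" using assms by (auto simp: sin_double)
  then have "isCont angle_speed \<phi>" unfolding angle_speed_def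
    by (intro continuous_intros) (auto simp: tan_def)
  then have "((\<lambda>u. integral {\<phi> - 1..u} angle_speed) has_vector_derivative angle_speed \<phi>) (at \<phi> within {\<phi> - 1..\<phi> + 1})"
    using integral_has_vector_derivative_continuous_at[OF angle_speed_integrable, of \<phi> "\<phi> - 1" "\<phi> + 1" "{}"]
    by (auto intro: continuous_at_imp_continuous_at_within)
  then have "((\<lambda>u. gen_angle (\<phi> - 1) + integral {\<phi> - 1..u} angle_speed) has_real_derivative angle_speed \<phi>) (at \<phi> within {\<phi> - 1..\<phi> + 1})"
    by (auto simp: has_real_derivative_iff_has_vector_derivative intro!: derivative_eq_intros)
  then have "(gen_angle has_real_derivative angle_speed \<phi>) (at \<phi> within {\<phi> - 1..\<phi> + 1})"
  proof (rule has_field_derivative_transform_within[where d = 1])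
    show "gen_angle (\<phi> - 1) + integral {\<phi> - 1..x} angle_speed = gen_angle x" if "x \<in> {\<phi> - 1..\<phi> + 1}" for x
      using gen_angle_diff[of "\<phi> - 1" x] that by simp
  qed auto
  then show ?thesis by (simp add: at_within_Icc_at)
qed

lemma continuous_gen_angle: "continuous_on UNIV gen_angle"
proof (rule continuous_at_imp_continuous_on, rule ballI)
  fix x :: real
  have "continuous_on {x - 1..x + 1} (\<lambda>u. gen_angle (x - 1) + integral {x - 1..u} angle_speed)"
    by (intro continuous_intros indefinite_integral_continuous_1 angle_speed_integrable)
  moreover have "gen_angle (x - 1) + integral {x - 1..u} angle_speed = gen_angle u" if "u \<in> {x - 1..x + 1}" for u
    using gen_angle_diff[of "x - 1" u] that by simp
  ultimately have "continuous_on {x - 1..x + 1} gen_angle" by (rule continuous_on_eq)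
  then show "isCont gen_angle x" by (rule continuous_on_interior) simp
qed

lemma gen_angle_mono: "x \<le> y \<Longrightarrow> gen_angle x \<le> gen_angle y"
  using gen_angle_diff[of x y] integral_nonneg[OF angle_speed_integrable[of x y]] angle_speed_nonneg by simp

lemma gen_angle_strict_mono: "x < y \<Longrightarrow> gen_angle x < gen_angle y"
proof (rule ccontr)
  assume xy: "x < y" and "\<not> gen_angle x < gen_angle y"
  then have eq: "gen_angle x = gen_angle y" using gen_angle_mono[of x y] by simp
  \<comment> \<open>A point of positive speed: the midpoint, shifted by \<open>\<eta>\<close> if it
    happens to be a multiple of \<open>pi / 2\<close>. Since \<open>0 < 2 \<eta> < pi\<close>, the
    shifted point is not such a multiple.\<close>
  obtain z where z: "x < z" "z < y" "sin (2 * z) \<noteq> 0"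
  proof (cases "sin (2 * ((x + y) / 2)) = 0")
    case True
    define \<eta> where "\<eta> = min 1 ((y - x) / 4)"
    have \<eta>: "0 < \<eta>" "\<eta> \<le> 1" "\<eta> \<le> (y - x) / 4" using xy unfolding \<eta>_def
      by (auto simp only: min_less_iff_conj min.cobounded1 min.cobounded2 zero_less_one intro!: divide_pos_pos)
    have "sin (2 * \<eta>) > 0" using \<eta> pi_gt3 by (intro sin_gt_zero) auto
    moreover have "cos (2 * ((x + y) / 2)) \<noteq> 0" using True sin_cos_squared_add[of "2 * ((x + y) / 2)"] by auto
    moreover have "sin (2 * ((x + y) / 2 + \<eta>)) = cos (2 * ((x + y) / 2)) * sin (2 * \<eta>)"
      using True by (simp add: distrib_left sin_add)
    ultimately have "sin (2 * ((x + y) / 2 + \<eta>)) \<noteq> 0" by simp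
    then show ?thesis using \<eta> xy by (intro that[of "(x + y) / 2 + \<eta>"]) (auto simp: field_simps)
  qed (use xy that[of "(x + y) / 2"] in auto)
  have const: "gen_angle u = gen_angle x" if "x < u" "u < y" for u
    using gen_angle_mono[of x u] gen_angle_mono[of u y] that eq by simp
  have "(gen_angle has_real_derivative 0) (at z)"
    by (rule has_field_derivative_transform_within_open[where S = "{x<..<y}" and f = "\<lambda>_. gen_angle x"])
      (use z const in auto)
  moreover have "angle_speed z > 0"
    using z p by (auto simp: angle_speed_def tan_def sin_double)
  ultimately show False using DERIV_unique gen_angle_has_derivative[OF z(3)] by fastforce
qed

lemma gen_angle_add_npi: "gen_angle (\<phi> + real n * pi) = gen_angle \<phi> + real n * pi_hat p"
proof (induction n)
  case (Suc n)
  have "gen_angle (\<phi> + real (Suc n) * pi) = gen_angle ((\<phi> + real n * pi) + pi)"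
    by (simp add: algebra_simps)
  then show ?case unfolding gen_angle_add_pi using Suc by (simp add: algebra_simps)
qed simp

lemma bij_gen_angle: "bij gen_angle"
proof (rule bijI)
  show "inj gen_angle" using gen_angle_strict_mono by (metis injI linorder_cases order_less_irrefl)
  show "surj gen_angle"
    unfolding surj_def
  proof
    fix y
    obtain n where n: "\<bar>y\<bar> < real n * pi_hat p" using reals_Archimedean3[OF pi_hat_pos] by blast
    have "gen_angle (- (real n * pi)) = - (real n * pi_hat p)" "gen_angle (real n * pi) = real n * pi_hat p"
      using gen_angle_add_npi[of "- (real n * pi)" n] gen_angle_add_npi[of 0 n] by auto
    then have "\<exists>x. - (real n * pi) \<le> x \<and> x \<le> real n * pi \<and> gen_angle x = y"
      using n by (intro IVT' continuous_on_subset[OF continuous_gen_angle]) auto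
    then show "\<exists>x. y = gen_angle x" by blast
  qed
qed

definition std_angle :: "real \<Rightarrow> real" where "std_angle = inv gen_angle"

lemma gen_std [simp]: "gen_angle (std_angle t) = t"
  unfolding std_angle_def using bij_gen_angle by (simp add: bij_is_surj surj_f_inv_f)

lemma std_gen [simp]: "std_angle (gen_angle \<phi>) = \<phi>"
  unfolding std_angle_def using bij_gen_angle by (simp add: bij_is_inj inv_f_f)

lemma std_angle_0 [simp]: "std_angle 0 = 0"
  using std_gen[of 0] by simp

lemma std_angle_less: "std_angle s < std_angle t \<longleftrightarrow> s < t"
  by (metis gen_angle_strict_mono gen_std linorder_less_linear order_less_asym)

lemma continuous_std_angle: "continuous_on UNIV std_angle"
proof (rule continuous_onI_mono)
  have "range std_angle = UNIV" by (metis std_gen surjI)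
  then show "open (range std_angle)" by simp
  show "std_angle x \<le> std_angle y" if "x \<le> y" for x y using std_angle_less that by (metis not_le)
qed

lemma std_angle_add_pi_hat: "std_angle (t + pi_hat p) = std_angle t + pi"
  by (metis gen_angle_add_pi gen_std std_gen)

lemma std_angle_has_derivative:
  assumes "sin (2 * std_angle t) \<noteq> 0"
  shows "(std_angle has_real_derivative inverse (angle_speed (std_angle t))) (at t)"
proof (rule DERIV_inverse_function[of gen_angle _ _ _ "t - 1" "t + 1"])
  show "(gen_angle has_real_derivative angle_speed (std_angle t)) (at (std_angle t))"
    using gen_angle_has_derivative[OF assms] .
  show "angle_speed (std_angle t) \<noteq> 0"
    using assms p by (auto simp: angle_speed_def tan_def sin_double)
  show "isCont std_angle t" using continuous_std_angle by (simp add: continuous_on_eq_continuous_at)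
qed auto

text \<open>\<open>gsin\<close> is the generalized sine, \<open>gcos\<close> its derivative and \<open>gmom\<close> the power \<open>gcos\<^sup>(\<^sup>p\<^sup>-\<^sup>1\<^sup>)\<close>.\<close>

definition gsin :: "real \<Rightarrow> real" where "gsin t = spow (sin (std_angle t)) (2 / p)"
definition gmom :: "real \<Rightarrow> real" where "gmom t = spow (cos (std_angle t)) (2 - 2 / p)"
definition gcos :: "real \<Rightarrow> real" where "gcos t = spow (cos (std_angle t)) (2 / p)"

lemma exps: "2 / p > 0" "2 - 2 / p > 0" "(2 - 2 / p) / (p - 1) = 2 / p" "2 / p * (p - 1) = 2 - 2 / p"
  using p by (auto simp: field_simps)

lemma gcos_gmom: "gcos t = spow (gmom t) (1 / (p - 1))"
  using exps by (simp add: gcos_def gmom_def spow_spow)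

lemma gmom_gcos: "gmom t = spow (gcos t) (p - 1)"
  using exps by (simp add: gcos_def gmom_def spow_spow)

lemma continuous_gsin: "continuous_on UNIV gsin"
  and continuous_gmom: "continuous_on UNIV gmom"
  and continuous_gcos: "continuous_on UNIV gcos"
  unfolding gsin_def gmom_def gcos_def
  by (intro continuous_intros continuous_std_angle exps)+

lemma gsin_add_pi_hat: "gsin (t + pi_hat p) = - gsin t"
  and gmom_add_pi_hat: "gmom (t + pi_hat p) = - gmom t"
  and gcos_add_pi_hat: "gcos (t + pi_hat p) = - gcos t"
  by (simp_all add: gsin_def gmom_def gcos_def std_angle_add_pi_hat)

lemma gsin_0 [simp]: "gsin 0 = 0" and gmom_0 [simp]: "gmom 0 = 1" and gcos_0 [simp]: "gcos 0 = 1"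
  by (simp_all add: gsin_def gmom_def gcos_def spow_def)

lemma gsin_pos: "0 < t \<Longrightarrow> t < pi_hat p \<Longrightarrow> gsin t > 0"
  unfolding gsin_def using std_angle_less[of 0 t] std_angle_less[of t "pi_hat p"] std_angle_add_pi_hat[of 0]
  by (simp add: sin_gt_zero)

lemma gsin_powr: "\<bar>gsin t\<bar> powr p = (sin (std_angle t))\<^sup>2"
proof -
  have "2 / p * p = 2" using p by simp
  then have "\<bar>gsin t\<bar> powr p = \<bar>sin (std_angle t)\<bar> powr 2"
    unfolding gsin_def abs_spow powr_powr by simp
  then show ?thesis by (cases "sin (std_angle t) = 0") (auto simp: powr_numeral)
qed

lemma gcos_powr: "\<bar>gcos t\<bar> powr p = (cos (std_angle t))\<^sup>2"
proof -
  have "2 / p * p = 2" using p by simp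
  then have "\<bar>gcos t\<bar> powr p = \<bar>cos (std_angle t)\<bar> powr 2"
    unfolding gcos_def abs_spow powr_powr by simp
  then show ?thesis by (cases "cos (std_angle t) = 0") (auto simp: powr_numeral)
qed

lemma gcos_gmom_mult: "gcos t * gmom t = \<bar>gcos t\<bar> powr p"
  unfolding gmom_gcos using mult_spow[of "gcos t" "p - 1"] by simp

lemma gpyth: "\<bar>gsin t\<bar> powr p + \<bar>gcos t\<bar> powr p = 1"
  by (simp add: gsin_powr gcos_powr)

text \<open>The powers of \<open>\<bar>sin\<bar>\<close> and \<open>\<bar>cos\<bar>\<close> that
  come from differentiating the signed powers combine with those of the inverse speed;
  \<open>angle_speed\<close> is chosen to make this happen.\<close>

lemma generic_derivatives:
  assumes "sin (2 * std_angle t) \<noteq> 0"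
  shows "(gsin has_real_derivative gcos t) (at t)"
    and "(gmom has_real_derivative - (p - 1) * spow (gsin t) (p - 1)) (at t)"
proof -
  define \<phi> where "\<phi> = std_angle t"
  have sc: "sin \<phi> \<noteq> 0" "cos \<phi> \<noteq> 0" using assms by (auto simp: sin_double \<phi>_def)
  have inv: "inverse (angle_speed \<phi>) = p / 2 * (\<bar>sin \<phi>\<bar> powr (1 - 2/p) * \<bar>cos \<phi>\<bar> powr (2/p - 1))"
  proof -
    have "\<bar>tan \<phi>\<bar> powr (2/p - 1) = \<bar>sin \<phi>\<bar> powr (2/p - 1) / \<bar>cos \<phi>\<bar> powr (2/p - 1)"
      by (simp add: tan_def powr_divide)
    moreover have "\<bar>sin \<phi>\<bar> powr (1 - 2/p) = inverse (\<bar>sin \<phi>\<bar> powr (2/p - 1))"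
      by (simp add: powr_minus[symmetric])
    ultimately show ?thesis by (simp add: angle_speed_def field_simps)
  qed
  have d: "(std_angle has_real_derivative inverse (angle_speed \<phi>)) (at t)"
    unfolding \<phi>_def by (rule std_angle_has_derivative[OF assms])
  have "((\<lambda>t. sin (std_angle t)) has_real_derivative cos \<phi> * inverse (angle_speed \<phi>)) (at t)"
    using DERIV_chain2[OF DERIV_sin d[unfolded \<phi>_def]] by (simp add: \<phi>_def)
  from DERIV_chain2[OF has_derivative_spow this]
  have 1: "(gsin has_real_derivative 2 / p * \<bar>sin \<phi>\<bar> powr (2 / p - 1) * (cos \<phi> * inverse (angle_speed \<phi>))) (at t)"
    using sc unfolding gsin_def \<phi>_def by blast
  have "\<bar>sin \<phi>\<bar> powr (2/p - 1) * \<bar>sin \<phi>\<bar> powr (1 - 2/p) = 1"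
    using sc by (simp add: powr_add[symmetric])
  then have "2 / p * \<bar>sin \<phi>\<bar> powr (2 / p - 1) * (cos \<phi> * inverse (angle_speed \<phi>)) = cos \<phi> * \<bar>cos \<phi>\<bar> powr (2/p - 1)"
    unfolding inv using p by (simp add: field_simps)
  also have "\<dots> = gcos t"
  proof -
    have "\<bar>cos \<phi>\<bar> powr (2/p) = \<bar>cos \<phi>\<bar> * \<bar>cos \<phi>\<bar> powr (2/p - 1)" using sc by (simp add: powr_diff)
    then show ?thesis unfolding gcos_def \<phi>_def[symmetric] spow_def by (auto simp: sgn_if)
  qed
  finally show "(gsin has_real_derivative gcos t) (at t)" using 1 by simp
  have "((\<lambda>t. cos (std_angle t)) has_real_derivative - sin \<phi> * inverse (angle_speed \<phi>)) (at t)"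
    using DERIV_chain2[OF DERIV_cos d[unfolded \<phi>_def]] by (simp add: \<phi>_def)
  from DERIV_chain2[OF has_derivative_spow this]
  have 2: "(gmom has_real_derivative (2 - 2 / p) * \<bar>cos \<phi>\<bar> powr (2 - 2 / p - 1) * (- sin \<phi> * inverse (angle_speed \<phi>))) (at t)"
    using sc unfolding gmom_def \<phi>_def by blast
  have AB: "\<bar>cos \<phi>\<bar> powr (2 - 2 / p - 1) * \<bar>cos \<phi>\<bar> powr (2/p - 1) = 1"
    using sc by (simp add: powr_add[symmetric])
  have "(2 - 2 / p) * \<bar>cos \<phi>\<bar> powr (2 - 2 / p - 1) * (- sin \<phi> * inverse (angle_speed \<phi>))
     = - ((2 - 2 / p) * (p / 2)) * (sin \<phi> * \<bar>sin \<phi>\<bar> powr (1 - 2/p))"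
  proof -
    have "c * A * (- s * (e * (D * B))) = - (c * e) * (s * D) * (A * B)" for A B c s D e :: real
      by (simp add: mult_ac)
    from this[of "2 - 2 / p" "\<bar>cos \<phi>\<bar> powr (2 - 2 / p - 1)" "sin \<phi>" "p / 2" "\<bar>sin \<phi>\<bar> powr (1 - 2/p)" "\<bar>cos \<phi>\<bar> powr (2/p - 1)"]
    show ?thesis unfolding inv AB by (simp only: mult_1_right mult_minus_left mult.assoc)
  qed
  also have "(2 - 2 / p) * (p / 2) = p - 1" using p by (simp add: field_simps)
  also have "sin \<phi> * \<bar>sin \<phi>\<bar> powr (1 - 2/p) = spow (gsin t) (p - 1)"
  proof -
    have "\<bar>sin \<phi>\<bar> powr (2 - 2/p) = \<bar>sin \<phi>\<bar> * \<bar>sin \<phi>\<bar> powr (1 - 2/p)"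
      using sc powr_add[of "\<bar>sin \<phi>\<bar>" 1 "1 - 2/p"] by simp
    then show ?thesis unfolding gsin_def spow_spow exps \<phi>_def[symmetric] by (auto simp: sgn_if spow_def)
  qed
  finally show "(gmom has_real_derivative - (p - 1) * spow (gsin t) (p - 1)) (at t)" using 2 by simp
qed

lemma finite_exceptional: "finite {t \<in> {a..b}. sin (2 * std_angle t) = 0}"
proof -
  have "{t \<in> {a..b}. sin (2 * std_angle t) = 0} \<subseteq>
     (\<lambda>i. gen_angle (real_of_int i * pi / 2)) ` {\<lfloor>2 * std_angle a / pi\<rfloor>..\<lceil>2 * std_angle b / pi\<rceil>}"
  proof
    fix t assume t: "t \<in> {t \<in> {a..b}. sin (2 * std_angle t) = 0}"
    then obtain i where i: "2 * std_angle t = real_of_int i * pi" using sin_zero_iff_int2 by auto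
    have "std_angle a \<le> std_angle t" "std_angle t \<le> std_angle b"
      using t std_angle_less by (auto simp: not_less[symmetric])
    then have "2 * std_angle a / pi \<le> real_of_int i" "real_of_int i \<le> 2 * std_angle b / pi"
      using i pi_gt_zero by (auto simp: field_simps)
    then have "\<lfloor>2 * std_angle a / pi\<rfloor> \<le> i" "i \<le> \<lceil>2 * std_angle b / pi\<rceil>" by linarith+
    moreover have "t = gen_angle (real_of_int i * pi / 2)"
      using i gen_std[of t] by (metis nonzero_mult_div_cancel_left zero_neq_numeral)
    ultimately show "t \<in> (\<lambda>i. gen_angle (real_of_int i * pi / 2)) ` {\<lfloor>2 * std_angle a / pi\<rfloor>..\<lceil>2 * std_angle b / pi\<rceil>}"
      by auto
  qed
  then show ?thesis by (rule finite_subset) simp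
qed

text \<open>The chain rule covers all but finitely many points of a bounded interval. The
  fundamental theorem tolerates these, and continuity of \<open>gcos\<close> recovers the derivative
  everywhere.\<close>

lemma gsin_has_derivative: "(gsin has_real_derivative gcos t) (at t)"
proof (rule DERIV_of_continuous_integrand[OF continuous_gcos])
  fix a b :: real assume "a \<le> b"
  then show "(gcos has_integral gsin b - gsin a) {a..b}"
    by (intro fundamental_theorem_of_calculus_interior_strong[OF finite_exceptional[of a b]]
          continuous_on_subset[OF continuous_gsin])
      (auto simp: has_real_derivative_iff_has_vector_derivative[symmetric] intro: generic_derivatives)
qed

lemma gmom_has_derivative: "(gmom has_real_derivative - (p - 1) * spow (gsin t) (p - 1)) (at t)"
proof (rule DERIV_of_continuous_integrand)
  show "continuous_on UNIV (\<lambda>t. - (p - 1) * spow (gsin t) (p - 1))"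
    using p by (intro continuous_intros continuous_gsin) auto
  fix a b :: real assume "a \<le> b"
  then show "((\<lambda>t. - (p - 1) * spow (gsin t) (p - 1)) has_integral gmom b - gmom a) {a..b}"
    by (intro fundamental_theorem_of_calculus_interior_strong[OF finite_exceptional[of a b]]
          continuous_on_subset[OF continuous_gmom])
      (auto simp: has_real_derivative_iff_has_vector_derivative[symmetric] intro!: generic_derivatives(2)[simplified])
qed

lemma gsin_gmom_eq_imp:
  assumes "gsin a = gsin b" "gmom a = gmom b"
  obtains n :: int where "a = b + 2 * real_of_int n * pi_hat p"
proof -
  have "sin (std_angle a) = sin (std_angle b)" "cos (std_angle a) = cos (std_angle b)"
    using assms exps spow_inj unfolding gsin_def gmom_def by (metis less_irrefl)+
  then obtain n :: int where n: "std_angle a = std_angle b + 2 * pi * n"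
    using sin_cos_eq_iff by blast
  have shift: "gen_angle (\<phi> + 2 * pi * real_of_int n) = gen_angle \<phi> + 2 * real_of_int n * pi_hat p" for \<phi>
  proof (cases "n \<ge> 0")
    case True
    then show ?thesis using gen_angle_add_npi[of \<phi> "nat (2 * n)"] by (simp add: algebra_simps)
  next
    case False
    then show ?thesis
      using gen_angle_add_npi[of "\<phi> + 2 * pi * real_of_int n" "nat (- (2 * n))"] by (simp add: algebra_simps)
  qed
  show thesis using that[of n] shift[of "std_angle b"] n gen_std[of a] by simp
qed

text \<open>Lift \<open>cos \<phi> + i sin \<phi>\<close> through the complex exponential.\<close>

lemma angle_lift:
  fixes s v :: "real \<Rightarrow> real"
  assumes "continuous_on {a..b} s" "continuous_on {a..b} v"
    and "\<And>x. x \<in> {a..b} \<Longrightarrow> \<bar>s x\<bar> powr p + \<bar>v x\<bar> powr (p / (p - 1)) = 1"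
  obtains \<theta> where "continuous_on {a..b} \<theta>" "\<And>x. x \<in> {a..b} \<Longrightarrow> gsin (\<theta> x) = s x"
    "\<And>x. x \<in> {a..b} \<Longrightarrow> gmom (\<theta> x) = v x"
proof -
  \<comment> \<open>The inverse of the exponent in \<open>gmom\<close>. As
    \<open>2 r = p / (p - 1)\<close>, the equation of the curve says exactly that \<open>z x\<close>
    has norm 1.\<close>
  define r where "r = 1 / (2 - 2 / p)"
  have r: "r > 0" "r * (2 - 2/p) = 1" "2 * r = p / (p - 1)" using exps p by (auto simp: r_def field_simps)
  define z where "z x = Complex (spow (v x) r) (spow (s x) (p / 2))" for x
  have nz: "norm (z x) = 1" if "x \<in> {a..b}" for x
  proof -
    have sq: "(spow u e)\<^sup>2 = \<bar>u\<bar> powr (2 * e)" for u e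
    proof -
      have "(spow u e)\<^sup>2 = (\<bar>u\<bar> powr e)\<^sup>2" by (metis abs_spow power2_abs)
      then show ?thesis by (simp add: power2_eq_square powr_add[symmetric])
    qed
    have "(norm (z x))\<^sup>2 = 1" using assms(3)[OF that] r by (simp add: z_def cmod_power2 sq)
    then show ?thesis using norm_ge_zero[of "z x"] by (simp add: power2_eq_1_iff)
  qed
  have "continuous_on {a..b} z" unfolding z_def
    using assms(1,2) r p by (intro continuous_on_Complex continuous_intros) auto
  moreover have "z x \<noteq> 0" if "x \<in> {a..b}" for x using nz[OF that] by auto
  ultimately obtain g where g: "continuous_on {a..b} g" "\<And>x. x \<in> {a..b} \<Longrightarrow> z x = exp (g x)"
    using continuous_logarithm_on_contractible[of "{a..b}" z] convex_imp_contractible by blast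
  define \<theta> where "\<theta> x = gen_angle (Im (g x))" for x
  have sc: "sin (Im (g x)) = spow (s x) (p / 2)" "cos (Im (g x)) = spow (v x) r" if "x \<in> {a..b}" for x
  proof -
    have "exp (Re (g x)) = 1" using nz[OF that] g(2)[OF that] by simp
    moreover have "Re (z x) = exp (Re (g x)) * cos (Im (g x))" "Im (z x) = exp (Re (g x)) * sin (Im (g x))"
      using g(2)[OF that] by (simp_all add: Re_exp Im_exp)
    ultimately show "sin (Im (g x)) = spow (s x) (p / 2)" "cos (Im (g x)) = spow (v x) r"
      by (simp_all add: z_def)
  qed
  show thesis
  proof
    show "continuous_on {a..b} \<theta>" unfolding \<theta>_def
      using g(1) by (intro continuous_on_compose2[OF continuous_gen_angle] continuous_intros) auto
    show "gsin (\<theta> x) = s x" "gmom (\<theta> x) = v x" if "x \<in> {a..b}" for x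
      using sc[OF that] r p by (simp_all add: gsin_def gmom_def \<theta>_def spow_spow)
  qed
qed

end

section \<open>Generalized Pruefer angle\<close>

text \<open>Near \<open>\<theta> x0\<close> the function \<open>F\<close> is bi-Lipschitz, so a
  merely continuous \<open>\<theta>\<close> inherits absolute continuity and its derivative from
  \<open>F (\<theta> x)\<close>. Meant for \<open>gsin\<close> and \<open>gmom\<close> as local
  coordinates on the curve.\<close>

lemma ac_deriv_local_inverse:
  fixes F F' \<theta> h :: "real \<Rightarrow> real"
  assumes F: "\<And>u. (F has_real_derivative F' u) (at u)" and F': "continuous_on UNIV F'"
    and \<theta>: "continuous_on {a..b} \<theta>" and ac: "ac_deriv a b (\<lambda>x. F (\<theta> x)) (\<lambda>x. h x * F' (\<theta> x))"
    and x0: "x0 \<in> {a..b}" "F' (\<theta> x0) \<noteq> 0"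
  shows "\<exists>\<delta>>0. \<forall>c d. {c..d} \<subseteq> {a..b} \<longrightarrow> x0 - \<delta> < c \<longrightarrow> d < x0 + \<delta> \<longrightarrow> ac_deriv c d \<theta> h"
proof -
  define m where "m = \<bar>F' (\<theta> x0)\<bar> / 2"
  have m: "m > 0" using x0 by (simp add: m_def)
  have "isCont F' (\<theta> x0)" using F' by (simp add: continuous_on_eq_continuous_at)
  then obtain \<eta> where \<eta>: "\<eta> > 0" "\<And>t. \<bar>t - \<theta> x0\<bar> < \<eta> \<Longrightarrow> \<bar>F' t - F' (\<theta> x0)\<bar> < m"
    using m unfolding continuous_at_eps_delta by (auto simp: dist_real_def)
  have F'm: "\<bar>F' t\<bar> \<ge> m" if "\<bar>t - \<theta> x0\<bar> < \<eta>" for t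
    using \<eta>(2)[OF that] unfolding m_def by (auto simp: abs_if field_simps split: if_splits)
  obtain \<delta> where \<delta>: "\<delta> > 0" "\<And>x. \<lbrakk>x \<in> {a..b}; \<bar>x - x0\<bar> < \<delta>\<rbrakk> \<Longrightarrow> \<bar>\<theta> x - \<theta> x0\<bar> < \<eta>"
    using \<theta>[unfolded continuous_on_iff, rule_format, OF x0(1) \<eta>(1)] unfolding dist_real_def by meson
  show ?thesis
  proof (intro exI[of _ \<delta>] conjI allI impI)
    fix c d assume cd: "{c..d} \<subseteq> {a..b}" "x0 - \<delta> < c" "d < x0 + \<delta>"
    have near: "\<bar>\<theta> x - \<theta> x0\<bar> < \<eta>" if "x \<in> {c..d}" for x
    proof (rule \<delta>(2))
      show "x \<in> {a..b}" using that cd by auto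
      show "\<bar>x - x0\<bar> < \<delta>" using that cd by auto
    qed
    note acs = ac_deriv_subinterval[OF ac cd(1)]
    have lip: "m * \<bar>s - t\<bar> \<le> \<bar>F s - F t\<bar>" if "\<bar>s - \<theta> x0\<bar> < \<eta>" "\<bar>t - \<theta> x0\<bar> < \<eta>" "s < t" for s t
    proof -
      obtain z where z: "s < z" "z < t" "F t - F s = (t - s) * F' z"
        using MVT2[OF \<open>s < t\<close>, of F F'] F by auto
      have "\<bar>z - \<theta> x0\<bar> < \<eta>" using z that by auto
      then have "m * \<bar>t - s\<bar> \<le> \<bar>F' z\<bar> * \<bar>t - s\<bar>" using F'm by (intro mult_right_mono) auto
      also have "\<dots> = \<bar>F t - F s\<bar>" unfolding z(3) by (simp add: abs_mult)
      finally show ?thesis by (simp add: abs_minus_commute)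
    qed
    show "ac_deriv c d \<theta> h"
    proof (rule ac_deriv_dominated[OF acs acs, where L = "1 / m"])
      fix x y assume "x \<in> {c..d}" "y \<in> {c..d}"
      then have "m * \<bar>\<theta> x - \<theta> y\<bar> \<le> \<bar>F (\<theta> x) - F (\<theta> y)\<bar>"
        using lip[OF near near, of x y] lip[OF near near, of y x]
        by (cases "\<theta> x" "\<theta> y" rule: linorder_cases) (auto simp: abs_minus_commute)
      then have "\<bar>\<theta> x - \<theta> y\<bar> \<le> 1 / m * \<bar>F (\<theta> x) - F (\<theta> y)\<bar>" using m by (simp add: field_simps)
      also have "\<dots> \<le> 1 / m * (\<bar>F (\<theta> x) - F (\<theta> y)\<bar> + \<bar>F (\<theta> x) - F (\<theta> y)\<bar>)"
        using m by (intro mult_left_mono) auto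
      finally show "\<bar>\<theta> x - \<theta> y\<bar> \<le> \<dots>" .
    next
      fix x assume x: "x \<in> {c<..<d}" and der: "((\<lambda>x. F (\<theta> x)) has_real_derivative h x * F' (\<theta> x)) (at x)"
      have F'x: "F' (\<theta> x) \<noteq> 0" using F'm[OF near, of x] x m by auto
      \<comment> \<open>Caratheodory's form of the derivative:
        \<open>\<theta> z = \<theta> x\<close> may occur for \<open>z\<close> close to
        \<open>x\<close>, so a quotient by \<open>\<theta> z - \<theta> x\<close> has to be
        avoided.\<close>
      obtain k where k: "\<And>t. F t - F (\<theta> x) = k t * (t - \<theta> x)" "isCont k (\<theta> x)" "k (\<theta> x) = F' (\<theta> x)"
        using F[of "\<theta> x"] unfolding CARAT_DERIV by blast
      have "isCont \<theta> x"
        using continuous_on_interior[OF continuous_on_subset[OF \<theta> cd(1)]] x by (simp add: interior_atLeastAtMost_real)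
      then have "isCont (\<lambda>z. k (\<theta> z)) x" using k(2) isCont_o2 by blast
      then have kl: "((\<lambda>z. k (\<theta> z)) \<longlongrightarrow> F' (\<theta> x)) (at x)" using k(3) by (simp add: isCont_def)
      have "((\<lambda>z. (F (\<theta> z) - F (\<theta> x)) / (z - x) / k (\<theta> z)) \<longlongrightarrow> h x * F' (\<theta> x) / F' (\<theta> x)) (at x)"
        using der kl F'x unfolding has_field_derivative_iff by (intro tendsto_divide)
      moreover have "\<forall>\<^sub>F z in at x. k (\<theta> z) \<noteq> 0" using kl F'x by (rule tendsto_imp_eventually_ne)
      then have "\<forall>\<^sub>F z in at x. (F (\<theta> z) - F (\<theta> x)) / (z - x) / k (\<theta> z) = (\<theta> z - \<theta> x) / (z - x)"
        by eventually_elim (simp add: k(1))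
      ultimately have "((\<lambda>z. (\<theta> z - \<theta> x) / (z - x)) \<longlongrightarrow> h x * F' (\<theta> x) / F' (\<theta> x)) (at x)"
        by (rule Lim_transform_eventually)
      then show "(\<theta> has_real_derivative h x) (at x)"
        using F'x unfolding has_field_derivative_iff by simp
    qed
  qed (rule \<delta>(1))
qed

lemma powr_le_of_powr_le:
  fixes x E :: real
  assumes "0 \<le> x" "x powr a \<le> E" "a > 0" "r \<ge> 0"
  shows "x powr r \<le> E powr (r / a)"
proof -
  have "x powr r = (x powr a) powr (r / a)" using assms by (simp add: powr_powr)
  also have "\<dots> \<le> E powr (r / a)" using assms by (intro powr_mono2) auto
  finally show ?thesis .
qed

context half_linear
begin

definition gpot :: "real \<Rightarrow> real" where "gpot t = \<bar>gsin t\<bar> powr p"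
definition gpot' :: "real \<Rightarrow> real" where "gpot' t = p * spow (gsin t) (p - 1) * gcos t"

lemma gpot_has_derivative: "(gpot has_real_derivative gpot' t) (at t)"
  unfolding gpot_def gpot'_def using DERIV_chain2[OF has_derivative_abs_powr[OF p] gsin_has_derivative] .

lemma continuous_gpot: "continuous_on UNIV gpot"
  using gpot_has_derivative DERIV_isCont by (blast intro: continuous_at_imp_continuous_on)

lemma continuous_gpot': "continuous_on UNIV gpot'"
  unfolding gpot'_def using p by (intro continuous_intros continuous_gsin continuous_gcos) auto

lemma gpot_nonneg: "gpot t \<ge> 0" and gpot_le_1: "gpot t \<le> 1"
  using gpyth[of t] by (auto simp: gpot_def) (smt (verit) powr_ge_zero)

lemma abs_gcos: "\<bar>gcos t\<bar> powr p = 1 - gpot t"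
  using gpyth[of t] by (simp add: gpot_def)

lemma abs_gsin_le_1: "\<bar>gsin t\<bar> \<le> 1" and abs_gcos_le_1: "\<bar>gcos t\<bar> \<le> 1"
proof -
  have *: "\<bar>x\<bar> \<le> 1" if "\<bar>x\<bar> powr p \<le> 1" for x :: real
    using powr_le_of_powr_le[OF _ that, of 1] p by simp
  show "\<bar>gsin t\<bar> \<le> 1" using gpot_le_1[of t] by (intro *) (simp add: gpot_def)
  show "\<bar>gcos t\<bar> \<le> 1" using gpot_nonneg[of t] abs_gcos[of t] by (intro *) simp
qed

lemma abs_gmom_le_1: "\<bar>gmom t\<bar> \<le> 1"
  unfolding gmom_gcos abs_spow using powr_mono2[of "p - 1" "\<bar>gcos t\<bar>" 1] abs_gcos_le_1[of t] p by simp

lemma abs_gpot'_le: "\<bar>gpot' t\<bar> \<le> p"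
proof -
  have "\<bar>gsin t\<bar> powr (p - 1) \<le> 1" using powr_mono2[of "p - 1" "\<bar>gsin t\<bar>" 1] abs_gsin_le_1[of t] p by simp
  then have "\<bar>gsin t\<bar> powr (p - 1) * \<bar>gcos t\<bar> \<le> 1 * 1" using abs_gcos_le_1 by (intro mult_mono) auto
  then have "p * (\<bar>gsin t\<bar> powr (p - 1) * \<bar>gcos t\<bar>) \<le> p * 1" using p by (intro mult_left_mono) auto
  then show ?thesis using p by (simp add: gpot'_def abs_mult abs_spow mult.assoc)
qed

lemma gpot_add_pi_hat: "gpot (t + pi_hat p) = gpot t"
  by (simp add: gpot_def gsin_add_pi_hat)

lemma gpot_0 [simp]: "gpot 0 = 0"
  by (simp add: gpot_def)

lemma half_turns:
  "gpot (t + of_int n * pi_hat p) = gpot t"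
  "gsin (t + of_int n * pi_hat p) = (if even n then gsin t else - gsin t)"
  "gmom (t + of_int n * pi_hat p) = (if even n then gmom t else - gmom t)"
  "gcos (t + of_int n * pi_hat p) = (if even n then gcos t else - gcos t)"
proof -
  have "gpot (t + of_int n * pi_hat p) = gpot t \<and>
    gsin (t + of_int n * pi_hat p) = (if even n then gsin t else - gsin t) \<and>
    gmom (t + of_int n * pi_hat p) = (if even n then gmom t else - gmom t) \<and>
    gcos (t + of_int n * pi_hat p) = (if even n then gcos t else - gcos t)"
  proof (induction n rule: int_induct[where k = 0])
    case (step1 i)
    have "t + of_int (i + 1) * pi_hat p = (t + of_int i * pi_hat p) + pi_hat p" by (simp add: algebra_simps)
    then show ?case using step1
      by (simp only: gpot_add_pi_hat gsin_add_pi_hat gmom_add_pi_hat gcos_add_pi_hat) auto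
  next
    case (step2 i)
    have e: "t + of_int i * pi_hat p = (t + of_int (i - 1) * pi_hat p) + pi_hat p" by (simp add: algebra_simps)
    from step2 show ?case unfolding e
      by (simp only: gpot_add_pi_hat gsin_add_pi_hat gmom_add_pi_hat gcos_add_pi_hat) (auto split: if_splits)
  qed simp
  then show "gpot (t + of_int n * pi_hat p) = gpot t"
    "gsin (t + of_int n * pi_hat p) = (if even n then gsin t else - gsin t)"
    "gmom (t + of_int n * pi_hat p) = (if even n then gmom t else - gmom t)"
    "gcos (t + of_int n * pi_hat p) = (if even n then gcos t else - gcos t)" by auto
qed

text \<open>\<open>gsin\<close> and \<open>gcos\<close> have no common zero, so near each point
  \<open>\<theta>\<close> can be recovered from \<open>s\<close> or from \<open>v\<close>, with
  derivative \<open>h\<close>. Then \<open>\<theta>\<close> minus the integral of \<open>h\<close>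
  is locally constant, hence constant.\<close>

lemma angle_ode_lift:
  assumes ab: "a \<le> b" and s: "ac_deriv a b s (\<lambda>x. h x * spow (v x) (1 / (p - 1)))"
    and v: "ac_deriv a b v (\<lambda>x. - (p - 1) * h x * spow (s x) (p - 1))"
    and curve: "\<And>x. x \<in> {a..b} \<Longrightarrow> \<bar>s x\<bar> powr p + \<bar>v x\<bar> powr (p / (p - 1)) = 1"
    and h: "h absolutely_integrable_on {a..b}"
  obtains \<theta> where "ac_deriv a b \<theta> h" "\<And>x. x \<in> {a..b} \<Longrightarrow> gsin (\<theta> x) = s x"
    "\<And>x. x \<in> {a..b} \<Longrightarrow> gmom (\<theta> x) = v x"
proof -
  obtain \<theta> where \<theta>: "continuous_on {a..b} \<theta>" "\<And>x. x \<in> {a..b} \<Longrightarrow> gsin (\<theta> x) = s x"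
    "\<And>x. x \<in> {a..b} \<Longrightarrow> gmom (\<theta> x) = v x"
    using angle_lift[OF ac_deriv_continuous[OF s] ac_deriv_continuous[OF v] curve] by blast
  have gc: "gcos (\<theta> x) = spow (v x) (1 / (p - 1))" if "x \<in> {a..b}" for x
    using \<theta>(3)[OF that] gcos_gmom[of "\<theta> x"] by simp
  have loc: "\<exists>\<delta>>0. \<forall>c d. {c..d} \<subseteq> {a..b} \<longrightarrow> x0 - \<delta> < c \<longrightarrow> d < x0 + \<delta> \<longrightarrow> ac_deriv c d \<theta> h"
    if x0: "x0 \<in> {a..b}" for x0
  proof (cases "gcos (\<theta> x0) = 0")
    case False
    show ?thesis
    proof (rule ac_deriv_local_inverse[OF gsin_has_derivative continuous_gcos \<theta>(1) _ x0 False])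
      show "ac_deriv a b (\<lambda>x. gsin (\<theta> x)) (\<lambda>x. h x * gcos (\<theta> x))"
        by (rule ac_deriv_cong[OF s]) (auto simp: \<theta> gc)
    qed
  next
    case True
    then have nz: "- (p - 1) * spow (gsin (\<theta> x0)) (p - 1) \<noteq> 0"
      using gpyth[of "\<theta> x0"] p by auto
    show ?thesis
    proof (rule ac_deriv_local_inverse[OF gmom_has_derivative _ \<theta>(1) _ x0 nz])
      show "continuous_on UNIV (\<lambda>t. - (p - 1) * spow (gsin t) (p - 1))"
        using p by (intro continuous_intros continuous_gsin) auto
      show "ac_deriv a b (\<lambda>x. gmom (\<theta> x)) (\<lambda>x. h x * (- (p - 1) * spow (gsin (\<theta> x)) (p - 1)))"
        by (rule ac_deriv_cong[OF v]) (auto simp: \<theta>)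
    qed
  qed
  define H where "H x = integral {a..x} h" for x
  have H: "ac_deriv a b H h" unfolding H_def using ac_deriv_integral[OF h] .
  have "((\<lambda>x. \<theta> x - H x) has_field_derivative 0) (at x0 within {a..b})" if x0: "x0 \<in> {a..b}" for x0
  proof -
    obtain \<delta> where \<delta>: "\<delta> > 0" "\<And>c d. \<lbrakk>{c..d} \<subseteq> {a..b}; x0 - \<delta> < c; d < x0 + \<delta>\<rbrakk> \<Longrightarrow> ac_deriv c d \<theta> h"
      using loc[OF x0] by blast
    have const: "\<theta> v - H v = \<theta> u - H u" if "u \<le> v" "u \<in> {a..b}" "v \<in> {a..b}" "x0 - \<delta> < u" "v < x0 + \<delta>" for u v
    proof -
      have uv: "{u..v} \<subseteq> {a..b}" using that by auto
      have "ac_deriv u v (\<lambda>x. \<theta> x - H x) (\<lambda>x. h x - h x)"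
        by (rule ac_deriv_diff[OF \<delta>(2)[OF uv that(4,5)] ac_deriv_subinterval[OF H uv]])
      from ac_deriv_ftc[OF this that(1)] show ?thesis
        by (simp add: has_integral_0_eq)
    qed
    show ?thesis
    proof (rule has_field_derivative_transform_within[OF DERIV_const \<delta>(1) x0])
      fix x assume "x \<in> {a..b}" "dist x x0 < \<delta>"
      then show "\<theta> x0 - H x0 = \<theta> x - H x"
        using const[of x x0] const[of x0 x] x0 \<delta>(1) by (cases "x \<le> x0") (auto simp: dist_real_def)
    qed
  qed
  then obtain c where c: "\<And>x. x \<in> {a..b} \<Longrightarrow> \<theta> x - H x = c"
    using has_field_derivative_zero_constant[of "{a..b}" "\<lambda>x. \<theta> x - H x"] by auto
  have "ac_deriv a b (\<lambda>x. c + H x) (\<lambda>x. 0 + h x)"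
    by (rule ac_deriv_add[OF ac_deriv_const H])
  then have "ac_deriv a b \<theta> h"
    by (rule ac_deriv_cong) (use c in \<open>auto simp: algebra_simps\<close>)
  with \<theta> show thesis using that by blast
qed

text \<open>The energy, with \<open>p / (p - 1)\<close> the exponent conjugate to \<open>p\<close>.
  Its derivative is bounded by an integrable multiple of the energy, which keeps nontrivial
  solutions away from the origin, and it vanishes for \<open>\<mu> = \<kappa>\<close>, which serves
  to identify \<open>S_p\<close>.\<close>

lemma energy_deriv:
  assumes y: "ac_deriv a b y (\<lambda>x. \<kappa> * spow (w x) (1 / (p - 1)))"
    and w: "ac_deriv a b w (\<lambda>x. - (p - 1) * \<mu> x * spow (y x) (p - 1))"
  shows "ac_deriv a b (\<lambda>x. \<bar>y x\<bar> powr p + \<bar>w x\<bar> powr (p / (p - 1)))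
    (\<lambda>x. p * (\<kappa> - \<mu> x) * spow (y x) (p - 1) * spow (w x) (1 / (p - 1)))"
proof -
  have p': "p / (p - 1) > 1" "p / (p - 1) - 1 = 1 / (p - 1)" using p by (auto simp: field_simps)
  have 1: "ac_deriv a b (\<lambda>x. \<bar>y x\<bar> powr p) (\<lambda>x. p * spow (y x) (p - 1) * (\<kappa> * spow (w x) (1 / (p - 1))))"
    by (rule ac_deriv_chain[OF y, of "\<lambda>u. \<bar>u\<bar> powr p" "\<lambda>u. p * spow u (p - 1)"])
      (use p in \<open>auto intro!: has_derivative_abs_powr continuous_intros\<close>)
  have 2: "ac_deriv a b (\<lambda>x. \<bar>w x\<bar> powr (p / (p - 1)))
    (\<lambda>x. p / (p - 1) * spow (w x) (p / (p - 1) - 1) * (- (p - 1) * \<mu> x * spow (y x) (p - 1)))"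
  proof (rule ac_deriv_chain[OF w, of "\<lambda>u. \<bar>u\<bar> powr (p / (p - 1))" "\<lambda>u. p / (p - 1) * spow u (p / (p - 1) - 1)"])
    show "continuous_on (w ` {a..b}) (\<lambda>u. p / (p - 1) * spow u (p / (p - 1) - 1))"
      using p p' by (intro continuous_intros) auto
  qed (rule has_derivative_abs_powr[OF p'(1)])
  have *: "p / (p - 1) * W * (- (p - 1) * m * Y) = - (p * W * m * Y)" for W m Y
    using p by (simp add: field_simps)
  show ?thesis
    by (rule ac_deriv_cong[OF ac_deriv_add[OF 1 2]]) (simp_all only: * p'(2), simp add: algebra_simps)
qed

text \<open>The energy \<open>E\<close> stays positive by a Gronwall argument in both directions
  from \<open>x0\<close>. Dividing \<open>y\<close> by \<open>E^(1/p)\<close> and \<open>w\<close>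
  by \<open>E^(1 - 1/p)\<close> moves the trajectory onto the unit curve, where the angle can be
  lifted.\<close>

lemma pruefer:
  assumes ab: "a \<le> b" and y: "ac_deriv a b y (\<lambda>x. \<kappa> * spow (w x) (1 / (p - 1)))"
    and w: "ac_deriv a b w (\<lambda>x. - (p - 1) * \<mu> x * spow (y x) (p - 1))"
    and \<mu>: "\<mu> absolutely_integrable_on {a..b}"
    and x0: "x0 \<in> {a..b}" "y x0 \<noteq> 0 \<or> w x0 \<noteq> 0"
  obtains \<theta> \<rho> where "ac_deriv a b \<theta> (\<lambda>x. \<kappa> + (\<mu> x - \<kappa>) * gpot (\<theta> x))"
    "\<And>x. \<rho> x = \<bar>y x\<bar> powr p + \<bar>w x\<bar> powr (p / (p - 1))" "\<And>x. x \<in> {a..b} \<Longrightarrow> \<rho> x > 0"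
    "\<And>x. x \<in> {a..b} \<Longrightarrow> y x = \<rho> x powr (1 / p) * gsin (\<theta> x)"
    "\<And>x. x \<in> {a..b} \<Longrightarrow> w x = \<rho> x powr (1 - 1 / p) * gmom (\<theta> x)"
proof -
  define E where "E x = \<bar>y x\<bar> powr p + \<bar>w x\<bar> powr (p / (p - 1))" for x
  define Y where "Y x = spow (y x) (p - 1)" for x
  define W where "W x = spow (w x) (1 / (p - 1))" for x
  define E' where "E' x = p * (\<kappa> - \<mu> x) * Y x * W x" for x
  have E: "ac_deriv a b E E'" unfolding E_def E'_def Y_def W_def using energy_deriv[OF y w] .
  have En: "E x \<ge> 0" for x by (simp add: E_def)
  \<comment> \<open>The factors are at most \<open>E^((p-1)/p)\<close> and \<open>E^(1/p)\<close>;
    the exponents add up to 1.\<close>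
  have YW: "\<bar>Y x * W x\<bar> \<le> E x" for x
  proof -
    have "\<bar>Y x\<bar> \<le> E x powr ((p - 1) / p)" unfolding Y_def abs_spow
      using p by (intro powr_le_of_powr_le) (auto simp: E_def)
    moreover have "\<bar>W x\<bar> \<le> E x powr ((1 / (p - 1)) / (p / (p - 1)))" unfolding W_def abs_spow
      using p by (intro powr_le_of_powr_le) (auto simp: E_def)
    ultimately have "\<bar>Y x * W x\<bar> \<le> E x powr ((p - 1) / p) * E x powr ((1 / (p - 1)) / (p / (p - 1)))"
      unfolding abs_mult by (intro mult_mono) auto
    also have "\<dots> = E x powr ((p - 1) / p + (1 / (p - 1)) / (p / (p - 1)))" by (simp add: powr_add)
    also have "(p - 1) / p + (1 / (p - 1)) / (p / (p - 1)) = 1" using p by (simp add: field_simps)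
    finally show ?thesis using En by simp
  qed
  define c where "c x = p * \<bar>\<kappa> - \<mu> x\<bar>" for x
  have \<mu>\<kappa>: "(\<lambda>x. \<kappa> - \<mu> x) absolutely_integrable_on {a..b}"
    using \<mu> by (intro set_integral_diff absolutely_integrable_on_const) auto
  have ci: "c absolutely_integrable_on {a..b}" unfolding c_def
    using absolutely_integrable_continuous_mult[OF absolutely_integrable_abs[OF \<mu>\<kappa>], of "\<lambda>_. p"]
    by (simp add: mult.commute)
  then have ci': "(\<lambda>x. - c x) absolutely_integrable_on {a..b}"
    using absolutely_integrable_continuous_mult[OF ci, of "\<lambda>_. - 1"] by simp
  have Ec: "\<bar>E' x\<bar> \<le> c x * E x" for x
  proof -
    have "\<bar>E' x\<bar> = c x * \<bar>Y x * W x\<bar>" using p by (simp add: E'_def c_def abs_mult)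
    also have "\<dots> \<le> c x * E x" using YW p by (intro mult_left_mono) (auto simp: c_def)
    finally show ?thesis .
  qed
  \<comment> \<open>From \<open>\<bar>E'\<bar> \<le> c E\<close>: \<open>E\<close> times
    \<open>exp (\<integral> c)\<close> is nondecreasing and \<open>E\<close> times
    \<open>exp (- \<integral> c)\<close> is nonincreasing, which carries positivity at
    \<open>x0\<close> to the right and to the left respectively.\<close>
  have up: "ac_deriv a b (\<lambda>x. E x * exp (- integral {a..x} (\<lambda>x. - c x))) (\<lambda>x. (E' x + c x * E x) * exp (- integral {a..x} (\<lambda>x. - c x)))"
    by (rule ac_deriv_linear[OF _ ci']) (rule ac_deriv_cong[OF E], auto)
  have dn: "ac_deriv a b (\<lambda>x. E x * exp (- integral {a..x} c)) (\<lambda>x. (E' x - c x * E x) * exp (- integral {a..x} c))"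
    by (rule ac_deriv_linear[OF _ ci]) (rule ac_deriv_cong[OF E], auto)
  have E0: "E x0 > 0"
    using x0(2) by (auto simp: E_def intro: add_pos_nonneg add_nonneg_pos)
  have Epos: "E x > 0" if x: "x \<in> {a..b}" for x
  proof (cases "x0 \<le> x")
    case True
    have "E x0 * exp (- integral {a..x0} (\<lambda>x. - c x)) \<le> E x * exp (- integral {a..x} (\<lambda>x. - c x))"
    proof (rule ac_deriv_mono[OF ac_deriv_subinterval[OF up] _ True])
      show "0 \<le> (E' z + c z * E z) * exp (- integral {a..z} (\<lambda>x. - c x))" for z
        using Ec[of z] by (intro mult_nonneg_nonneg) auto
    qed (use x x0 in auto)
    with E0 show ?thesis
      by (smt (verit) exp_gt_zero mult_pos_pos zero_less_mult_pos2)
  next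
    case False
    have "- (E x * exp (- integral {a..x} c)) \<le> - (E x0 * exp (- integral {a..x0} c))"
    proof (rule ac_deriv_mono[where f = "\<lambda>x. - (E x * exp (- integral {a..x} c))"])
      have "ac_deriv x x0 (\<lambda>x. 0 - E x * exp (- integral {a..x} c)) (\<lambda>x. 0 - (E' x - c x * E x) * exp (- integral {a..x} c))"
        by (rule ac_deriv_diff[OF ac_deriv_const ac_deriv_subinterval[OF dn]]) (use x x0 in auto)
      then show "ac_deriv x x0 (\<lambda>x. - (E x * exp (- integral {a..x} c))) (\<lambda>x. (c x * E x - E' x) * exp (- integral {a..x} c))"
        by (rule ac_deriv_cong) (auto simp: algebra_simps)
      show "0 \<le> (c z * E z - E' z) * exp (- integral {a..z} c)" for z
        using Ec[of z] by (intro mult_nonneg_nonneg) auto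
    qed (use False in auto)
    with E0 show ?thesis
      by (smt (verit) exp_gt_zero mult_pos_pos zero_less_mult_pos2)
  qed
  have powE: "ac_deriv a b (\<lambda>x. E x powr r) (\<lambda>x. r * E x powr (r - 1) * E' x)" for r
  proof (rule ac_deriv_chain[OF E, of "\<lambda>u. u powr r" "\<lambda>u. r * u powr (r - 1)"])
    show "((\<lambda>u. u powr r) has_real_derivative r * u powr (r - 1)) (at u)" if "u \<in> E ` {a..b}" for u
      using Epos that by (auto intro: has_real_derivative_powr)
    show "continuous_on (E ` {a..b}) (\<lambda>u. r * u powr (r - 1))"
      using Epos by (intro continuous_intros) force
  qed
  define s where "s x = y x * E x powr (- 1 / p)" for x
  define v where "v x = w x * E x powr (- (p - 1) / p)" for x
  define h where "h x = \<kappa> + (\<mu> x - \<kappa>) * \<bar>s x\<bar> powr p" for x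
  have sp: "\<bar>s x\<bar> powr p = \<bar>y x\<bar> powr p / E x" if "x \<in> {a..b}" for x
  proof -
    have "- 1 / p * p = - 1" using p by simp
    then have "(E x powr (- 1 / p)) powr p = 1 / E x"
      using Epos[OF that] powr_minus_divide[of "E x" 1] unfolding powr_powr by simp
    then show ?thesis by (simp add: s_def abs_mult powr_mult)
  qed
  have vp: "\<bar>v x\<bar> powr (p / (p - 1)) = \<bar>w x\<bar> powr (p / (p - 1)) / E x" if "x \<in> {a..b}" for x
  proof -
    have "- (p - 1) / p * (p / (p - 1)) = - 1" using p by (simp add: field_simps)
    then have "(E x powr (- (p - 1) / p)) powr (p / (p - 1)) = 1 / E x"
      using Epos[OF that] powr_minus_divide[of "E x" 1] unfolding powr_powr by simp
    then show ?thesis by (simp add: v_def abs_mult powr_mult)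
  qed
  have spowE: "spow (z * E x powr e) r = spow z r * E x powr (e * r)" if "x \<in> {a..b}" for x z e r
    using Epos[OF that] by (simp add: spow_mult spow_pos powr_powr)
  have vW: "spow (v x) (1 / (p - 1)) = W x * E x powr (- 1 / p)" if "x \<in> {a..b}" for x
  proof -
    have "- (p - 1) / p * (1 / (p - 1)) = - 1 / p" using p by (simp add: field_simps)
    then show ?thesis unfolding v_def spowE[OF that] W_def by simp
  qed
  have sY: "spow (s x) (p - 1) = Y x * E x powr (- (p - 1) / p)" if "x \<in> {a..b}" for x
  proof -
    have "- 1 / p * (p - 1) = - (p - 1) / p" by (simp only: times_divide_eq_left mult_minus_left mult_1)
    then show ?thesis unfolding s_def spowE[OF that] Y_def by (simp only:)
  qed
  have s: "ac_deriv a b s (\<lambda>x. h x * spow (v x) (1 / (p - 1)))"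
  proof (rule ac_deriv_cong[OF ac_deriv_mult[OF y powE[of "- 1 / p"]]])
    show "y x * E x powr (- 1 / p) = s x" for x by (simp add: s_def)
    fix x assume "x \<in> {a<..<b}"
    then have x: "x \<in> {a..b}" by auto
    have e: "E x powr (- 1 / p - 1) = E x powr (- 1 / p) / E x" using Epos[OF x] by (simp add: powr_diff)
    have yY: "y x * Y x = \<bar>y x\<bar> powr p" using mult_spow[of "y x" "p - 1"] by (simp add: Y_def)
    have "\<kappa> * W x * P + y x * (- 1 / p * (P / E x) * E' x) = (\<kappa> + (\<mu> x - \<kappa>) * (y x * Y x / E x)) * (W x * P)" for P
      using Epos[OF x] p by (simp add: E'_def field_simps)
    then show "\<kappa> * spow (w x) (1 / (p - 1)) * E x powr (- 1 / p) + y x * (- 1 / p * E x powr (- 1 / p - 1) * E' x)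
       = h x * spow (v x) (1 / (p - 1))"
      unfolding vW[OF x] h_def sp[OF x] yY[symmetric] e W_def[symmetric] .
  qed
  have v: "ac_deriv a b v (\<lambda>x. - (p - 1) * h x * spow (s x) (p - 1))"
  proof (rule ac_deriv_cong[OF ac_deriv_mult[OF w powE[of "- (p - 1) / p"]]])
    show "w x * E x powr (- (p - 1) / p) = v x" for x by (simp add: v_def)
    fix x assume "x \<in> {a<..<b}"
    then have x: "x \<in> {a..b}" by auto
    have e: "E x powr (- (p - 1) / p - 1) = E x powr (- (p - 1) / p) / E x" using Epos[OF x] by (simp add: powr_diff)
    have yY: "y x * Y x = \<bar>y x\<bar> powr p" using mult_spow[of "y x" "p - 1"] by (simp add: Y_def)
    have "1 / (p - 1) + 1 = p / (p - 1)" using p by (simp add: field_simps)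
    then have wW: "w x * W x = E x - y x * Y x"
      using mult_spow[of "w x" "1 / (p - 1)"] by (simp add: W_def yY E_def)
    have "w x * (- (p - 1) / p * (P / E x) * E' x) = - (p - 1) * (w x * W x) / E x * (\<kappa> - \<mu> x) * (Y x * P)" for P
      using Epos[OF x] p by (simp add: E'_def field_simps)
    moreover have "- (p - 1) * \<mu> x * Y x * P + - (p - 1) * (w x * W x) / E x * (\<kappa> - \<mu> x) * (Y x * P)
       = - (p - 1) * (\<kappa> + (\<mu> x - \<kappa>) * (y x * Y x / E x)) * (Y x * P)" for P
      unfolding wW using Epos[OF x] by (simp add: field_simps)
    ultimately show "- (p - 1) * \<mu> x * spow (y x) (p - 1) * E x powr (- (p - 1) / p)
         + w x * (- (p - 1) / p * E x powr (- (p - 1) / p - 1) * E' x)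
       = - (p - 1) * h x * spow (s x) (p - 1)"
      unfolding sY[OF x] h_def sp[OF x] yY[symmetric] e Y_def[symmetric] by simp
  qed
  have curve: "\<bar>s x\<bar> powr p + \<bar>v x\<bar> powr (p / (p - 1)) = 1" if x: "x \<in> {a..b}" for x
    using Epos[OF x] unfolding sp[OF x] vp[OF x] by (simp add: E_def add_divide_distrib[symmetric])
  have hi: "h absolutely_integrable_on {a..b}"
  proof -
    have "continuous_on {a..b} (\<lambda>x. \<bar>s x\<bar> powr p)"
      using ac_deriv_continuous[OF s] p by (intro continuous_on_powr' continuous_intros) auto
    from absolutely_integrable_continuous_mult[OF \<mu>\<kappa> this]
    have "(\<lambda>x. \<kappa> - (\<kappa> - \<mu> x) * \<bar>s x\<bar> powr p) absolutely_integrable_on {a..b}"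
      by (intro set_integral_diff absolutely_integrable_on_const) auto
    then show ?thesis unfolding h_def by (simp add: algebra_simps)
  qed
  obtain \<theta> where \<theta>: "ac_deriv a b \<theta> h" "\<And>x. x \<in> {a..b} \<Longrightarrow> gsin (\<theta> x) = s x"
    "\<And>x. x \<in> {a..b} \<Longrightarrow> gmom (\<theta> x) = v x"
    using angle_ode_lift[OF ab s v curve hi] by blast
  show thesis
  proof
    show "ac_deriv a b \<theta> (\<lambda>x. \<kappa> + (\<mu> x - \<kappa>) * gpot (\<theta> x))"
      by (rule ac_deriv_cong[OF \<theta>(1)]) (auto simp: h_def gpot_def \<theta>(2))
    show "E x = \<bar>y x\<bar> powr p + \<bar>w x\<bar> powr (p / (p - 1))" for x by (rule E_def)
    fix x assume x: "x \<in> {a..b}"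
    show "E x > 0" using Epos[OF x] .
    show "y x = E x powr (1 / p) * gsin (\<theta> x)"
      unfolding \<theta>(2)[OF x] s_def using Epos[OF x] by (simp add: powr_minus)
    have "(p - 1) / p = 1 - 1 / p" using p by (simp add: field_simps)
    then have "E x powr (- (p - 1) / p) = inverse (E x powr (1 - 1 / p))"
      by (metis minus_divide_left powr_minus)
    then show "w x = E x powr (1 - 1 / p) * gmom (\<theta> x)"
      unfolding \<theta>(3)[OF x] v_def using Epos[OF x] by simp
  qed
qed

end

section \<open>The flow of the angle equation\<close>

lemma absolutely_integrable_cmult:
  fixes b :: "real \<Rightarrow> real"
  assumes "b absolutely_integrable_on {u..v}"
  shows "(\<lambda>x. c * b x) absolutely_integrable_on {u..v}"
  using absolutely_integrable_continuous_mult[OF assms, of "\<lambda>_. c"] by (simp add: mult.commute)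

lemma absolutely_integrable_add_const:
  fixes b :: "real \<Rightarrow> real"
  assumes "b absolutely_integrable_on {u..v}"
  shows "(\<lambda>x. a + b x) absolutely_integrable_on {u..v}"
  using assms by (intro set_integral_add absolutely_integrable_on_const) auto

lemma continuous_on_lipschitz_real:
  fixes G :: "real \<Rightarrow> real"
  assumes "\<And>u v. \<bar>G u - G v\<bar> \<le> L * \<bar>u - v\<bar>"
  shows "continuous_on A G"
proof -
  have "(\<bar>L\<bar>)-lipschitz_on A G"
  proof (rule lipschitz_onI)
    fix u v
    have "\<bar>G u - G v\<bar> \<le> L * \<bar>u - v\<bar>" by (rule assms)
    also have "\<dots> \<le> \<bar>L\<bar> * \<bar>u - v\<bar>" by (intro mult_right_mono) auto
    finally show "dist (G u) (G v) \<le> \<bar>L\<bar> * dist u v" by (simp add: dist_real_def)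
  qed simp
  then show ?thesis by (rule lipschitz_on_continuous_on)
qed

text \<open>
  Banach's fixed point theorem with the Bielecki weight \<open>exp (2 L \<integral> |b|)\<close>, which makes the
  integral operator a contraction with constant \<open>1/2\<close>.
\<close>

lemma caratheodory_ode_exists:
  fixes G b :: "real \<Rightarrow> real"
  assumes G: "\<And>u v. \<bar>G u - G v\<bar> \<le> L * \<bar>u - v\<bar>" and L: "L > 0"
    and b: "b absolutely_integrable_on {0..1}"
  shows "\<exists>\<theta>. \<theta> 0 = t0 \<and> ac_deriv 0 1 \<theta> (\<lambda>x. a + b x * G (\<theta> x))"
proof -
  define B where "B x = integral {0..x} (\<lambda>x. \<bar>b x\<bar>)" for x
  have ab: "(\<lambda>x. \<bar>b x\<bar>) absolutely_integrable_on {0..1}" using b by (rule set_integrable_abs)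
  have Bac: "ac_deriv 0 1 B (\<lambda>x. \<bar>b x\<bar>)" unfolding B_def by (rule ac_deriv_integral[OF ab])
  have Bc: "continuous_on {0..1} B" by (rule ac_deriv_continuous[OF Bac])
  have Gc: "continuous_on A G" for A using G by (rule continuous_on_lipschitz_real)
  define e where "e x = exp (2 * L * B x)" for x
  have epos: "e x > 0" for x by (simp add: e_def)
  have ec: "continuous_on {0..1} e" unfolding e_def by (intro continuous_intros Bc)
  have eac: "ac_deriv 0 1 e (\<lambda>x. 2 * L * e x * \<bar>b x\<bar>)"
    unfolding e_def
    by (rule ac_deriv_chain[OF Bac, of "\<lambda>u. exp (2 * L * u)" "\<lambda>u. 2 * L * exp (2 * L * u)"])
      (auto intro!: derivative_eq_intros continuous_on_mult continuous_on_exp continuous_on_const continuous_on_id)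
  \<comment> \<open>The Banach space consists of bounded continuous functions on the whole line;
    clamping the argument extends functions on \<open>[0, 1]\<close> by constants.\<close>
  define cl where "cl x = max 0 (min 1 x)" for x :: real
  have cl: "cl x \<in> {0..1}" "x \<in> {0..1} \<Longrightarrow> cl x = x" for x by (auto simp: cl_def)
  have clc: "continuous_on UNIV cl" unfolding cl_def by (intro continuous_intros)
  \<comment> \<open>\<open>z\<close> stands for \<open>\<theta> / e\<close>, so the sup metric in
    \<open>z\<close> is the weighted metric in \<open>\<theta>\<close>.\<close>
  define f where "f z s = a + b s * G (e s * apply_bcontfun z s)" for z s
  have fi: "f z absolutely_integrable_on {0..1}" for z unfolding f_def
    by (intro absolutely_integrable_add_const absolutely_integrable_continuous_mult[OF b]
        continuous_on_compose2[OF Gc[of UNIV]] continuous_intros ec) auto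
  define T where "T z x = (t0 + integral {0..cl x} (f z)) / e (cl x)" for z x
  have Tb: "T z \<in> bcontfun" for z
  proof -
    have c: "continuous_on {0..1} (\<lambda>x. (t0 + integral {0..x} (f z)) / e x)"
      using fi epos by (intro continuous_intros ec indefinite_integral_continuous_1)
        (auto simp: absolutely_integrable_on_def less_imp_neq[symmetric])
    then have "bounded ((\<lambda>x. (t0 + integral {0..x} (f z)) / e x) ` {0..1})"
      using compact_continuous_image compact_imp_bounded by blast
    then obtain M where "\<And>x. x \<in> {0..1} \<Longrightarrow> norm ((t0 + integral {0..x} (f z)) / e x) \<le> M"
      unfolding bounded_iff by fastforce
    then have "norm (T z x) \<le> M" for x using cl(1)[of x] unfolding T_def by blast
    moreover have "continuous_on UNIV (T z)" unfolding T_def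
      by (rule continuous_on_compose2[OF c clc]) (use cl in auto)
    ultimately show ?thesis by (intro bcontfun_normI)
  qed
  have contr: "dist (Bcontfun (T z)) (Bcontfun (T w)) \<le> 1/2 * dist z w" for z w
  proof (rule dist_bound)
    fix x
    define c where "c = cl x"
    have c: "0 \<le> c" "c \<le> 1" using cl(1)[of x] by (auto simp: c_def)
    define d where "d = dist z w"
    have zw: "\<bar>apply_bcontfun z s - apply_bcontfun w s\<bar> \<le> d" for s
      using dist_bounded[of z s w] by (simp add: d_def dist_real_def)
    have sub: "{0..c} \<subseteq> {0..1}" using c by auto
    have fic: "f z integrable_on {0..c}" for z
      using fi[of z] sub by (auto simp: absolutely_integrable_on_def intro: integrable_on_subinterval)
    \<comment> \<open>The weight has derivative \<open>2 L \<bar>b\<bar> e\<close>, twice the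
      Lipschitz bound of the integrand; this is the source of the constant
      \<open>1/2\<close>.\<close>
    have eint: "((\<lambda>s. 2 * L * e s * \<bar>b s\<bar>) has_integral (e c - e 0)) {0..c}"
      using ac_deriv_ftc[OF ac_deriv_subinterval[OF eac sub] c(1)] .
    have "((\<lambda>s. d / 2 * (2 * L * e s * \<bar>b s\<bar>)) has_integral d / 2 * (e c - e 0)) {0..c}"
      by (rule has_integral_mult_right[OF eint])
    then have I: "((\<lambda>s. L * d * e s * \<bar>b s\<bar>) has_integral d / 2 * (e c - e 0)) {0..c}"
      by (simp add: mult_ac)
    have "norm (integral {0..c} (\<lambda>s. f z s - f w s)) \<le> integral {0..c} (\<lambda>s. L * d * e s * \<bar>b s\<bar>)"
    proof (rule integral_norm_bound_integral)
      show "(\<lambda>s. f z s - f w s) integrable_on {0..c}" by (intro integrable_diff fic)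
      show "(\<lambda>s. L * d * e s * \<bar>b s\<bar>) integrable_on {0..c}" using I by blast
      fix s
      have "\<bar>G (e s * apply_bcontfun z s) - G (e s * apply_bcontfun w s)\<bar> \<le> L * \<bar>e s * apply_bcontfun z s - e s * apply_bcontfun w s\<bar>"
        by (rule G)
      also have "\<dots> = L * (e s * \<bar>apply_bcontfun z s - apply_bcontfun w s\<bar>)"
        using epos[of s] by (simp add: right_diff_distrib[symmetric] abs_mult)
      also have "\<dots> \<le> L * (e s * d)"
        using zw L epos[of s] by (intro mult_left_mono) auto
      finally have "\<bar>b s\<bar> * \<bar>G (e s * apply_bcontfun z s) - G (e s * apply_bcontfun w s)\<bar> \<le> \<bar>b s\<bar> * (L * (e s * d))"
        by (intro mult_left_mono) auto
      then show "norm (f z s - f w s) \<le> L * d * e s * \<bar>b s\<bar>"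
        by (simp add: f_def right_diff_distrib[symmetric] abs_mult mult_ac)
    qed
    also have "\<dots> = d / 2 * (e c - e 0)" using I by (rule integral_unique)
    also have "\<dots> \<le> d / 2 * e c" using epos[of 0] by (intro mult_left_mono) (auto simp: d_def)
    finally have le: "\<bar>integral {0..c} (f z) - integral {0..c} (f w)\<bar> \<le> d / 2 * e c"
      by (simp add: integral_diff fic)
    have "T z x - T w x = (integral {0..c} (f z) - integral {0..c} (f w)) / e c"
      by (simp add: T_def c_def diff_divide_distrib add_divide_distrib)
    then have "\<bar>T z x - T w x\<bar> \<le> d / 2 * e c / e c"
      using divide_right_mono[OF le, of "e c"] epos[of c] by (simp only: abs_divide abs_of_pos less_imp_le)
    then show "dist (apply_bcontfun (Bcontfun (T z)) x) (apply_bcontfun (Bcontfun (T w)) x) \<le> 1/2 * dist z w"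
      using epos[of c] Tb by (simp add: Bcontfun_inverse dist_real_def d_def)
  qed
  obtain z where z: "Bcontfun (T z) = z"
    using banach_fix_type[of "1/2" "\<lambda>z. Bcontfun (T z)"] contr by auto
  then have zT: "apply_bcontfun z x = T z x" for x using Bcontfun_inverse[OF Tb[of z]] by simp
  define \<theta> where "\<theta> x = e x * apply_bcontfun z x" for x
  have \<theta>: "\<theta> x = t0 + integral {0..x} (f z)" if "x \<in> {0..1}" for x
    using cl(2)[OF that] epos[of x] by (simp add: \<theta>_def zT T_def)
  have "ac_deriv 0 1 \<theta> (f z)"
    by (rule ac_deriv_of_integral[OF fi]) (simp add: \<theta>)
  then have "ac_deriv 0 1 \<theta> (\<lambda>x. a + b x * G (\<theta> x))"
    by (simp add: f_def[abs_def] \<theta>_def)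
  moreover have "\<theta> 0 = t0" using \<theta>[of 0] by simp
  ultimately show ?thesis by blast
qed

text \<open>The divided difference, continued by the derivative on the diagonal. It makes
  \<open>F u - F v\<close> an exact multiple of \<open>u - v\<close>, so that differences of
  solutions obey linear equations without an error term.\<close>

definition slope :: "(real \<Rightarrow> real) \<Rightarrow> (real \<Rightarrow> real) \<Rightarrow> real \<Rightarrow> real \<Rightarrow> real" where
  "slope F F' u v = (if u = v then F' u else (F u - F v) / (u - v))"

lemma slope_mult: "F u - F v = slope F F' u v * (u - v)"
  by (simp add: slope_def)

lemma slope_mvt:
  assumes "\<And>u. (F has_real_derivative F' u) (at u)"
  shows "\<exists>w. min u v \<le> w \<and> w \<le> max u v \<and> slope F F' u v = F' w"
proof (cases u v rule: linorder_cases)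
  case less
  then obtain z where "u < z" "z < v" "F v - F u = (v - u) * F' z" using MVT2[of u v F F'] assms by auto
  then show ?thesis using less by (intro exI[of _ z]) (auto simp: slope_def field_simps)
next
  case greater
  then obtain z where "v < z" "z < u" "F u - F v = (u - v) * F' z" using MVT2[of v u F F'] assms by auto
  then show ?thesis using greater by (intro exI[of _ z]) (auto simp: slope_def field_simps)
qed (auto simp: slope_def)

text \<open>Near a point of the diagonal the mean value theorem turns divided differences into
  nearby values of \<open>F'\<close>, so a continuous derivative is enough.\<close>

lemma continuous_slope:
  assumes F: "\<And>u. (F has_real_derivative F' u) (at u)" and F': "continuous_on UNIV F'"
  shows "continuous_on UNIV (\<lambda>z. slope F F' (fst z) (snd z))"
proof (rule continuous_at_imp_continuous_on, rule ballI)
  fix z :: "real \<times> real"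
  obtain u v where z: "z = (u, v)" by (cases z)
  have Fc: "continuous_on UNIV F" using F DERIV_isCont by (blast intro: continuous_at_imp_continuous_on)
  show "isCont (\<lambda>z. slope F F' (fst z) (snd z)) z"
  proof (cases "u = v")
    case False
    define U where "U = {z :: real \<times> real. fst z \<noteq> snd z}"
    have "open U" unfolding U_def by (intro open_Collect_neq continuous_intros)
    moreover have "continuous_on U (\<lambda>z. (F (fst z) - F (snd z)) / (fst z - snd z))"
      by (intro continuous_intros continuous_on_compose2[OF Fc]) (auto simp: U_def)
    then have "continuous_on U (\<lambda>z. slope F F' (fst z) (snd z))"
      by (rule continuous_on_eq) (auto simp: U_def slope_def)
    ultimately show ?thesis using False z by (intro continuous_on_interior[of U]) (auto simp: interior_open U_def)
  next
    case True
    have "isCont F' u" using F' by (simp add: continuous_on_eq_continuous_at)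
    show ?thesis unfolding continuous_at_eps_delta
    proof (intro allI impI)
      fix \<epsilon> :: real assume "\<epsilon> > 0"
      then obtain d where d: "d > 0" "\<And>w. \<bar>w - u\<bar> < d \<Longrightarrow> \<bar>F' w - F' u\<bar> < \<epsilon>"
        using \<open>isCont F' u\<close> unfolding continuous_at_eps_delta by (auto simp: dist_real_def)
      show "\<exists>d>0. \<forall>z'. dist z' z < d \<longrightarrow> dist (slope F F' (fst z') (snd z')) (slope F F' (fst z) (snd z)) < \<epsilon>"
      proof (intro exI[of _ d] conjI allI impI)
        fix z' assume "dist z' z < d"
        then have near: "\<bar>fst z' - u\<bar> < d" "\<bar>snd z' - u\<bar> < d"
          using dist_fst_le[of z' z] dist_snd_le[of z' z] z True by (auto simp: dist_real_def)
        obtain w where w: "min (fst z') (snd z') \<le> w" "w \<le> max (fst z') (snd z')"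
          "slope F F' (fst z') (snd z') = F' w" using slope_mvt[OF F] by blast
        have "\<bar>w - u\<bar> < d" using w(1,2) near by (auto simp: min_def max_def split: if_splits)
        then show "dist (slope F F' (fst z') (snd z')) (slope F F' (fst z) (snd z)) < \<epsilon>"
          using d(2) w(3) z True by (simp add: dist_real_def slope_def)
      qed (rule d(1))
    qed
  qed
qed

lemma has_integral_abs_le:
  fixes f :: "real \<Rightarrow> real"
  assumes "(f has_integral i) {0..x}" "\<And>s. s \<in> {0..x} \<Longrightarrow> \<bar>f s\<bar> \<le> c" "0 \<le> x" "x \<le> 1" "0 \<le> c"
  shows "\<bar>i\<bar> \<le> c"
proof -
  have "\<bar>i\<bar> \<le> c * x"
    using has_integral_bound[of c f i 0 x] assms by auto
  also have "\<dots> \<le> c" using assms by (simp add: mult_left_le)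
  finally show ?thesis .
qed

context half_linear
begin

lemma gpot_lipschitz: "\<bar>gpot u - gpot v\<bar> \<le> p * \<bar>u - v\<bar>"
proof -
  obtain w where "slope gpot gpot' u v = gpot' w" using slope_mvt[OF gpot_has_derivative] by blast
  then show ?thesis
    using abs_gpot'_le[of w] slope_mult[of gpot u v gpot'] by (simp add: abs_mult mult_right_mono)
qed

lemma abs_slope_gpot: "\<bar>slope gpot gpot' u v\<bar> \<le> p"
  using slope_mvt[OF gpot_has_derivative] abs_gpot'_le by metis

lemma continuous_slope_gpot:
  assumes "continuous_on A f" "continuous_on A g"
  shows "continuous_on A (\<lambda>x. slope gpot gpot' (f x) (g x))"
  using continuous_on_compose2[OF continuous_slope[OF gpot_has_derivative continuous_gpot'], of A "\<lambda>x. (f x, g x)"]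
    assms by (auto intro: continuous_on_Pair)

text \<open>The difference of the angles solves a linear equation with coefficient \<open>b\<close>
  times the divided difference, which the integrating factor removes. \<open>c1\<close> and
  \<open>c2\<close> are functions so that solutions for different parameters, and upper solutions,
  can be compared too.\<close>

lemma angle_difference:
  assumes 1: "ac_deriv 0 1 \<theta>1 (\<lambda>x. c1 x + b x * gpot (\<theta>1 x))"
    and 2: "ac_deriv 0 1 \<theta>2 (\<lambda>x. c2 x + b x * gpot (\<theta>2 x))"
    and b: "b absolutely_integrable_on {0..1}"
  defines "M \<equiv> \<lambda>x. integral {0..x} (\<lambda>x. b x * slope gpot gpot' (\<theta>1 x) (\<theta>2 x))"
  shows "ac_deriv 0 1 (\<lambda>x. (\<theta>1 x - \<theta>2 x) * exp (- M x)) (\<lambda>x. (c1 x - c2 x) * exp (- M x))"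
    and "\<And>x. x \<in> {0..1} \<Longrightarrow> \<bar>M x\<bar> \<le> p * integral {0..1} (\<lambda>x. \<bar>b x\<bar>)"
proof -
  define m where "m x = b x * slope gpot gpot' (\<theta>1 x) (\<theta>2 x)" for x
  have m: "m absolutely_integrable_on {0..1}" unfolding m_def
    by (intro absolutely_integrable_continuous_mult[OF b] continuous_slope_gpot ac_deriv_continuous[OF 1] ac_deriv_continuous[OF 2])
  have "ac_deriv 0 1 (\<lambda>x. \<theta>1 x - \<theta>2 x) (\<lambda>x. m x * (\<theta>1 x - \<theta>2 x) + (c1 x - c2 x))"
  proof (rule ac_deriv_cong[OF ac_deriv_diff[OF 1 2]])
    fix x
    show "c1 x + b x * gpot (\<theta>1 x) - (c2 x + b x * gpot (\<theta>2 x)) = m x * (\<theta>1 x - \<theta>2 x) + (c1 x - c2 x)"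
    proof -
      have "b x * (gpot (\<theta>1 x) - gpot (\<theta>2 x)) = m x * (\<theta>1 x - \<theta>2 x)"
        unfolding m_def slope_mult[of gpot "\<theta>1 x" "\<theta>2 x" gpot'] by (simp only: mult.assoc)
      then show ?thesis unfolding right_diff_distrib by linarith
    qed
  qed simp
  from ac_deriv_linear[OF this m]
  show "ac_deriv 0 1 (\<lambda>x. (\<theta>1 x - \<theta>2 x) * exp (- M x)) (\<lambda>x. (c1 x - c2 x) * exp (- M x))"
    unfolding M_def m_def .
  fix x :: real assume "x \<in> {0..1}"
  then show "\<bar>M x\<bar> \<le> p * integral {0..1} (\<lambda>x. \<bar>b x\<bar>)"
    unfolding M_def m_def[symmetric]
  proof (intro integral_abs_bound[OF b])
    show "\<bar>m x\<bar> \<le> p * \<bar>b x\<bar>" for x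
      using mult_right_mono[OF abs_slope_gpot, of "\<bar>b x\<bar>"] by (simp add: m_def abs_mult mult.commute)
    show "m integrable_on {0..1}" using m by (simp add: absolutely_integrable_on_def)
  qed (use p in auto)
qed

lemma angle_unique:
  assumes 1: "ac_deriv 0 1 \<theta>1 (\<lambda>x. c + b x * gpot (\<theta>1 x))"
    and 2: "ac_deriv 0 1 \<theta>2 (\<lambda>x. c + b x * gpot (\<theta>2 x))"
    and b: "b absolutely_integrable_on {0..1}" and eq: "\<theta>1 0 = \<theta>2 0" and x: "x \<in> {0..1}"
  shows "\<theta>1 x = \<theta>2 x"
  using ac_deriv_eq_integral[OF angle_difference(1)[OF 1 2 b] x] eq by simp

text \<open>At multiples of \<open>pi_hat p\<close> the term with \<open>gpot\<close> vanishes and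
  the speed is formally \<open>c > 0\<close>. Since \<open>b\<close> is only integrable, this is
  made rigorous by comparison: the constant at such a multiple solves the same equation with
  \<open>c\<close> replaced by \<open>0\<close>.\<close>

lemma angle_crosses_upwards:
  assumes \<theta>: "ac_deriv 0 1 \<theta> (\<lambda>x. c + b x * gpot (\<theta> x))" and b: "b absolutely_integrable_on {0..1}"
    and c: "c > 0" and x: "0 \<le> x1" "x1 < x2" "x2 \<le> 1" and ge: "\<theta> x1 \<ge> of_int n * pi_hat p"
  shows "\<theta> x2 > of_int n * pi_hat p"
proof -
  define t where "t = of_int n * pi_hat p"
  have t: "gpot t = 0" using half_turns(1)[of 0 n] by (simp add: t_def)
  have 2: "ac_deriv 0 1 (\<lambda>x. t) (\<lambda>x. 0 + b x * gpot t)"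
    using ac_deriv_const[of 0 1 t] by (simp add: t)
  define M where "M x = integral {0..x} (\<lambda>x. b x * slope gpot gpot' (\<theta> x) t)" for x
  have ac: "ac_deriv 0 1 (\<lambda>x. (\<theta> x - t) * exp (- M x)) (\<lambda>x. c * exp (- M x))"
    and Mb: "\<And>x. x \<in> {0..1} \<Longrightarrow> \<bar>M x\<bar> \<le> p * integral {0..1} (\<lambda>x. \<bar>b x\<bar>)"
    using angle_difference[OF \<theta> 2 b] unfolding M_def by auto
  \<comment> \<open>A positive lower bound for the transformed right-hand side
    \<open>c exp (- M)\<close>; it makes the final inequality strict.\<close>
  define k where "k = c * exp (- (p * integral {0..1} (\<lambda>x. \<bar>b x\<bar>)))"
  have k: "k > 0" using c by (simp add: k_def)
  have "((\<theta> x1 - t) * exp (- M x1) - k * x1) \<le> ((\<theta> x2 - t) * exp (- M x2) - k * x2)"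
  proof (rule ac_deriv_mono[where f = "\<lambda>x. (\<theta> x - t) * exp (- M x) - k * x" and g = "\<lambda>x. c * exp (- M x) - k"])
    show "ac_deriv x1 x2 (\<lambda>x. (\<theta> x - t) * exp (- M x) - k * x) (\<lambda>x. c * exp (- M x) - k)"
      by (intro ac_deriv_diff ac_deriv_subinterval[OF ac] ac_deriv_C1)
        (use x in \<open>auto intro!: derivative_eq_intros\<close>)
    fix s assume "s \<in> {x1<..<x2}"
    then have "M s \<le> p * integral {0..1} (\<lambda>x. \<bar>b x\<bar>)" using Mb[of s] x by auto
    then show "0 \<le> c * exp (- M s) - k" using c by (simp add: k_def)
  qed (use x in auto)
  moreover have "(\<theta> x1 - t) * exp (- M x1) \<ge> 0" using ge by (simp add: t_def)
  moreover have "k * x1 < k * x2" using k x by simp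
  ultimately have "(\<theta> x2 - t) * exp (- M x2) > 0" by linarith
  then show ?thesis by (simp add: t_def zero_less_mult_iff)
qed

end

section \<open>The angle flow and its displacement over one period\<close>

locale half_linear_potential = half_linear +
  fixes q :: "real \<Rightarrow> real"
  assumes q: "q absolutely_integrable_on {0..1}"
begin

definition angle_coeff :: "real \<Rightarrow> real \<Rightarrow> real" where "angle_coeff \<mu> x = \<mu> - q x - 1"

lemma angle_coeff: "angle_coeff \<mu> absolutely_integrable_on {0..1}"
  using absolutely_integrable_add_const[OF absolutely_integrable_cmult[OF q, of "-1"], of "\<mu> - 1"]
  by (simp add: angle_coeff_def[abs_def] algebra_simps)

text \<open>By \<open>angle_unique\<close> the choice is immaterial on \<open>{0..1}\<close>, the
  only place where the flow is evaluated.\<close>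

definition flow :: "real \<Rightarrow> real \<Rightarrow> real \<Rightarrow> real" where
  "flow \<mu> t = (SOME \<theta>. \<theta> 0 = t \<and> ac_deriv 0 1 \<theta> (\<lambda>x. 1 + angle_coeff \<mu> x * gpot (\<theta> x)))"

lemma flow_0: "flow \<mu> t 0 = t"
  and flow_ac: "ac_deriv 0 1 (flow \<mu> t) (\<lambda>x. 1 + angle_coeff \<mu> x * gpot (flow \<mu> t x))"
proof -
  have "flow \<mu> t 0 = t \<and> ac_deriv 0 1 (flow \<mu> t) (\<lambda>x. 1 + angle_coeff \<mu> x * gpot (flow \<mu> t x))"
    unfolding flow_def
    by (rule someI_ex[OF caratheodory_ode_exists]) (use gpot_lipschitz p angle_coeff in auto)
  then show "flow \<mu> t 0 = t" "ac_deriv 0 1 (flow \<mu> t) (\<lambda>x. 1 + angle_coeff \<mu> x * gpot (flow \<mu> t x))" by auto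
qed

lemma flow_add_pi_hat:
  assumes "x \<in> {0..1}"
  shows "flow \<mu> (t + of_int n * pi_hat p) x = flow \<mu> t x + of_int n * pi_hat p"
proof (rule angle_unique[OF flow_ac _ angle_coeff _ assms])
  have "ac_deriv 0 1 (\<lambda>x. flow \<mu> t x + of_int n * pi_hat p) (\<lambda>x. 1 + angle_coeff \<mu> x * gpot (flow \<mu> t x) + 0)"
    by (rule ac_deriv_add[OF flow_ac ac_deriv_const])
  then show "ac_deriv 0 1 (\<lambda>x. flow \<mu> t x + of_int n * pi_hat p) (\<lambda>x. 1 + angle_coeff \<mu> x * gpot (flow \<mu> t x + of_int n * pi_hat p))"
    by (simp add: half_turns)
qed (simp add: flow_0)

lemma flow_mono:
  assumes "s < t" "x \<in> {0..1}"
  shows "flow \<mu> s x < flow \<mu> t x"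
proof -
  define M where "M x = integral {0..x} (\<lambda>x. angle_coeff \<mu> x * slope gpot gpot' (flow \<mu> t x) (flow \<mu> s x))" for x
  have "(flow \<mu> t x - flow \<mu> s x) * exp (- M x) = t - s"
    using ac_deriv_eq_integral[OF angle_difference(1)[OF flow_ac flow_ac angle_coeff] assms(2), of \<mu> t s]
    by (simp add: M_def flow_0)
  then have "(flow \<mu> t x - flow \<mu> s x) * exp (- M x) > 0" using assms(1) by simp
  then show ?thesis by (simp add: zero_less_mult_iff)
qed

text \<open>The change of parameter is absorbed into the inhomogeneous term
  \<open>(\<nu> - \<mu>) gpot\<close>, so that both angles share the coefficient belonging to
  \<open>\<mu>\<close> and the constant does not depend on \<open>\<nu>\<close> or \<open>s\<close>.
  One factor \<open>exp B\<close> bounds the transformed right-hand side, the other undoes the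
  integrating factor.\<close>

lemma flow_lipschitz:
  obtains C where "C \<ge> 0" "\<And>\<nu> s x. x \<in> {0..1} \<Longrightarrow> \<bar>flow \<nu> s x - flow \<mu> t x\<bar> \<le> C * (\<bar>s - t\<bar> + \<bar>\<nu> - \<mu>\<bar>)"
proof
  define B where "B = p * integral {0..1} (\<lambda>x. \<bar>angle_coeff \<mu> x\<bar>)"
  have B: "B \<ge> 0" unfolding B_def using p angle_coeff[of \<mu>]
    by (intro mult_nonneg_nonneg integral_nonneg) (auto simp: absolutely_integrable_on_def)
  show "exp B * exp B \<ge> 0" by simp
  fix \<nu> s x :: real assume x: "x \<in> {0..1}"
  have 1: "ac_deriv 0 1 (flow \<nu> s) (\<lambda>x. (1 + (\<nu> - \<mu>) * gpot (flow \<nu> s x)) + angle_coeff \<mu> x * gpot (flow \<nu> s x))"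
    by (rule ac_deriv_cong[OF flow_ac]) (auto simp: angle_coeff_def algebra_simps)
  define M where "M x = integral {0..x} (\<lambda>x. angle_coeff \<mu> x * slope gpot gpot' (flow \<nu> s x) (flow \<mu> t x))" for x
  have ac: "ac_deriv 0 1 (\<lambda>x. (flow \<nu> s x - flow \<mu> t x) * exp (- M x)) (\<lambda>x. (\<nu> - \<mu>) * gpot (flow \<nu> s x) * exp (- M x))"
    and Mb: "\<And>x. x \<in> {0..1} \<Longrightarrow> \<bar>M x\<bar> \<le> B"
    using angle_difference[OF 1 flow_ac angle_coeff] unfolding M_def B_def by auto
  have xx: "{0..x} \<subseteq> {0..1}" using x by auto
  have "((\<lambda>x. (\<nu> - \<mu>) * gpot (flow \<nu> s x) * exp (- M x)) has_integral
     ((flow \<nu> s x - flow \<mu> t x) * exp (- M x) - (s - t))) {0..x}"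
    using ac_deriv_ftc[OF ac_deriv_subinterval[OF ac xx]] x by (simp add: flow_0 M_def)
  then have "\<bar>(flow \<nu> s x - flow \<mu> t x) * exp (- M x) - (s - t)\<bar> \<le> \<bar>\<nu> - \<mu>\<bar> * exp B"
  proof (rule has_integral_abs_le)
    fix z assume "z \<in> {0..x}"
    then have "- M z \<le> B" using Mb[of z] xx by auto
    then have "gpot (flow \<nu> s z) * exp (- M z) \<le> 1 * exp B"
      using gpot_nonneg gpot_le_1 by (intro mult_mono) auto
    then show "\<bar>(\<nu> - \<mu>) * gpot (flow \<nu> s z) * exp (- M z)\<bar> \<le> \<bar>\<nu> - \<mu>\<bar> * exp B"
      using gpot_nonneg by (simp add: abs_mult mult.assoc mult_left_mono)
  qed (use x in auto)
  moreover have "\<bar>s - t\<bar> \<le> \<bar>s - t\<bar> * exp B" using B by (simp add: mult_le_cancel_left1)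
  ultimately have *: "\<bar>(flow \<nu> s x - flow \<mu> t x) * exp (- M x)\<bar> \<le> exp B * (\<bar>s - t\<bar> + \<bar>\<nu> - \<mu>\<bar>)"
    by (simp add: algebra_simps)
  have "\<bar>flow \<nu> s x - flow \<mu> t x\<bar> = \<bar>(flow \<nu> s x - flow \<mu> t x) * exp (- M x)\<bar> * exp (M x)"
    by (simp add: abs_mult mult.assoc exp_minus)
  also have "\<dots> \<le> exp B * (\<bar>s - t\<bar> + \<bar>\<nu> - \<mu>\<bar>) * exp B"
    using * Mb[OF x] by (intro mult_mono) auto
  finally show "\<bar>flow \<nu> s x - flow \<mu> t x\<bar> \<le> exp B * exp B * (\<bar>s - t\<bar> + \<bar>\<nu> - \<mu>\<bar>)"
    by (simp add: mult_ac)
qed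

text \<open>The displacement function of a lifted circle map, the circle having length
  \<open>pi_hat p\<close>; its periodicity in \<open>t\<close> confines the search for extrema to a
  compact interval.\<close>

definition turn :: "real \<Rightarrow> real \<Rightarrow> real" where "turn \<mu> t = flow \<mu> t 1 - t"

lemma turn_add_pi_hat: "turn \<mu> (t + of_int n * pi_hat p) = turn \<mu> t"
  by (simp add: turn_def flow_add_pi_hat)

lemma turn_reduce:
  obtains s where "0 \<le> s" "s \<le> pi_hat p" "turn \<mu> s = turn \<mu> t"
proof -
  define n where "n = \<lfloor>t / pi_hat p\<rfloor>"
  have "of_int n \<le> t / pi_hat p" "t / pi_hat p < of_int n + 1" unfolding n_def by linarith+
  then have "of_int n * pi_hat p \<le> t" "t < of_int n * pi_hat p + pi_hat p"
    using pi_hat_pos by (auto simp: field_simps)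
  then show thesis
    using that[of "t - of_int n * pi_hat p"] turn_add_pi_hat[of \<mu> "t - of_int n * pi_hat p" n] by simp
qed

lemma continuous_turn: "continuous_on UNIV (\<lambda>z. turn (fst z) (snd z))"
proof (rule continuous_at_imp_continuous_on, rule ballI)
  fix z :: "real \<times> real"
  obtain C where C: "C \<ge> 0" "\<And>\<nu> s x. x \<in> {0..1} \<Longrightarrow> \<bar>flow \<nu> s x - flow (fst z) (snd z) x\<bar> \<le> C * (\<bar>s - snd z\<bar> + \<bar>\<nu> - fst z\<bar>)"
    using flow_lipschitz by blast
  have "((\<lambda>w. turn (fst w) (snd w) - turn (fst z) (snd z)) \<longlongrightarrow> 0) (at z)"
  proof (rule Lim_null_comparison[OF always_eventually], rule allI)
    fix w
    show "norm (turn (fst w) (snd w) - turn (fst z) (snd z)) \<le> C * (\<bar>snd w - snd z\<bar> + \<bar>fst w - fst z\<bar>) + \<bar>snd w - snd z\<bar>"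
      using C(2)[of 1 "fst w" "snd w"] unfolding turn_def real_norm_def by simp
    have "((\<lambda>w. C * (\<bar>snd w - snd z\<bar> + \<bar>fst w - fst z\<bar>) + \<bar>snd w - snd z\<bar>) \<longlongrightarrow>
       C * (\<bar>snd z - snd z\<bar> + \<bar>fst z - fst z\<bar>) + \<bar>snd z - snd z\<bar>) (at z)"
      by (intro tendsto_intros)
    then show "((\<lambda>w. C * (\<bar>snd w - snd z\<bar> + \<bar>fst w - fst z\<bar>) + \<bar>snd w - snd z\<bar>) \<longlongrightarrow> 0) (at z)" by simp
  qed
  then show "isCont (\<lambda>z. turn (fst z) (snd z)) z"
    by (simp add: isCont_def LIM_zero_iff)
qed

text \<open>The difference quotient is exactly \<open>exp (I s)\<close>. As \<open>s\<close> tends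
  to \<open>t\<close> the divided differences converge to \<open>gpot'\<close>, boundedly, and
  dominated convergence passes the limit through the integral.\<close>

lemma flow_has_derivative:
  "((\<lambda>s. flow \<mu> s 1) has_real_derivative exp (integral {0..1} (\<lambda>x. angle_coeff \<mu> x * gpot' (flow \<mu> t x)))) (at t)"
proof -
  define I where "I s = integral {0..1} (\<lambda>x. angle_coeff \<mu> x * slope gpot gpot' (flow \<mu> s x) (flow \<mu> t x))" for s
  have quot: "flow \<mu> s 1 - flow \<mu> t 1 = exp (I s) * (s - t)" for s
  proof -
    have "(flow \<mu> s 1 - flow \<mu> t 1) * exp (- I s) = s - t"
      using ac_deriv_eq_integral[OF angle_difference(1)[OF flow_ac flow_ac angle_coeff], of 1 \<mu> s t]
      by (simp add: I_def flow_0)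
    then show ?thesis by (simp add: exp_minus field_simps)
  qed
  obtain C where C: "C \<ge> 0" "\<And>\<nu> s x. x \<in> {0..1} \<Longrightarrow> \<bar>flow \<nu> s x - flow \<mu> t x\<bar> \<le> C * (\<bar>s - t\<bar> + \<bar>\<nu> - \<mu>\<bar>)"
    using flow_lipschitz by blast
  have "(I \<longlongrightarrow> integral {0..1} (\<lambda>x. angle_coeff \<mu> x * gpot' (flow \<mu> t x))) (at t)"
    unfolding tendsto_at_iff_sequentially comp_def
  proof (intro allI impI)
    fix X :: "nat \<Rightarrow> real" assume X: "X \<longlonglongrightarrow> t"
    show "(\<lambda>n. I (X n)) \<longlonglongrightarrow> integral {0..1} (\<lambda>x. angle_coeff \<mu> x * gpot' (flow \<mu> t x))"
      unfolding I_def
    proof (rule dominated_convergence(2)[where h = "\<lambda>x. p * \<bar>angle_coeff \<mu> x\<bar>"])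
      show "(\<lambda>x. angle_coeff \<mu> x * slope gpot gpot' (flow \<mu> (X n) x) (flow \<mu> t x)) integrable_on {0..1}" for n
        using absolutely_integrable_continuous_mult[OF angle_coeff continuous_slope_gpot[OF ac_deriv_continuous[OF flow_ac] ac_deriv_continuous[OF flow_ac]]]
        by (simp add: absolutely_integrable_on_def)
      show "(\<lambda>x. p * \<bar>angle_coeff \<mu> x\<bar>) integrable_on {0..1}"
        using angle_coeff[of \<mu>] by (intro integrable_on_mult_right) (simp add: absolutely_integrable_on_def)
      show "norm (angle_coeff \<mu> x * slope gpot gpot' (flow \<mu> (X n) x) (flow \<mu> t x)) \<le> p * \<bar>angle_coeff \<mu> x\<bar>" for n x
        using mult_right_mono[OF abs_slope_gpot, of "\<bar>angle_coeff \<mu> x\<bar>"] by (simp add: abs_mult mult.commute)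
      fix x :: real assume x: "x \<in> {0..1}"
      have "(\<lambda>n. flow \<mu> (X n) x - flow \<mu> t x) \<longlonglongrightarrow> 0"
      proof (rule Lim_null_comparison[OF always_eventually], rule allI)
        show "norm (flow \<mu> (X n) x - flow \<mu> t x) \<le> C * \<bar>X n - t\<bar>" for n using C(2)[OF x, of \<mu> "X n"] by simp
        have "(\<lambda>n. C * \<bar>X n - t\<bar>) \<longlonglongrightarrow> C * \<bar>t - t\<bar>" by (intro tendsto_intros X)
        then show "(\<lambda>n. C * \<bar>X n - t\<bar>) \<longlonglongrightarrow> 0" by simp
      qed
      then have fl: "(\<lambda>n. flow \<mu> (X n) x) \<longlonglongrightarrow> flow \<mu> t x" by (simp add: LIM_zero_iff)
      have "isCont (\<lambda>z. slope gpot gpot' (fst z) (snd z)) (flow \<mu> t x, flow \<mu> t x)"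
        using continuous_slope[OF gpot_has_derivative continuous_gpot'] by (simp add: continuous_on_eq_continuous_at)
      from isCont_tendsto_compose[OF this tendsto_Pair[OF fl tendsto_const]]
      have "(\<lambda>n. slope gpot gpot' (flow \<mu> (X n) x) (flow \<mu> t x)) \<longlonglongrightarrow> gpot' (flow \<mu> t x)"
        by (simp add: slope_def[of _ _ "flow \<mu> t x" "flow \<mu> t x"])
      then show "(\<lambda>n. angle_coeff \<mu> x * slope gpot gpot' (flow \<mu> (X n) x) (flow \<mu> t x)) \<longlonglongrightarrow> angle_coeff \<mu> x * gpot' (flow \<mu> t x)"
        by (intro tendsto_intros)
    qed
  qed
  then have "((\<lambda>s. exp (I s)) \<longlongrightarrow> exp (integral {0..1} (\<lambda>x. angle_coeff \<mu> x * gpot' (flow \<mu> t x)))) (at t)"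
    by (intro tendsto_intros)
  moreover have "\<forall>\<^sub>F s in at t. exp (I s) = (flow \<mu> s 1 - flow \<mu> t 1) / (s - t)"
    unfolding quot by (auto simp: eventually_at_filter)
  ultimately show ?thesis
    unfolding has_field_derivative_iff by (rule Lim_transform_eventually)
qed

text \<open>The displacement has derivative \<open>exp\<close> of this integral minus
  \<open>1\<close>. The integral is \<open>- p\<close> times the logarithm of the growth of the
  amplitude over the period, so its vanishing closes up the amplitude.\<close>

lemma turn_extremum:
  assumes "(\<forall>s. turn \<mu> t \<le> turn \<mu> s) \<or> (\<forall>s. turn \<mu> s \<le> turn \<mu> t)"
  shows "integral {0..1} (\<lambda>x. angle_coeff \<mu> x * gpot' (flow \<mu> t x)) = 0"
proof -
  have "(turn \<mu> has_real_derivative exp (integral {0..1} (\<lambda>x. angle_coeff \<mu> x * gpot' (flow \<mu> t x))) - 1) (at t)"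
    unfolding turn_def by (intro DERIV_diff flow_has_derivative DERIV_ident)
  then have "exp (integral {0..1} (\<lambda>x. angle_coeff \<mu> x * gpot' (flow \<mu> t x))) - 1 = 0"
    using assms DERIV_local_min[of "turn \<mu>" _ t 1] DERIV_local_max[of "turn \<mu>" _ t 1] by (metis zero_less_one)
  then show ?thesis by simp
qed

end

section \<open>Angles and eigenvalues\<close>

text \<open>Translates the definition of a solution into \<open>ac_deriv\<close>: at interior points
  of \<open>[a, b]\<close> derivatives within \<open>I\<close> are two-sided.\<close>

lemma half_linear_solution_ac_deriv:
  assumes sol: "half_linear_solution p \<mu> q I y y'" and I: "{a..b} \<subseteq> I"
  shows "ac_deriv a b y y'"
    and "ac_deriv a b (\<lambda>x. spow (y' x) (p - 1)) (\<lambda>x. - (p - 1) * (\<mu> - q x) * spow (y x) (p - 1))"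
proof -
  have at: "at x within I = at x" if "x \<in> {a<..<b}" for x
    by (rule at_within_interior) (use that I interior_mono[OF I] in \<open>auto simp: interior_atLeastAtMost_real\<close>)
  have "abs_continuous_on {a..b} y" "abs_continuous_on {a..b} (\<lambda>x. spow (y' x) (p - 1))"
    using sol I unfolding half_linear_solution_def locally_abs_continuous_on_def by auto
  moreover have "(y has_real_derivative y' x) (at x)" if "x \<in> {a<..<b}" for x
  proof -
    have "x \<in> I" using that I by auto
    then have "(y has_real_derivative y' x) (at x within I)" using sol unfolding half_linear_solution_def by blast
    then show ?thesis unfolding at[OF that] .
  qed
  then have "\<exists>N. negligible N \<and> (\<forall>x\<in>{a<..<b} - N. (y has_real_derivative y' x) (at x))"
    by (intro exI[of _ "{}"]) auto
  moreover obtain N where N: "N \<in> null_sets lebesgue" "\<And>x. \<lbrakk>x \<notin> N; x \<in> I\<rbrakk> \<Longrightarrow>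
    \<exists>d. ((\<lambda>t. spow (y' t) (p - 1)) has_real_derivative d) (at x within I) \<and>
             - d = (p - 1) * (\<mu> - q x) * spow (y x) (p - 1)"
  proof -
    have "AE x in lebesgue. x \<in> I \<longrightarrow> (\<exists>d. ((\<lambda>t. spow (y' t) (p - 1)) has_real_derivative d) (at x within I) \<and>
             - d = (p - 1) * (\<mu> - q x) * spow (y x) (p - 1))"
      using sol unfolding half_linear_solution_def by blast
    then obtain N where "N \<in> null_sets lebesgue" "{x \<in> space lebesgue. \<not> (x \<in> I \<longrightarrow> (\<exists>d. ((\<lambda>t. spow (y' t) (p - 1)) has_real_derivative d) (at x within I) \<and>
             - d = (p - 1) * (\<mu> - q x) * spow (y x) (p - 1)))} \<subseteq> N"
      unfolding eventually_ae_filter by blast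
    then show ?thesis by (intro that[of N]) auto
  qed
  have "((\<lambda>x. spow (y' x) (p - 1)) has_real_derivative - (p - 1) * (\<mu> - q x) * spow (y x) (p - 1)) (at x)"
    if "x \<in> {a<..<b} - N" for x
  proof -
    have "x \<in> {a<..<b}" "x \<notin> N" "x \<in> I" using that I by auto
    then obtain d where "((\<lambda>t. spow (y' t) (p - 1)) has_real_derivative d) (at x)"
      "- d = (p - 1) * (\<mu> - q x) * spow (y x) (p - 1)"
      using N(2)[of x] at[of x] by auto
    moreover have "d = - (p - 1) * (\<mu> - q x) * spow (y x) (p - 1)"
      using calculation(2) unfolding mult_minus_left by linarith
    ultimately show ?thesis by (simp only:)
  qed
  ultimately show "ac_deriv a b y y'"
    "ac_deriv a b (\<lambda>x. spow (y' x) (p - 1)) (\<lambda>x. - (p - 1) * (\<mu> - q x) * spow (y x) (p - 1))"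
    using N(1) unfolding ac_deriv_def negligible_iff_null_sets by blast+
qed

lemma half_linear_solutionI:
  assumes y: "ac_deriv a b y y'" and y': "continuous_on {a..b} y'"
    and v: "ac_deriv a b (\<lambda>x. spow (y' x) (p - 1)) (\<lambda>x. - (p - 1) * (\<mu> - q x) * spow (y x) (p - 1))"
  shows "half_linear_solution p \<mu> q {a..b} y y'"
  unfolding half_linear_solution_def locally_abs_continuous_on_def
proof (intro conjI ballI allI impI)
  show "(y has_real_derivative y' x) (at x within {a..b})" if "x \<in> {a..b}" for x
    by (rule ac_deriv_imp_has_derivative[OF y y' that])
  show "abs_continuous_on {c..d} y" "abs_continuous_on {c..d} (\<lambda>x. spow (y' x) (p - 1))" if "{c..d} \<subseteq> {a..b}" for c d
    using y v that abs_continuous_on_subset unfolding ac_deriv_def by blast+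
  obtain N where N: "negligible N" "\<And>x. x \<in> {a<..<b} - N \<Longrightarrow>
    ((\<lambda>x. spow (y' x) (p - 1)) has_real_derivative - (p - 1) * (\<mu> - q x) * spow (y x) (p - 1)) (at x)"
    using v unfolding ac_deriv_def by blast
  show "AE x in lebesgue. x \<in> {a..b} \<longrightarrow>
        (\<exists>d. ((\<lambda>t. spow (y' t) (p - 1)) has_real_derivative d) (at x within {a..b}) \<and>
             - d = (p - 1) * (\<mu> - q x) * spow (y x) (p - 1))"
  proof (rule AE_I')
    show "N \<union> {a, b} \<in> null_sets lebesgue"
      using N(1) by (simp add: negligible_iff_null_sets[symmetric])
    have "\<exists>d. ((\<lambda>t. spow (y' t) (p - 1)) has_real_derivative d) (at x within {a..b}) \<and>
             - d = (p - 1) * (\<mu> - q x) * spow (y x) (p - 1)" if "x \<in> {a..b}" "x \<notin> N \<union> {a, b}" for x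
    proof (intro exI conjI)
      show "((\<lambda>t. spow (y' t) (p - 1)) has_real_derivative - (p - 1) * (\<mu> - q x) * spow (y x) (p - 1)) (at x within {a..b})"
        by (rule has_field_derivative_at_within[OF N(2)]) (use that in auto)
    qed (simp only: mult_minus_left minus_minus)
    then show "{x \<in> space lebesgue. \<not> (x \<in> {a..b} \<longrightarrow>
        (\<exists>d. ((\<lambda>t. spow (y' t) (p - 1)) has_real_derivative d) (at x within {a..b}) \<and>
             - d = (p - 1) * (\<mu> - q x) * spow (y x) (p - 1)))} \<subseteq> N \<union> {a, b}"
      by blast
  qed
qed

section \<open>Identification of \<open>S_p\<close>\<close>

context half_linear
begin

lemma spow_conjugate: "spow (spow x (p - 1)) (1 / (p - 1)) = x" "spow (spow x (1 / (p - 1))) (p - 1) = x"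
  using p by (simp_all add: spow_spow)

lemma gsin_solution: "half_linear_solution p 1 (\<lambda>_. 0) UNIV gsin gcos"
  unfolding half_linear_solution_def locally_abs_continuous_on_def gmom_gcos[symmetric]
proof (intro conjI ballI allI impI)
  show "abs_continuous_on {a..b} gsin" for a b
    using ac_deriv_C1[of a b gsin gcos] gsin_has_derivative continuous_gcos continuous_on_subset
    unfolding ac_deriv_def by blast
  have "continuous_on A (\<lambda>t. - (p - 1) * spow (gsin t) (p - 1))" for A
    using p by (intro continuous_intros continuous_on_subset[OF continuous_gsin]) auto
  then show "abs_continuous_on {a..b} gmom" for a b
    using ac_deriv_C1[of a b gmom "\<lambda>t. - (p - 1) * spow (gsin t) (p - 1)"] gmom_has_derivative
    unfolding ac_deriv_def by blast
  have "\<exists>d. (gmom has_real_derivative d) (at x) \<and> - d = (p - 1) * (1 - 0) * spow (gsin x) (p - 1)" for x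
    by (intro exI conjI, rule gmom_has_derivative) (simp only: mult_minus_left minus_minus diff_0_right mult_1_right)
  then show "AE x in lebesgue. x \<in> UNIV \<longrightarrow> (\<exists>d. (gmom has_real_derivative d) (at x) \<and>
     - d = (p - 1) * (1 - 0) * spow (gsin x) (p - 1))" by simp
qed (use gsin_has_derivative in auto)

text \<open>Uniqueness through Pruefer coordinates, because the Lipschitz condition fails for
  \<open>p \<noteq> 2\<close>: with zero potential and parameter 1 the energy is constant and the
  angle moves with unit speed.\<close>

lemma gsin_unique:
  assumes sol: "half_linear_solution p 1 (\<lambda>_. 0) UNIV y y'" and init: "y 0 = 0" "y' 0 = 1"
  shows "y x = gsin x"
proof -
  define R where "R = \<bar>x\<bar> + 1"
  define w where "w x = spow (y' x) (p - 1)" for x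
  have R: "- R \<le> R" "0 \<in> {-R..R}" "x \<in> {-R..R}" by (auto simp: R_def)
  have y: "ac_deriv (-R) R y (\<lambda>x. 1 * spow (w x) (1 / (p - 1)))"
    using half_linear_solution_ac_deriv(1)[OF sol, of "-R" R] by (simp add: w_def[abs_def] spow_conjugate)
  have w: "ac_deriv (-R) R w (\<lambda>x. - (p - 1) * 1 * spow (y x) (p - 1))"
    using half_linear_solution_ac_deriv(2)[OF sol, of "-R" R] by (simp add: w_def[abs_def])
  have w0: "w 0 = 1" using init by (simp add: w_def spow_def)
  then have w0': "w 0 \<noteq> 0" by simp
  have one: "(\<lambda>_::real. 1::real) absolutely_integrable_on {-R..R}" by (rule absolutely_integrable_on_const) auto
  obtain \<theta> \<rho> where \<theta>: "ac_deriv (-R) R \<theta> (\<lambda>x. 1 + (1 - 1) * gpot (\<theta> x))"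
    "\<And>x. \<rho> x = \<bar>y x\<bar> powr p + \<bar>w x\<bar> powr (p / (p - 1))"
    "\<And>x. x \<in> {-R..R} \<Longrightarrow> y x = \<rho> x powr (1 / p) * gsin (\<theta> x)"
    "\<And>x. x \<in> {-R..R} \<Longrightarrow> w x = \<rho> x powr (1 - 1 / p) * gmom (\<theta> x)"
    by (rule pruefer[OF R(1) y w one R(2) disjI2[OF w0']]) (rule that; blast)
  have "ac_deriv (-R) R \<rho> (\<lambda>x. 0)" unfolding \<theta>(2)
    by (rule ac_deriv_cong[OF energy_deriv[OF y w]]) auto
  note \<rho>_int = ac_deriv_eq_integral[OF this]
  have \<rho>: "\<rho> z = \<rho> (-R)" if "z \<in> {-R..R}" for z
    using \<rho>_int[OF that] by simp
  have "\<rho> 0 = 1" unfolding \<theta>(2)[of 0] init(1) w0 by simp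
  then have \<rho>1: "\<rho> z = 1" if "z \<in> {-R..R}" for z using \<rho>[OF R(2)] \<rho>[OF that] by simp
  have "gsin (\<theta> 0) = gsin 0" "gmom (\<theta> 0) = gmom 0"
    using \<theta>(3)[OF R(2)] \<theta>(4)[OF R(2)] unfolding \<rho>1[OF R(2)] init(1) w0 by simp_all
  then obtain n :: int where n: "\<theta> 0 = 0 + 2 * real_of_int n * pi_hat p" by (rule gsin_gmom_eq_imp)
  have lin: "\<theta> z = \<theta> (-R) + (z + R)" if "z \<in> {-R..R}" for z
    using ac_deriv_eq_integral[OF \<theta>(1) that] that by simp
  have "\<theta> x = x + of_int (2 * n) * pi_hat p" using lin[OF R(2)] lin[OF R(3)] n by simp
  then have "gsin (\<theta> x) = gsin x" using half_turns(2)[of x "2 * n"] by simp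
  then show ?thesis using \<theta>(3)[OF R(3)] unfolding \<rho>1[OF R(3)] by simp
qed

lemma S_p_eq_gsin: "S_p p = gsin"
  unfolding S_p_def
proof (rule the_equality)
  show "\<exists>y'. half_linear_solution p 1 (\<lambda>_. 0) UNIV gsin y' \<and> gsin 0 = 0 \<and> y' 0 = 1"
    using gsin_solution by (intro exI[of _ gcos]) auto
  show "y = gsin" if "\<exists>y'. half_linear_solution p 1 (\<lambda>_. 0) UNIV y y' \<and> y 0 = 0 \<and> y' 0 = 1" for y
    using that gsin_unique by blast
qed

text \<open>The Pythagorean identity leaves a function of \<open>gpot\<close> alone. The bounded
  product is thus an antiderivative of \<open>1 - p gpot\<close>, which serves the oscillatory
  integrals and the integral hypothesis of the antiperiodic case alike.\<close>

lemma gsin_gmom_has_derivative: "((\<lambda>t. gsin t * gmom t) has_real_derivative 1 - p * gpot t) (at t)"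
proof (rule DERIV_cong[OF DERIV_mult[OF gsin_has_derivative gmom_has_derivative]])
  have "gsin t * spow (gsin t) (p - 1) = gpot t" using mult_spow[of "gsin t" "p - 1"] by (simp add: gpot_def)
  moreover have "gcos t * gmom t = 1 - gpot t" using gcos_gmom_mult abs_gcos by simp
  moreover have "gcos t * gmom t + - (p - 1) * spow (gsin t) (p - 1) * gsin t
    = gcos t * gmom t - (p - 1) * (gsin t * spow (gsin t) (p - 1))" by (simp add: algebra_simps)
  ultimately show "gcos t * gmom t + - (p - 1) * spow (gsin t) (p - 1) * gsin t = 1 - p * gpot t"
    by (simp add: algebra_simps)
qed

lemma scaled_gsin_gmom_has_derivative:
  "((\<lambda>x. gsin (c + \<omega> * x) * gmom (c + \<omega> * x)) has_real_derivative (1 - p * gpot (c + \<omega> * x)) * \<omega>) (at x)"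
  by (rule DERIV_chain2[OF gsin_gmom_has_derivative]) (auto intro!: derivative_eq_intros)

end

context half_linear_potential
begin

text \<open>Reverses the Pruefer transformation with \<open>\<kappa> = 1\<close>: the angle
  determines the amplitude by \<open>r' = - (1/p) b gpot'(\<theta>) r\<close>, where
  \<open>b\<close> is \<open>angle_coeff\<close>.\<close>

lemma flow_solution:
  fixes \<mu> t :: real
  defines "r \<equiv> \<lambda>x. exp (- (1 / p) * integral {0..x} (\<lambda>x. angle_coeff \<mu> x * gpot' (flow \<mu> t x)))"
  shows "half_linear_solution p \<mu> q {0..1} (\<lambda>x. r x * gsin (flow \<mu> t x)) (\<lambda>x. r x * gcos (flow \<mu> t x))"
proof -
  define \<theta> where "\<theta> = flow \<mu> t"
  define m where "m x = angle_coeff \<mu> x * gpot' (\<theta> x)" for x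
  define P where "P x = exp (- ((p - 1) / p) * integral {0..x} m)" for x
  have r: "r x = exp (- (1 / p) * integral {0..x} m)" for x by (simp add: r_def m_def[abs_def] \<theta>_def)
  have \<theta>: "ac_deriv 0 1 \<theta> (\<lambda>x. 1 + angle_coeff \<mu> x * gpot (\<theta> x))" unfolding \<theta>_def by (rule flow_ac)
  have \<theta>c: "continuous_on {0..1} \<theta>" by (rule ac_deriv_continuous[OF \<theta>])
  have m: "m absolutely_integrable_on {0..1}" unfolding m_def
    by (intro absolutely_integrable_continuous_mult[OF angle_coeff] continuous_on_compose2[OF continuous_gpot' \<theta>c]) auto
  have ac_exp: "ac_deriv 0 1 (\<lambda>x. exp (- c * integral {0..x} m)) (\<lambda>x. - c * exp (- c * integral {0..x} m) * m x)" for c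
    by (rule ac_deriv_chain[OF ac_deriv_integral[OF m], of "\<lambda>u. exp (- c * u)" "\<lambda>u. - c * exp (- c * u)"])
      (auto intro!: derivative_eq_intros continuous_on_mult continuous_on_exp continuous_on_const continuous_on_id continuous_on_minus)
  have gs: "ac_deriv 0 1 (\<lambda>x. gsin (\<theta> x)) (\<lambda>x. gcos (\<theta> x) * (1 + angle_coeff \<mu> x * gpot (\<theta> x)))"
    by (rule ac_deriv_chain[OF \<theta> gsin_has_derivative]) (auto intro: continuous_on_subset[OF continuous_gcos])
  have gm: "ac_deriv 0 1 (\<lambda>x. gmom (\<theta> x)) (\<lambda>x. - (p - 1) * spow (gsin (\<theta> x)) (p - 1) * (1 + angle_coeff \<mu> x * gpot (\<theta> x)))"
    by (rule ac_deriv_chain[OF \<theta> gmom_has_derivative])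
      (use p in \<open>auto intro!: continuous_on_mult continuous_on_const continuous_on_spow continuous_on_subset[OF continuous_gsin]\<close>)
  have sS: "gsin s * spow (gsin s) (p - 1) = gpot s" for s using mult_spow[of "gsin s" "p - 1"] by (simp add: gpot_def)
  have cm: "gcos s * gmom s = 1 - gpot s" for s using gcos_gmom_mult abs_gcos by simp
  have y: "ac_deriv 0 1 (\<lambda>x. r x * gsin (\<theta> x)) (\<lambda>x. r x * gcos (\<theta> x))"
  proof (rule ac_deriv_cong[OF ac_deriv_mult[OF ac_exp[of "1 / p"] gs]])
    fix x
    have "1 / p * m x * gsin (\<theta> x) = angle_coeff \<mu> x * (gsin (\<theta> x) * spow (gsin (\<theta> x)) (p - 1)) * gcos (\<theta> x)"
      using p by (simp add: m_def gpot'_def)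
    then have "1 / p * m x * gsin (\<theta> x) = angle_coeff \<mu> x * gpot (\<theta> x) * gcos (\<theta> x)" unfolding sS .
    then have "r x * (1 / p * m x * gsin (\<theta> x)) = r x * (angle_coeff \<mu> x * gpot (\<theta> x) * gcos (\<theta> x))" by (simp only:)
    then show "- (1 / p) * exp (- (1 / p) * integral {0..x} m) * m x * gsin (\<theta> x) +
      exp (- (1 / p) * integral {0..x} m) * (gcos (\<theta> x) * (1 + angle_coeff \<mu> x * gpot (\<theta> x))) = r x * gcos (\<theta> x)"
      unfolding r[symmetric] by (simp add: algebra_simps)
  qed (simp add: r)
  have rP: "r x powr (p - 1) = P x" for x
    unfolding r P_def powr_def by (simp add: field_simps)
  have sr: "spow (r x * z) (p - 1) = P x * spow z (p - 1)" for x z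
    using spow_pos[of "r x" "p - 1"] by (simp add: spow_mult rP) (simp add: r)
  have v: "ac_deriv 0 1 (\<lambda>x. spow (r x * gcos (\<theta> x)) (p - 1)) (\<lambda>x. - (p - 1) * (\<mu> - q x) * spow (r x * gsin (\<theta> x)) (p - 1))"
    unfolding sr gmom_gcos[symmetric]
  proof (rule ac_deriv_cong[OF ac_deriv_mult[OF ac_exp[of "(p - 1) / p"] gm]])
    fix x
    define Y where "Y = spow (gsin (\<theta> x)) (p - 1)"
    define a where "a = angle_coeff \<mu> x"
    have "(p - 1) / p * m x * gmom (\<theta> x) = (p - 1) * a * Y * (gcos (\<theta> x) * gmom (\<theta> x))"
      using p by (simp add: m_def gpot'_def Y_def a_def)
    then have "(p - 1) / p * m x * gmom (\<theta> x) = (p - 1) * a * Y * (1 - gpot (\<theta> x))" unfolding cm .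
    then have "P x * ((p - 1) / p * m x * gmom (\<theta> x)) = P x * ((p - 1) * a * Y * (1 - gpot (\<theta> x)))" by (simp only:)
    then have "- ((p - 1) / p) * P x * m x * gmom (\<theta> x) + P x * (- (p - 1) * Y * (1 + a * gpot (\<theta> x)))
       = - (p - 1) * (1 + a) * (P x * Y)"
      by (simp add: algebra_simps)
    then show "- ((p - 1) / p) * exp (- ((p - 1) / p) * integral {0..x} m) * m x * gmom (\<theta> x) +
         exp (- ((p - 1) / p) * integral {0..x} m) * (- (p - 1) * spow (gsin (\<theta> x)) (p - 1) * (1 + angle_coeff \<mu> x * gpot (\<theta> x))) =
         - (p - 1) * (\<mu> - q x) * (P x * spow (gsin (\<theta> x)) (p - 1))"
      unfolding P_def[symmetric] Y_def[symmetric] a_def[symmetric] by (simp add: a_def angle_coeff_def)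
  qed (simp add: P_def)
  have "continuous_on {0..1} (\<lambda>x. r x * gcos (\<theta> x))"
    unfolding r using ac_deriv_continuous[OF ac_exp[of "1 / p"]]
    by (intro continuous_on_mult continuous_on_compose2[OF continuous_gcos \<theta>c]) auto
  from half_linear_solutionI[OF y this v] show ?thesis unfolding \<theta>_def .
qed

text \<open>At an extremum the amplitude returns to its initial value, and \<open>n\<close> half
  turns multiply \<open>gsin\<close> and \<open>gcos\<close> by \<open>(-1)^n\<close>.\<close>

lemma turn_extremum_eigenvalue:
  assumes ext: "(\<forall>s. turn \<mu> t \<le> turn \<mu> s) \<or> (\<forall>s. turn \<mu> s \<le> turn \<mu> t)"
    and n: "turn \<mu> t = of_int n * pi_hat p"
  shows "if even n then \<mu> \<in> periodic_eigenvalues p q else \<mu> \<in> antiperiodic_eigenvalues p q"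
proof -
  define r where "r x = exp (- (1 / p) * integral {0..x} (\<lambda>x. angle_coeff \<mu> x * gpot' (flow \<mu> t x)))" for x
  define y where "y x = r x * gsin (flow \<mu> t x)" for x
  define y' where "y' x = r x * gcos (flow \<mu> t x)" for x
  have sol: "half_linear_solution p \<mu> q {0..1} y y'"
    using flow_solution[of \<mu> t] unfolding y_def y'_def r_def .
  have r: "r x > 0" "r 0 = 1" "r 1 = 1" for x
    using turn_extremum[OF ext] by (auto simp: r_def)
  have f1: "flow \<mu> t 1 = t + of_int n * pi_hat p" using n by (simp add: turn_def)
  \<comment> \<open>If \<open>y\<close> vanished on the whole interval, so would
    \<open>y' (1/2)\<close>, contrary to \<open>gpyth\<close>.\<close>
  have nz: "\<exists>x\<in>{0..1}. y x \<noteq> 0"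
  proof (rule ccontr)
    assume "\<not> (\<exists>x\<in>{0..1}. y x \<noteq> 0)"
    then have y0: "y x = 0" if "x \<in> {0..1}" for x using that by blast
    have "(y has_real_derivative y' (1/2)) (at (1/2) within {0..1})"
      using sol unfolding half_linear_solution_def by auto
    then have "(y has_real_derivative y' (1/2)) (at (1/2))" by (simp add: at_within_Icc_at)
    moreover have "(y has_real_derivative 0) (at (1/2))"
      by (rule has_field_derivative_transform_within_open[OF DERIV_const, where S = "{0<..<1}"]) (auto simp: y0)
    ultimately have "y' (1/2) = 0" using DERIV_unique by blast
    then show False using y0[of "1/2"] r(1)[of "1/2"] gpyth[of "flow \<mu> t (1/2)"] by (simp add: y_def y'_def)
  qed
  have "y 0 = (if even n then y 1 else - y 1)" "y' 0 = (if even n then y' 1 else - y' 1)"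
    unfolding y_def y'_def r(2,3) flow_0 f1 half_turns by auto
  then have "(if even n then y 0 = y 1 \<and> y' 0 = y' 1 else y 0 = - y 1 \<and> y' 0 = - y' 1)" by simp
  then show ?thesis
    unfolding periodic_eigenvalues_def antiperiodic_eigenvalues_def mem_Collect_eq using sol nz by meson
qed

text \<open>The boundary conditions make the energies at the two ends equal, so the end points on
  the unit curve agree up to sign and the angles differ by a whole number of half turns. Which
  number is left open; it is determined only for large parameters.\<close>

lemma eigen_angle:
  assumes sol: "half_linear_solution p \<mu> q {0..1} y y'" and nz: "\<exists>x\<in>{0..1}. y x \<noteq> 0"
    and bc: "(y 0 = y 1 \<and> y' 0 = y' 1) \<or> (y 0 = - y 1 \<and> y' 0 = - y' 1)" and \<kappa>: "\<kappa> > 0"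
  obtains \<theta> n where "ac_deriv 0 1 \<theta> (\<lambda>x. \<kappa> + ((\<mu> - q x) * \<kappa> powr (1 - p) - \<kappa>) * gpot (\<theta> x))"
    "\<theta> 1 = \<theta> 0 + of_int n * pi_hat p"
proof -
  \<comment> \<open>The scaling that gives
    \<open>\<kappa> * spow (w x) (1 / (p - 1)) = y' x\<close>.\<close>
  define w where "w x = \<kappa> powr (1 - p) * spow (y' x) (p - 1)" for x
  have k1: "spow (\<kappa> powr (1 - p)) (1 / (p - 1)) = inverse \<kappa>"
  proof -
    have "(1 - p) * (1 / (p - 1)) = - 1" using p by (simp add: field_simps)
    then show ?thesis using \<kappa> powr_minus[of \<kappa> 1] by (simp add: spow_pos powr_powr)
  qed
  have yw: "\<kappa> * spow (w x) (1 / (p - 1)) = y' x" for x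
    using \<kappa> by (simp add: w_def spow_mult spow_conjugate k1)
  have y: "ac_deriv 0 1 y (\<lambda>x. \<kappa> * spow (w x) (1 / (p - 1)))"
    unfolding yw using half_linear_solution_ac_deriv(1)[OF sol] by simp
  have w: "ac_deriv 0 1 w (\<lambda>x. - (p - 1) * ((\<mu> - q x) * \<kappa> powr (1 - p)) * spow (y x) (p - 1))"
    unfolding w_def
    by (rule ac_deriv_cong[OF ac_deriv_mult[OF ac_deriv_const half_linear_solution_ac_deriv(2)[OF sol order_refl]]]) auto
  have \<mu>q: "(\<lambda>x. (\<mu> - q x) * \<kappa> powr (1 - p)) absolutely_integrable_on {0..1}"
    using q by (intro absolutely_integrable_continuous_mult set_integral_diff absolutely_integrable_on_const) auto
  obtain x0 where x0: "x0 \<in> {0..1}" "y x0 \<noteq> 0" using nz by blast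
  obtain \<theta> \<rho> where \<theta>: "ac_deriv 0 1 \<theta> (\<lambda>x. \<kappa> + ((\<mu> - q x) * \<kappa> powr (1 - p) - \<kappa>) * gpot (\<theta> x))"
    "\<And>x. \<rho> x = \<bar>y x\<bar> powr p + \<bar>w x\<bar> powr (p / (p - 1))" "\<And>x. x \<in> {0..1} \<Longrightarrow> \<rho> x > 0"
    "\<And>x. x \<in> {0..1} \<Longrightarrow> y x = \<rho> x powr (1 / p) * gsin (\<theta> x)"
    "\<And>x. x \<in> {0..1} \<Longrightarrow> w x = \<rho> x powr (1 - 1 / p) * gmom (\<theta> x)"
    by (rule pruefer[OF zero_le_one y w \<mu>q x0(1) disjI1[OF x0(2)]]) (rule that; blast)
  have w01: "w 0 = - w 1" if "y' 0 = - y' 1" using that by (simp add: w_def)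
  have 01: "(0::real) \<in> {0..1}" "(1::real) \<in> {0..1}" by auto
  have abs01: "\<bar>y 0\<bar> = \<bar>y 1\<bar>" "\<bar>y' 0\<bar> = \<bar>y' 1\<bar>" using bc by linarith+
  have "\<bar>w 0\<bar> = \<bar>w 1\<bar>" unfolding w_def abs_mult abs_spow abs01 ..
  then have \<rho>01: "\<rho> 0 = \<rho> 1" unfolding \<theta>(2) abs01 by (simp only:)
  have pos: "\<rho> 1 powr (1 / p) \<noteq> 0" "\<rho> 1 powr (1 - 1 / p) \<noteq> 0" using \<theta>(3)[OF 01(2)] by auto
  from bc show thesis
  proof
    assume b: "y 0 = y 1 \<and> y' 0 = y' 1"
    then have "w 1 = w 0" by (simp add: w_def)
    then have "\<rho> 1 powr (1 / p) * gsin (\<theta> 1) = \<rho> 1 powr (1 / p) * gsin (\<theta> 0)"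
      "\<rho> 1 powr (1 - 1 / p) * gmom (\<theta> 1) = \<rho> 1 powr (1 - 1 / p) * gmom (\<theta> 0)"
      using b \<theta>(4,5)[OF 01(1)] \<theta>(4,5)[OF 01(2)] unfolding \<rho>01 by metis+
    then have "gsin (\<theta> 1) = gsin (\<theta> 0)" "gmom (\<theta> 1) = gmom (\<theta> 0)"
      unfolding mult_left_cancel[OF pos(1)] mult_left_cancel[OF pos(2)] by auto
    then obtain n :: int where "\<theta> 1 = \<theta> 0 + 2 * real_of_int n * pi_hat p" by (rule gsin_gmom_eq_imp)
    then show thesis using that[OF \<theta>(1), of "2 * n"] by simp
  next
    assume b: "y 0 = - y 1 \<and> y' 0 = - y' 1"
    then have "w 0 = - w 1" using w01 by simp
    then have "\<rho> 1 powr (1 / p) * gsin (\<theta> 1) = \<rho> 1 powr (1 / p) * - gsin (\<theta> 0)"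
      "\<rho> 1 powr (1 - 1 / p) * gmom (\<theta> 1) = \<rho> 1 powr (1 - 1 / p) * - gmom (\<theta> 0)"
      using b \<theta>(4,5)[OF 01(1)] \<theta>(4,5)[OF 01(2)] unfolding \<rho>01 by (metis minus_equation_iff mult_minus_right)+
    then have "gsin (\<theta> 1) = gsin (\<theta> 0 + pi_hat p)" "gmom (\<theta> 1) = gmom (\<theta> 0 + pi_hat p)"
      unfolding gsin_add_pi_hat gmom_add_pi_hat mult_left_cancel[OF pos(1)] mult_left_cancel[OF pos(2)] by auto
    then obtain n :: int where "\<theta> 1 = \<theta> 0 + pi_hat p + 2 * real_of_int n * pi_hat p" by (rule gsin_gmom_eq_imp)
    then show thesis using that[OF \<theta>(1), of "2 * n + 1"] by (simp add: algebra_simps)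
  qed
qed

end

text \<open>Three errors of size \<open>\<epsilon> / 3\<close>: truncating \<open>q\<close> at a
  level \<open>m\<close>; replacing it by continuous functions that converge almost everywhere,
  truncated at the same level so that the convergence is dominated; and replacing one of these by a
  polynomial.\<close>

lemma L1_approx_C1:
  fixes q :: "real \<Rightarrow> real"
  assumes q: "q absolutely_integrable_on {a..b}" and "\<epsilon> > 0"
  obtains P P' where "\<And>x. (P has_real_derivative P' x) (at x)" "continuous_on UNIV P'"
    "integral {a..b} (\<lambda>x. \<bar>q x - P x\<bar>) < \<epsilon>"
proof -
  define clip where "clip m y = max (- real m) (min (real m) y)" for m and y :: real
  have clip_abs: "\<bar>clip m y\<bar> \<le> real m" "\<bar>clip m y\<bar> \<le> \<bar>y\<bar>" for m y by (auto simp: clip_def)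
  have qm: "q \<in> borel_measurable (lebesgue_on {a..b})"
    using q absolutely_integrable_measurable[of "{a..b}" q] by auto
  have aq: "(\<lambda>x. \<bar>q x\<bar>) integrable_on {a..b}" using q by (simp add: absolutely_integrable_on_def)
  have ci: "(\<lambda>x. clip m (q x)) absolutely_integrable_on {a..b}" for m
    unfolding clip_def
    by (intro absolutely_integrable_max_1 absolutely_integrable_min_1 q absolutely_integrable_on_const) auto
  have "(\<lambda>m. integral {a..b} (\<lambda>x. \<bar>q x - clip m (q x)\<bar>)) \<longlonglongrightarrow> integral {a..b} (\<lambda>x. 0)"
  proof (rule dominated_convergence(2)[where h = "\<lambda>x. 2 * \<bar>q x\<bar>"])
    show "(\<lambda>x. \<bar>q x - clip m (q x)\<bar>) integrable_on {a..b}" for m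
      using set_integral_diff(1)[OF q ci[of m]] by (simp add: absolutely_integrable_on_def)
    show "(\<lambda>x. 2 * \<bar>q x\<bar>) integrable_on {a..b}" using aq by (rule integrable_on_mult_right)
    show "norm \<bar>q x - clip m (q x)\<bar> \<le> 2 * \<bar>q x\<bar>" for m x using clip_abs(2)[of m "q x"] by simp
    fix x
    obtain m0 where m0: "\<bar>q x\<bar> \<le> real m0" using real_arch_simple by blast
    have "\<forall>\<^sub>F m in sequentially. \<bar>q x - clip m (q x)\<bar> = 0"
    proof (rule eventually_sequentiallyI[of m0])
      fix m assume "m0 \<le> m"
      then have "\<bar>q x\<bar> \<le> real m" using m0 by (meson of_nat_le_iff order_trans)
      then show "\<bar>q x - clip m (q x)\<bar> = 0" by (auto simp: clip_def)
    qed
    then show "(\<lambda>m. \<bar>q x - clip m (q x)\<bar>) \<longlonglongrightarrow> 0" by (rule tendsto_eventually)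
  qed
  then have "(\<lambda>m. integral {a..b} (\<lambda>x. \<bar>q x - clip m (q x)\<bar>)) \<longlonglongrightarrow> 0" by simp
  then have "\<forall>\<^sub>F m in sequentially. integral {a..b} (\<lambda>x. \<bar>q x - clip m (q x)\<bar>) < \<epsilon> / 3"
    using \<open>\<epsilon> > 0\<close> by (intro order_tendstoD(2)) auto
  then obtain m where m: "integral {a..b} (\<lambda>x. \<bar>q x - clip m (q x)\<bar>) < \<epsilon> / 3"
    by (auto simp: eventually_sequentially)
  have "q measurable_on {a..b}" using qm by (simp add: measurable_on_iff_borel_measurable)
  then obtain N g where N: "negligible N" and g: "\<And>n. continuous_on UNIV (g n)"
    and lim: "\<And>x. x \<notin> N \<Longrightarrow> (\<lambda>n. g n x) \<longlonglongrightarrow> (if x \<in> {a..b} then q x else 0)"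
    unfolding measurable_on_def by metis
  have gc: "continuous_on A (\<lambda>x. clip m (g n x))" for n A
    unfolding clip_def by (intro continuous_intros continuous_on_subset[OF g]) auto
  have gi: "(\<lambda>x. clip m (g n x)) absolutely_integrable_on {a..b}" for n
    using gc by (intro absolutely_integrable_continuous_real)
  have di: "(\<lambda>x. \<bar>clip m (q x) - clip m (g n x)\<bar>) integrable_on {a..b}" for n
    using set_integral_diff(1)[OF ci gi] by (simp add: absolutely_integrable_on_def)
  have "(\<lambda>n. integral {a..b} (\<lambda>x. if x \<in> N then 0 else \<bar>clip m (q x) - clip m (g n x)\<bar>)) \<longlonglongrightarrow> integral {a..b} (\<lambda>x. 0)"
  proof (rule dominated_convergence(2)[where h = "\<lambda>x. 2 * real m"])
    show "(\<lambda>x. if x \<in> N then 0 else \<bar>clip m (q x) - clip m (g n x)\<bar>) integrable_on {a..b}" for n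
      by (rule integrable_spike[OF di[of n] N]) auto
    show "(\<lambda>x. 2 * real m) integrable_on {a..b}" by (rule integrable_const_ivl)
    show "norm (if x \<in> N then 0 else \<bar>clip m (q x) - clip m (g n x)\<bar>) \<le> 2 * real m" for n x
      using clip_abs(1)[of m "q x"] clip_abs(1)[of m "g n x"] by auto
    fix x assume x: "x \<in> {a..b}"
    show "(\<lambda>n. if x \<in> N then 0 else \<bar>clip m (q x) - clip m (g n x)\<bar>) \<longlonglongrightarrow> 0"
    proof (cases "x \<in> N")
      case False
      have "(\<lambda>n. \<bar>clip m (q x) - clip m (g n x)\<bar>) \<longlonglongrightarrow> \<bar>clip m (q x) - clip m (q x)\<bar>"
        unfolding clip_def using lim[OF False] x by (intro tendsto_intros) auto
      then show ?thesis using False by simp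
    qed simp
  qed
  moreover have "integral {a..b} (\<lambda>x. if x \<in> N then 0 else \<bar>clip m (q x) - clip m (g n x)\<bar>)
     = integral {a..b} (\<lambda>x. \<bar>clip m (q x) - clip m (g n x)\<bar>)" for n
    by (rule integral_spike[OF N]) auto
  ultimately have "(\<lambda>n. integral {a..b} (\<lambda>x. \<bar>clip m (q x) - clip m (g n x)\<bar>)) \<longlonglongrightarrow> 0" by simp
  then have "\<forall>\<^sub>F n in sequentially. integral {a..b} (\<lambda>x. \<bar>clip m (q x) - clip m (g n x)\<bar>) < \<epsilon> / 3"
    using \<open>\<epsilon> > 0\<close> by (intro order_tendstoD(2)) auto
  then obtain n where n: "integral {a..b} (\<lambda>x. \<bar>clip m (q x) - clip m (g n x)\<bar>) < \<epsilon> / 3"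
    by (auto simp: eventually_sequentially)
  define \<eta> where "\<eta> = \<epsilon> / (3 * (\<bar>b - a\<bar> + 1))"
  have \<eta>: "\<eta> > 0" unfolding \<eta>_def using \<open>\<epsilon> > 0\<close> by (intro divide_pos_pos mult_pos_pos add_nonneg_pos) auto
  obtain P where P: "real_polynomial_function P" "\<And>x. x \<in> {a..b} \<Longrightarrow> \<bar>clip m (g n x) - P x\<bar> < \<eta>"
    using Stone_Weierstrass_real_polynomial_function[OF compact_Icc gc \<eta>] by metis
  obtain P' where P': "real_polynomial_function P'" "\<And>x. (P has_real_derivative P' x) (at x)"
    using has_real_derivative_polynomial_function[OF P(1)] by blast
  have "continuous_on UNIV P'"
    using continuous_real_polymonial_function[OF P'(1)] by (simp add: continuous_at_imp_continuous_on)
  moreover have "integral {a..b} (\<lambda>x. \<bar>q x - P x\<bar>) < \<epsilon>"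
  proof -
    have i1: "(\<lambda>x. \<bar>q x - clip m (q x)\<bar>) integrable_on {a..b}"
      using set_integral_diff(1)[OF q ci[of m]] by (simp add: absolutely_integrable_on_def)
    have Pc: "continuous_on {a..b} P" using P'(2) DERIV_isCont by (blast intro: continuous_at_imp_continuous_on)
    have i3: "(\<lambda>x. \<bar>q x - P x\<bar>) integrable_on {a..b}"
      using set_integral_diff(1)[OF q absolutely_integrable_continuous_real[OF Pc]] by (simp add: absolutely_integrable_on_def)
    have "integral {a..b} (\<lambda>x. \<bar>q x - P x\<bar>) \<le>
      integral {a..b} (\<lambda>x. \<bar>q x - clip m (q x)\<bar> + \<bar>clip m (q x) - clip m (g n x)\<bar> + \<eta>)"
    proof (rule integral_le[OF i3])
      show "(\<lambda>x. \<bar>q x - clip m (q x)\<bar> + \<bar>clip m (q x) - clip m (g n x)\<bar> + \<eta>) integrable_on {a..b}"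
        by (intro integrable_add i1 di integrable_const_ivl)
      show "\<bar>q x - P x\<bar> \<le> \<bar>q x - clip m (q x)\<bar> + \<bar>clip m (q x) - clip m (g n x)\<bar> + \<eta>" if "x \<in> {a..b}" for x
        using P(2)[OF that] by linarith
    qed
    also have "\<dots> = integral {a..b} (\<lambda>x. \<bar>q x - clip m (q x)\<bar>) + integral {a..b} (\<lambda>x. \<bar>clip m (q x) - clip m (g n x)\<bar>) + integral {a..b} (\<lambda>x. \<eta>)"
      by (simp add: integral_add i1 di integrable_add integrable_const_ivl del: integral_const_real)
    also have "integral {a..b} (\<lambda>x. \<eta>) \<le> \<epsilon> / 3"
    proof -
      have "integral {a..b} (\<lambda>x. \<eta>) \<le> \<eta> * (\<bar>b - a\<bar> + 1)" using \<eta> by (simp add: mult.commute mult_left_mono)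
      also have "\<dots> = \<epsilon> / 3"
      proof -
        have "\<bar>b - a\<bar> + 1 \<noteq> 0" by linarith
        moreover have "\<epsilon> / (3 * c) * c = \<epsilon> / 3" if "c \<noteq> 0" for c
          using that by simp
        ultimately show ?thesis unfolding \<eta>_def by blast
      qed
      finally show ?thesis .
    qed
    finally show ?thesis using m n by linarith
  qed
  ultimately show thesis using that P'(2) by blast
qed

section \<open>Asymptotics and extremal eigenvalues\<close>

lemma ac_deriv_constant_imp_ae_zero:
  assumes "ac_deriv a b w g" "\<And>x. x \<in> {a..b} \<Longrightarrow> w x = c"
  shows "AE x in lebesgue. x \<in> {a<..<b} \<longrightarrow> g x = 0"
proof -
  obtain N where N: "negligible N" "\<And>x. x \<in> {a<..<b} - N \<Longrightarrow> (w has_real_derivative g x) (at x)"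
    using assms(1) unfolding ac_deriv_def by blast
  have "g x = 0" if x: "x \<in> {a<..<b}" "x \<notin> N" for x
  proof -
    have "(w has_real_derivative 0) (at x)"
      by (rule has_field_derivative_transform_within_open[OF DERIV_const[of c], where S = "{a<..<b}"]) (use x assms(2) in auto)
    then show ?thesis using DERIV_unique N(2)[of x] x by blast
  qed
  then show ?thesis
    by (intro AE_I'[of N]) (use N(1) in \<open>auto simp: negligible_iff_null_sets\<close>)
qed

text \<open>In Picone's argument the Riccati variables are singular at the end points, so
  \<open>q = 0\<close> is first available on inner intervals; countably many of them exhaust
  \<open>(0, 1)\<close>.\<close>

lemma ae_zero_exhaust:
  fixes q :: "real \<Rightarrow> real"
  assumes "\<And>a b. \<lbrakk>0 < a; a < b; b < 1\<rbrakk> \<Longrightarrow> AE x in lebesgue. x \<in> {a<..<b} \<longrightarrow> q x = 0"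
  shows "AE x in lebesgue. x \<in> {0..1} \<longrightarrow> q x = 0"
proof -
  \<comment> \<open>Adding 3 makes the interval nondegenerate already for
    \<open>n = 0\<close>.\<close>
  have "AE x in lebesgue. \<forall>n::nat. x \<in> {1 / (real n + 3)<..<1 - 1 / (real n + 3)} \<longrightarrow> q x = 0"
    unfolding AE_all_countable by (intro allI assms) (auto simp: field_simps)
  moreover have "AE x in lebesgue. x \<notin> {0, 1::real}"
    by (rule AE_not_in) (simp add: negligible_iff_null_sets[symmetric])
  ultimately show ?thesis
  proof (rule AE_mp[OF _ AE_mp, OF _ _ AE_I2], intro impI)
    fix x :: real
    assume 1: "\<forall>n::nat. x \<in> {1 / (real n + 3)<..<1 - 1 / (real n + 3)} \<longrightarrow> q x = 0"
      and 2: "x \<notin> {0, 1}" and 3: "x \<in> {0..1}"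
    define d where "d = min x (1 - x)"
    have d: "d > 0" "d \<le> x" "d \<le> 1 - x" using 2 3 by (auto simp: d_def)
    obtain n where "1 / d < real n" using reals_Archimedean2 by blast
    then have "1 / (real n + 3) < d" using d(1) by (simp add: field_simps)
    then show "q x = 0" using 1[rule_format, of n] d by auto
  qed
qed

text \<open>\<open>B\<close> is the gap between a strictly convex function and its tangent at
  \<open>v\<close>. The mean value theorem and strict monotonicity of \<open>spow\<close> give its
  sign; the case of equality is what yields rigidity.\<close>

lemma strict_convex_bregman:
  fixes v w r :: real
  assumes r: "r > 1"
  defines "B \<equiv> \<bar>w\<bar> powr r - \<bar>v\<bar> powr r - r * spow v (r - 1) * (w - v)"
  shows "B \<ge> 0" and "B = 0 \<Longrightarrow> w = v"
proof -
  have smono: "spow x (r - 1) < spow y (r - 1)" if "x < y" for x y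
  proof (cases "0 \<le> x")
    case True
    then show ?thesis using that r powr_less_mono2[of "r - 1" x y] by (auto simp: spow_def sgn_if)
  next
    case False
    then have x: "x < 0" by simp
    then have neg: "spow x (r - 1) < 0" by (simp add: spow_def)
    show ?thesis
    proof (cases "y < 0")
      case True
      then show ?thesis using that x r powr_less_mono2[of "r - 1" "- y" "- x"] by (simp add: spow_def)
    next
      case False
      then have "spow y (r - 1) \<ge> 0" by (auto simp: spow_def sgn_if)
      then show ?thesis using neg by linarith
    qed
  qed
  have pos: "B > 0" if "w \<noteq> v"
  proof (cases "v < w")
    case True
    obtain z where z: "v < z" "z < w" "\<bar>w\<bar> powr r - \<bar>v\<bar> powr r = (w - v) * (r * spow z (r - 1))"
      using MVT2[OF True has_derivative_abs_powr[OF r]] by metis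
    have "B = r * (w - v) * (spow z (r - 1) - spow v (r - 1))" unfolding B_def z(3) by (simp add: algebra_simps)
    then show ?thesis using smono[OF z(1)] True r by simp
  next
    case False
    then have wv: "w < v" using that by simp
    obtain z where z: "w < z" "z < v" "\<bar>v\<bar> powr r - \<bar>w\<bar> powr r = (v - w) * (r * spow z (r - 1))"
      using MVT2[OF wv has_derivative_abs_powr[OF r]] by metis
    have "B = - ((v - w) * (r * spow z (r - 1))) + r * spow v (r - 1) * (v - w)"
      unfolding B_def z(3)[symmetric] by (simp add: algebra_simps)
    also have "\<dots> = r * (v - w) * (spow v (r - 1) - spow z (r - 1))" by (simp add: algebra_simps)
    finally show ?thesis using smono[OF z(2)] wv r by simp
  qed
  show "B = 0 \<Longrightarrow> w = v" using pos by force
  show "B \<ge> 0" using pos by (cases "w = v") (auto simp: B_def)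
qed

text \<open>L'Hospital's rule with derivatives at \<open>a\<close> only; it controls a quotient
  whose terms both vanish at an end of the period.\<close>

lemma tendsto_ratio_of_zeros:
  fixes f g :: "real \<Rightarrow> real"
  assumes "(f has_real_derivative f') (at a within S)" "(g has_real_derivative g') (at a within S)"
    and "f a = 0" "g a = 0" "g' \<noteq> 0"
  shows "((\<lambda>x. f x / g x) \<longlongrightarrow> f' / g') (at a within S)"
proof -
  have "((\<lambda>x. ((f x - f a) / (x - a)) / ((g x - g a) / (x - a))) \<longlongrightarrow> f' / g') (at a within S)"
    using assms(1,2,5) unfolding has_field_derivative_iff by (intro tendsto_divide)
  moreover have "\<forall>\<^sub>F x in at a within S. ((f x - f a) / (x - a)) / ((g x - g a) / (x - a)) = f x / g x"
    unfolding eventually_at_filter by (rule always_eventually) (use assms(3,4) in auto)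
  ultimately show ?thesis by (rule Lim_transform_eventually)
qed

section \<open>The generalized cotangent and oscillatory integrals\<close>

context half_linear
begin

text \<open>For \<open>y = r gsin(\<theta>)\<close> and \<open>y' = r gcos(\<theta>)\<close> this is
  the Riccati variable \<open>y'^(p-1) / y^(p-1)\<close>; the amplitude cancels.\<close>

definition gcot :: "real \<Rightarrow> real" where "gcot t = gmom t / spow (gsin t) (p - 1)"

lemma gpot_pos: "gsin t \<noteq> 0 \<Longrightarrow> gpot t > 0"
  by (simp add: gpot_def)

lemma abs_gcot_powr:
  assumes "gsin t \<noteq> 0"
  shows "\<bar>gcot t\<bar> powr (p / (p - 1)) = 1 / gpot t - 1"
proof -
  have "(p - 1) * (p / (p - 1)) = p" using p by simp
  then have "\<bar>gmom t\<bar> powr (p / (p - 1)) = 1 - gpot t" "\<bar>spow (gsin t) (p - 1)\<bar> powr (p / (p - 1)) = gpot t"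
    unfolding gmom_gcos abs_spow powr_powr by (simp_all add: abs_gcos gpot_def)
  then have "\<bar>gcot t\<bar> powr (p / (p - 1)) = (1 - gpot t) / gpot t"
    by (simp add: gcot_def powr_divide)
  then show ?thesis using gpot_pos[OF assms] by (simp add: diff_divide_distrib)
qed

lemma gcot_has_derivative:
  assumes "gsin t \<noteq> 0"
  shows "(gcot has_real_derivative - (p - 1) / gpot t) (at t)"
proof -
  define Y where "Y = spow (gsin t) (p - 1)"
  have Y: "Y \<noteq> 0" using assms by (simp add: Y_def)
  have dY: "((\<lambda>t. spow (gsin t) (p - 1)) has_real_derivative (p - 1) * \<bar>gsin t\<bar> powr (p - 1 - 1) * gcos t) (at t)"
    by (rule DERIV_chain2[OF has_derivative_spow[OF assms] gsin_has_derivative])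
  have "(gcot has_real_derivative (- (p - 1) * Y * Y - gmom t * ((p - 1) * \<bar>gsin t\<bar> powr (p - 1 - 1) * gcos t)) / (Y * Y)) (at t)"
    unfolding gcot_def[abs_def] using DERIV_divide[OF gmom_has_derivative dY] Y by (simp add: Y_def)
  moreover have "(- (p - 1) * Y * Y - gmom t * ((p - 1) * \<bar>gsin t\<bar> powr (p - 1 - 1) * gcos t)) / (Y * Y) = - (p - 1) / gpot t"
  proof -
    have YY: "Y * Y = \<bar>gsin t\<bar> powr (p - 1 - 1) * gpot t"
    proof -
      have "Y * Y = \<bar>Y\<bar> * \<bar>Y\<bar>" by simp
      also have "\<dots> = \<bar>gsin t\<bar> powr ((p - 1) + (p - 1))" unfolding Y_def abs_spow by (simp only: powr_add)
      also have "(p - 1) + (p - 1) = (p - 1 - 1) + p" by simp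
      also have "\<bar>gsin t\<bar> powr ((p - 1 - 1) + p) = \<bar>gsin t\<bar> powr (p - 1 - 1) * gpot t" unfolding gpot_def by (simp only: powr_add)
      finally show ?thesis .
    qed
    define A where "A = \<bar>gsin t\<bar> powr (p - 1 - 1)"
    have A: "A > 0" using assms by (simp add: A_def)
    have cm: "gmom t * gcos t = 1 - gpot t" using gcos_gmom_mult[of t] abs_gcos[of t] by (simp add: mult.commute)
    have "- (p - 1) * Y * Y - gmom t * ((p - 1) * A * gcos t) = - (p - 1) * (Y * Y) - (p - 1) * A * (gmom t * gcos t)"
      by (simp add: algebra_simps)
    also have "\<dots> = - (p - 1) * A" unfolding YY cm A_def[symmetric] by (simp add: algebra_simps)
    finally show ?thesis unfolding A_def[symmetric] YY using A by simp
  qed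
  ultimately show ?thesis by simp
qed

text \<open>The denominator in the derivative of \<open>gcot\<close> cancels the factor
  \<open>gpot\<close> of \<open>d\<close>, so the potential enters additively, uncoupled from the
  unknown.\<close>

lemma gcot_ac_deriv:
  assumes \<theta>: "ac_deriv a b \<theta> (\<lambda>x. c x + d x * gpot (\<theta> x))" and nz: "\<And>x. x \<in> {a..b} \<Longrightarrow> gsin (\<theta> x) \<noteq> 0"
  shows "ac_deriv a b (\<lambda>x. gcot (\<theta> x)) (\<lambda>x. - (p - 1) * (c x / gpot (\<theta> x) + d x))"
proof (rule ac_deriv_cong[OF ac_deriv_chain[OF \<theta>, of gcot "\<lambda>t. - (p - 1) / gpot t"]])
  show "(gcot has_real_derivative - (p - 1) / gpot u) (at u)" if "u \<in> \<theta> ` {a..b}" for u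
    by (rule gcot_has_derivative) (use that nz in auto)
  show "continuous_on (\<theta> ` {a..b}) (\<lambda>t. - (p - 1) / gpot t)"
    using nz gpot_pos by (intro continuous_intros continuous_on_subset[OF continuous_gpot]) (auto simp: less_imp_neq[symmetric])
  fix x assume "x \<in> {a<..<b}"
  then have "gpot (\<theta> x) > 0" using nz gpot_pos by auto
  then show "- (p - 1) / gpot (\<theta> x) * (c x + d x * gpot (\<theta> x)) = - (p - 1) * (c x / gpot (\<theta> x) + d x)"
    by (simp add: field_simps)
qed simp

lemma gsin_nonzero_between:
  assumes "of_int n * pi_hat p < t" "t < of_int (n + 1) * pi_hat p"
  shows "gsin t \<noteq> 0"
proof -
  have "gsin (t - of_int n * pi_hat p) > 0" using assms by (intro gsin_pos) (auto simp: algebra_simps)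
  then show ?thesis using half_turns(2)[of "t - of_int n * pi_hat p" n] by (auto split: if_splits)
qed

text \<open>Integration by parts with the bounded function \<open>T\<close>, whose derivative is
  \<open>\<omega> (1 - p gpot)\<close>. \<open>C\<close> is uniform in the phase \<open>c\<close>,
  which in the application is an uncontrolled initial angle.\<close>

lemma oscillation_bound:
  assumes P: "\<And>x. (P has_real_derivative P' x) (at x)" and P': "continuous_on UNIV P'"
  obtains C where "\<And>c \<omega>. \<omega> > 0 \<Longrightarrow> \<bar>integral {0..1} (\<lambda>x. P x * (1 - p * gpot (c + \<omega> * x)))\<bar> \<le> C / \<omega>"
proof -
  have "bounded (P' ` {0..1})"
    by (intro compact_imp_bounded compact_continuous_image continuous_on_subset[OF P']) auto
  then obtain K where K: "\<And>x. x \<in> {0..1} \<Longrightarrow> \<bar>P' x\<bar> \<le> K" unfolding bounded_iff by fastforce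
  have "K \<ge> 0" using K[of 0] by simp
  show thesis
  proof (rule that[of "\<bar>P 1\<bar> + \<bar>P 0\<bar> + K"])
    fix c \<omega> :: real assume \<omega>: "\<omega> > 0"
    define T where "T x = gsin (c + \<omega> * x) * gmom (c + \<omega> * x)" for x
    define h where "h x = P x * (1 - p * gpot (c + \<omega> * x))" for x
    have T1: "\<bar>T x\<bar> \<le> 1" for x
      unfolding T_def abs_mult using mult_mono[OF abs_gsin_le_1 abs_gmom_le_1, of "c + \<omega> * x" "c + \<omega> * x"] by simp
    have Pc: "continuous_on A P" for A using P DERIV_isCont by (blast intro: continuous_at_imp_continuous_on)
    have dT: "(T has_real_derivative (1 - p * gpot (c + \<omega> * x)) * \<omega>) (at x)" for x
      unfolding T_def by (rule scaled_gsin_gmom_has_derivative)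
    have Tc: "continuous_on A T" for A using dT DERIV_isCont by (blast intro: continuous_at_imp_continuous_on)
    have hc: "continuous_on A h" for A unfolding h_def
      by (intro continuous_intros Pc continuous_on_compose2[OF continuous_gpot]) auto
    have "((\<lambda>x. P' x * T x + (1 - p * gpot (c + \<omega> * x)) * \<omega> * P x) has_integral (P 1 * T 1 - P 0 * T 0)) {0..1}"
    proof (rule fundamental_theorem_of_calculus)
      show "((\<lambda>x. P x * T x) has_vector_derivative P' x * T x + (1 - p * gpot (c + \<omega> * x)) * \<omega> * P x) (at x within {0..1})" for x
        using has_field_derivative_at_within[OF DERIV_mult[OF P(1) dT]]
        by (simp add: has_real_derivative_iff_has_vector_derivative)
    qed simp
    moreover have "(\<lambda>x. P' x * T x) integrable_on {0..1}"
      by (intro integrable_continuous_interval continuous_intros Tc continuous_on_subset[OF P']) auto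
    then have i1: "((\<lambda>x. P' x * T x) has_integral integral {0..1} (\<lambda>x. P' x * T x)) {0..1}" by (rule integrable_integral)
    ultimately have "((\<lambda>x. P' x * T x + (1 - p * gpot (c + \<omega> * x)) * \<omega> * P x - P' x * T x) has_integral
      (P 1 * T 1 - P 0 * T 0 - integral {0..1} (\<lambda>x. P' x * T x))) {0..1}"
      by (intro has_integral_diff)
    then have "((\<lambda>x. \<omega> * h x) has_integral (P 1 * T 1 - P 0 * T 0 - integral {0..1} (\<lambda>x. P' x * T x))) {0..1}"
      by (rule has_integral_eq[rotated]) (simp add: h_def algebra_simps)
    then have "\<omega> * integral {0..1} h = P 1 * T 1 - P 0 * T 0 - integral {0..1} (\<lambda>x. P' x * T x)"
      using integral_unique[of "\<lambda>x. \<omega> * h x"] unfolding integral_mult_right by metis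
    moreover have "\<bar>P 1 * T 1\<bar> \<le> \<bar>P 1\<bar>" "\<bar>P 0 * T 0\<bar> \<le> \<bar>P 0\<bar>" using T1 by (simp_all add: abs_mult mult_left_le)
    moreover have "\<bar>integral {0..1} (\<lambda>x. P' x * T x)\<bar> \<le> K"
    proof (rule has_integral_abs_le[OF i1])
      fix s :: real assume "s \<in> {0..1}"
      then show "\<bar>P' s * T s\<bar> \<le> K" using mult_mono[OF K T1, of s s] \<open>K \<ge> 0\<close> by (simp add: abs_mult)
    qed (use \<open>K \<ge> 0\<close> in auto)
    ultimately have "\<bar>\<omega> * integral {0..1} h\<bar> \<le> \<bar>P 1\<bar> + \<bar>P 0\<bar> + K" by linarith
    then show "\<bar>integral {0..1} (\<lambda>x. P x * (1 - p * gpot (c + \<omega> * x)))\<bar> \<le> (\<bar>P 1\<bar> + \<bar>P 0\<bar> + K) / \<omega>"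
      using \<omega> unfolding h_def[abs_def] by (simp add: abs_mult field_simps)
  qed
qed

end

context half_linear_potential
begin

lemma q_mult_integrable:
  assumes "continuous_on {0..1} f"
  shows "(\<lambda>x. q x * f x) integrable_on {0..1}"
  using absolutely_integrable_continuous_mult[OF q assms] by (simp add: absolutely_integrable_on_def)

lemma abs_integral_q_mult_le:
  assumes "continuous_on {0..1} f" "\<And>x. x \<in> {0..1} \<Longrightarrow> \<bar>f x\<bar> \<le> c" "x \<in> {0..1}" "0 \<le> c"
  shows "\<bar>integral {0..x} (\<lambda>x. q x * f x)\<bar> \<le> c * integral {0..1} (\<lambda>x. \<bar>q x\<bar>)"
  by (rule integral_abs_bound[OF q _ q_mult_integrable[OF assms(1)]])
    (use assms in \<open>auto simp: abs_mult mult.commute mult_right_mono\<close>)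

text \<open>
  For the angle equation at \<open>\<lambda> = \<omega>\<^sup>p\<close> the boundary condition forces \<open>\<integral> q |S\<^sub>p(\<theta>)|\<^sup>p\<close> to be a multiple
  of \<open>\<pi>\<^sub>p \<omega>\<^sup>p\<^sup>-\<^sup>1\<close>, hence to vanish for large \<open>\<omega>\<close>; as \<open>\<theta>\<close> is then nearly linear, the
  Riemann--Lebesgue argument applies to \<open>1 - p |S\<^sub>p|\<^sup>p = (S\<^sub>p S\<^sub>p'\<^sup>(\<^sup>p\<^sup>-\<^sup>1\<^sup>))'\<close>.
\<close>

lemma mean_zero:
  assumes N: "\<And>k. N k \<ge> k"
    and sol: "\<And>k. k \<ge> 1 \<Longrightarrow> \<exists>\<theta> n. ac_deriv 0 1 \<theta> (\<lambda>x. real (N k) * pi_hat p - (real (N k) * pi_hat p) powr (1 - p) * (q x * gpot (\<theta> x)))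
       \<and> \<theta> 1 = \<theta> 0 + of_int n * pi_hat p"
  shows "integral {0..1} q = 0"
proof (rule ccontr)
  assume "integral {0..1} q \<noteq> 0"
  define J where "J = \<bar>integral {0..1} q\<bar>"
  have J: "J > 0" using \<open>integral {0..1} q \<noteq> 0\<close> by (simp add: J_def)
  define Q where "Q = integral {0..1} (\<lambda>x. \<bar>q x\<bar>)"
  have aq: "(\<lambda>x. \<bar>q x\<bar>) integrable_on {0..1}" using q by (simp add: absolutely_integrable_on_def)
  have Q: "Q \<ge> 0" unfolding Q_def using aq by (intro integral_nonneg) auto
  \<comment> \<open>Since \<open>\<bar>1 - p gpot\<bar> \<le> 1 + p\<close>, replacing
    \<open>q\<close> by \<open>P\<close> in the oscillatory integral costs less than
    \<open>J / 4\<close>.\<close>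
  obtain P P' where P: "\<And>x. (P has_real_derivative P' x) (at x)" "continuous_on UNIV P'"
    "integral {0..1} (\<lambda>x. \<bar>q x - P x\<bar>) < J / (4 * (1 + p))"
    using L1_approx_C1[OF q, of "J / (4 * (1 + p))"] J p by auto
  obtain C where C: "\<And>c \<omega>. \<omega> > 0 \<Longrightarrow> \<bar>integral {0..1} (\<lambda>x. P x * (1 - p * gpot (c + \<omega> * x)))\<bar> \<le> C / \<omega>"
    using oscillation_bound[OF P(1,2)] by metis
  define \<omega> where "\<omega> k = real (N k) * pi_hat p" for k
  have "filterlim (\<lambda>k. real k * pi_hat p) at_top sequentially"
    using pi_hat_pos by (intro filterlim_at_top_mult_tendsto_pos[OF tendsto_const] filterlim_real_sequentially) auto
  then have \<omega>lim: "filterlim \<omega> at_top sequentially"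
    by (rule filterlim_at_top_mono) (use N pi_hat_pos in \<open>auto simp: \<omega>_def intro!: always_eventually mult_right_mono\<close>)
  then have e0: "(\<lambda>k. \<omega> k powr (1 - p)) \<longlonglongrightarrow> 0"
    using tendsto_neg_powr[of "1 - p" \<omega> sequentially] p by simp
  have "(\<lambda>k. \<omega> k powr (1 - p) * Q) \<longlonglongrightarrow> 0 * Q" by (intro tendsto_intros e0)
  then have ev1: "\<forall>\<^sub>F k in sequentially. \<omega> k powr (1 - p) * Q < pi_hat p"
    using pi_hat_pos by (intro order_tendstoD(2)) auto
  have "(\<lambda>k. p * (p * (\<omega> k powr (1 - p) * Q) * Q)) \<longlonglongrightarrow> p * (p * (0 * Q) * Q)" by (intro tendsto_intros e0)
  then have ev2: "\<forall>\<^sub>F k in sequentially. p * (p * (\<omega> k powr (1 - p) * Q) * Q) < J / 4"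
    using J by (intro order_tendstoD(2)) auto
  have "((\<lambda>k. C / \<omega> k) \<longlongrightarrow> 0) sequentially" using \<omega>lim by (rule real_tendsto_divide_at_top[OF tendsto_const])
  then have ev3: "\<forall>\<^sub>F k in sequentially. C / \<omega> k < J / 4" using J by (intro order_tendstoD(2)) auto
  have "\<forall>\<^sub>F k in sequentially. k \<ge> 1" by (rule eventually_ge_at_top)
  with ev1 ev2 ev3 have "\<forall>\<^sub>F k in sequentially. k \<ge> 1 \<and> \<omega> k powr (1 - p) * Q < pi_hat p \<and>
     p * (p * (\<omega> k powr (1 - p) * Q) * Q) < J / 4 \<and> C / \<omega> k < J / 4"
    by eventually_elim auto
  then obtain k where k: "k \<ge> 1" "\<omega> k powr (1 - p) * Q < pi_hat p"
     "p * (p * (\<omega> k powr (1 - p) * Q) * Q) < J / 4" "C / \<omega> k < J / 4"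
    unfolding eventually_sequentially by blast
  define \<epsilon> where "\<epsilon> = \<omega> k powr (1 - p)"
  have \<omega>k: "\<omega> k > 0" using N[of k] k(1) pi_hat_pos by (simp add: \<omega>_def)
  then have \<epsilon>: "\<epsilon> > 0" by (simp add: \<epsilon>_def)
  obtain \<theta> n where \<theta>: "ac_deriv 0 1 \<theta> (\<lambda>x. \<omega> k - \<epsilon> * (q x * gpot (\<theta> x)))" "\<theta> 1 = \<theta> 0 + of_int n * pi_hat p"
    using sol[OF k(1)] unfolding \<omega>_def \<epsilon>_def by blast
  have \<theta>c: "continuous_on {0..1} \<theta>" by (rule ac_deriv_continuous[OF \<theta>(1)])
  have Gc: "continuous_on {0..1} (\<lambda>x. gpot (\<theta> x))" by (rule continuous_on_compose2[OF continuous_gpot \<theta>c]) auto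
  have G1: "\<bar>gpot s\<bar> \<le> 1" for s using gpot_nonneg gpot_le_1 by simp
  have lin: "\<theta> x = \<theta> 0 + \<omega> k * x - \<epsilon> * integral {0..x} (\<lambda>x. q x * gpot (\<theta> x))" if x: "x \<in> {0..1}" for x
  proof -
    have "(\<lambda>x. q x * gpot (\<theta> x)) integrable_on {0..x}"
      using q_mult_integrable[OF Gc] x by (auto intro: integrable_on_subinterval)
    then have "integral {0..x} (\<lambda>x. \<omega> k - \<epsilon> * (q x * gpot (\<theta> x))) = \<omega> k * x - \<epsilon> * integral {0..x} (\<lambda>x. q x * gpot (\<theta> x))"
      using x by (subst integral_diff) (auto intro: integrable_on_mult_right)
    then show ?thesis using ac_deriv_eq_integral[OF \<theta>(1) x] by simp
  qed
  have Ib: "\<bar>integral {0..x} (\<lambda>x. q x * gpot (\<theta> x))\<bar> \<le> Q" if "x \<in> {0..1}" for x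
    using abs_integral_q_mult_le[OF Gc _ that, of 1] G1 by (simp add: Q_def)
  define I where "I = integral {0..1} (\<lambda>x. q x * gpot (\<theta> x))"
  have "I = 0"
  proof -
    have eq: "of_int (int (N k) - n) * pi_hat p = \<epsilon> * I"
      using lin[of 1] \<theta>(2) by (simp add: I_def \<omega>_def algebra_simps)
    have "\<bar>\<epsilon> * I\<bar> \<le> \<epsilon> * Q" using Ib[of 1] \<epsilon> by (simp add: abs_mult I_def)
    then have "\<bar>of_int (int (N k) - n) * pi_hat p\<bar> < pi_hat p" using k(2) unfolding eq \<epsilon>_def by simp
    then have "\<bar>real_of_int (int (N k) - n)\<bar> < 1" using pi_hat_pos by (simp add: abs_mult)
    then have "int (N k) - n = 0" by linarith
    then show ?thesis using eq \<epsilon> by simp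
  qed
  \<comment> \<open>Uniform rotation from the same initial angle; it stays within
    \<open>\<epsilon> Q\<close> of \<open>\<theta>\<close>.\<close>
  define l where "l x = \<theta> 0 + \<omega> k * x" for x
  have Glc: "continuous_on {0..1} (\<lambda>x. gpot (l x))"
    unfolding l_def by (intro continuous_on_compose2[OF continuous_gpot] continuous_intros) auto
  have near: "\<bar>gpot (l x) - gpot (\<theta> x)\<bar> \<le> p * (\<epsilon> * Q)" if x: "x \<in> {0..1}" for x
  proof -
    have "\<bar>l x - \<theta> x\<bar> = \<epsilon> * \<bar>integral {0..x} (\<lambda>x. q x * gpot (\<theta> x))\<bar>"
      using lin[OF x] \<epsilon> by (simp add: l_def abs_mult)
    also have "\<dots> \<le> \<epsilon> * Q" using Ib[OF x] \<epsilon> by (intro mult_left_mono) auto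
    finally have "p * \<bar>l x - \<theta> x\<bar> \<le> p * (\<epsilon> * Q)" using p by (intro mult_left_mono) auto
    then show ?thesis using gpot_lipschitz[of "l x" "\<theta> x"] by linarith
  qed
  have s2: "\<bar>integral {0..1} (\<lambda>x. q x * (gpot (l x) - gpot (\<theta> x)))\<bar> \<le> p * (\<epsilon> * Q) * Q"
    unfolding Q_def by (rule abs_integral_q_mult_le)
      (use near p \<epsilon> Q Gc Glc in \<open>auto simp: Q_def intro!: continuous_on_diff\<close>)
  have Pc: "continuous_on {0..1} P" using P(1) DERIV_isCont by (blast intro: continuous_at_imp_continuous_on)
  have oc: "continuous_on {0..1} (\<lambda>x. 1 - p * gpot (l x))" by (intro continuous_intros Glc)
  have iP: "(\<lambda>x. P x * (1 - p * gpot (l x))) integrable_on {0..1}"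
    by (intro integrable_continuous_interval continuous_on_mult Pc oc)
  have s1: "\<bar>integral {0..1} (\<lambda>x. q x * (1 - p * gpot (l x)))\<bar> < J / 4 + J / 4"
  proof -
    have dq: "(\<lambda>x. q x - P x) absolutely_integrable_on {0..1}"
      by (intro set_integral_diff q absolutely_integrable_continuous_real Pc)
    have "\<bar>integral {0..1} (\<lambda>x. (q x - P x) * (1 - p * gpot (l x)))\<bar> \<le> (1 + p) * integral {0..1} (\<lambda>x. \<bar>q x - P x\<bar>)"
    proof (rule integral_abs_bound[OF dq])
      show "(\<lambda>x. (q x - P x) * (1 - p * gpot (l x))) integrable_on {0..1}"
        using absolutely_integrable_continuous_mult[OF dq oc] by (simp add: absolutely_integrable_on_def)
      fix x
      have "p * gpot (l x) \<le> p * 1" using p gpot_le_1 by (intro mult_left_mono) auto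
      moreover have "p * gpot (l x) \<ge> 0" using p gpot_nonneg by simp
      ultimately have "\<bar>1 - p * gpot (l x)\<bar> \<le> 1 + p" by linarith
      from mult_right_mono[OF this, of "\<bar>q x - P x\<bar>"]
      show "\<bar>(q x - P x) * (1 - p * gpot (l x))\<bar> \<le> (1 + p) * \<bar>q x - P x\<bar>" by (simp add: abs_mult mult.commute)
    qed (use p in auto)
    also have "\<dots> < (1 + p) * (J / (4 * (1 + p)))" using P(3) p by (intro mult_strict_left_mono) auto
    also have "\<dots> = J / 4"
    proof -
      have "c * (J / (4 * c)) = J / 4" if "c \<noteq> 0" for c
        using that by simp
      moreover have "1 + p \<noteq> 0" using p by simp
      ultimately show ?thesis by blast
    qed
    finally have a: "\<bar>integral {0..1} (\<lambda>x. (q x - P x) * (1 - p * gpot (l x)))\<bar> < J / 4" .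
    have b: "\<bar>integral {0..1} (\<lambda>x. P x * (1 - p * gpot (l x)))\<bar> < J / 4"
      using C[OF \<omega>k, of "\<theta> 0"] k(4) unfolding l_def by linarith
    have "integral {0..1} (\<lambda>x. q x * (1 - p * gpot (l x))) =
      integral {0..1} (\<lambda>x. (q x - P x) * (1 - p * gpot (l x)) + P x * (1 - p * gpot (l x)))"
      by (rule integral_cong) (simp add: algebra_simps)
    also have "\<dots> = integral {0..1} (\<lambda>x. (q x - P x) * (1 - p * gpot (l x))) + integral {0..1} (\<lambda>x. P x * (1 - p * gpot (l x)))"
      using absolutely_integrable_continuous_mult[OF dq oc] iP by (intro integral_add) (auto simp: absolutely_integrable_on_def)
    finally show ?thesis using a b by linarith
  qed
  have i1: "(\<lambda>x. q x * (1 - p * gpot (l x))) integrable_on {0..1}" by (rule q_mult_integrable[OF oc])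
  have i2: "(\<lambda>x. q x * (gpot (l x) - gpot (\<theta> x))) integrable_on {0..1}"
    by (rule q_mult_integrable) (intro continuous_intros Glc Gc)
  have i3: "(\<lambda>x. q x * gpot (\<theta> x)) integrable_on {0..1}" by (rule q_mult_integrable[OF Gc])
  \<comment> \<open>The first part is below \<open>J / 2\<close> by approximation and oscillation,
    the second below \<open>J / 4\<close> because \<open>l\<close> is close to
    \<open>\<theta>\<close>, and the third is \<open>p I = 0\<close>. Together they contradict the
    choice of \<open>J\<close>.\<close>
  have "integral {0..1} q = integral {0..1} (\<lambda>x. q x * (1 - p * gpot (l x)) + p * (q x * (gpot (l x) - gpot (\<theta> x))) + p * (q x * gpot (\<theta> x)))"
    by (rule integral_cong) (simp add: algebra_simps)
  also have "\<dots> = integral {0..1} (\<lambda>x. q x * (1 - p * gpot (l x))) + p * integral {0..1} (\<lambda>x. q x * (gpot (l x) - gpot (\<theta> x))) + p * I"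
    unfolding I_def
    by (simp only: integral_add[OF integrable_add[OF i1 integrable_on_mult_right[OF i2]] integrable_on_mult_right[OF i3]]
        integral_add[OF i1 integrable_on_mult_right[OF i2]] integral_mult_right)
  finally have "J \<le> \<bar>integral {0..1} (\<lambda>x. q x * (1 - p * gpot (l x)))\<bar> + p * \<bar>integral {0..1} (\<lambda>x. q x * (gpot (l x) - gpot (\<theta> x)))\<bar>"
  proof -
    assume eq: "integral {0..1} q = integral {0..1} (\<lambda>x. q x * (1 - p * gpot (l x))) + p * integral {0..1} (\<lambda>x. q x * (gpot (l x) - gpot (\<theta> x))) + p * I"
    have "\<bar>A + p * D + p * I\<bar> \<le> \<bar>A\<bar> + p * \<bar>D\<bar>" for A D
      using abs_triangle_ineq[of A "p * D"] p \<open>I = 0\<close> by (simp add: abs_mult)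
    then show ?thesis unfolding J_def eq .
  qed
  moreover have "p * \<bar>integral {0..1} (\<lambda>x. q x * (gpot (l x) - gpot (\<theta> x)))\<bar> \<le> p * (p * (\<epsilon> * Q) * Q)"
    using s2 p by (intro mult_left_mono) auto
  ultimately show False using s1 k(3) J unfolding \<epsilon>_def by linarith
qed

lemma riccati:
  assumes "ac_deriv a b \<theta> (\<lambda>x. 1 + angle_coeff \<mu> x * gpot (\<theta> x))" "\<And>x. x \<in> {a..b} \<Longrightarrow> gsin (\<theta> x) \<noteq> 0"
  shows "ac_deriv a b (\<lambda>x. gcot (\<theta> x)) (\<lambda>x. (p - 1) * (q x - \<mu> - \<bar>gcot (\<theta> x)\<bar> powr (p / (p - 1))))"
proof (rule ac_deriv_cong[OF gcot_ac_deriv[OF assms]])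
  fix x assume "x \<in> {a<..<b}"
  then have "gsin (\<theta> x) \<noteq> 0" using assms(2) by auto
  then show "- (p - 1) * (1 / gpot (\<theta> x) + angle_coeff \<mu> x) = (p - 1) * (q x - \<mu> - \<bar>gcot (\<theta> x)\<bar> powr (p / (p - 1)))"
  proof -
    have "- (p - 1) * (g + (\<mu> - q x - 1)) = (p - 1) * (q x - \<mu> - (g - 1))" for g
      by (simp add: algebra_simps)
    then show ?thesis unfolding abs_gcot_powr[OF \<open>gsin (\<theta> x) \<noteq> 0\<close>] angle_coeff_def .
  qed
qed simp_all

text \<open>For every parameter this supplies a starting angle of positive displacement, one side of
  the intermediate value argument.\<close>

lemma turn_0_pos: "turn \<mu> 0 > 0"
  using angle_crosses_upwards[OF flow_ac angle_coeff zero_less_one, where n = 0 and ?x1.0 = 0 and ?x2.0 = 1, of \<mu> 0]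
  by (simp add: turn_def flow_0)

text \<open>Multiples of \<open>pi_hat p\<close> are only crossed upwards, so an angle without net
  displacement stays strictly between two of them. The Riccati variable \<open>w\<close> is then
  finite and equal at both ends, and integrating its equation gives
  \<open>\<integral> \<bar>w\<bar>^(p/(p-1)) = - \<mu>\<close>. For \<open>\<mu> = 0\<close> this
  forces \<open>w = 0\<close>, and the equation leaves only \<open>q\<close>.\<close>

lemma turn_zero:
  assumes t: "turn \<mu> t = 0" and mean: "integral {0..1} q = 0"
  shows "\<mu> \<le> 0" and "\<mu> = 0 \<Longrightarrow> AE x in lebesgue. x \<in> {0..1} \<longrightarrow> q x = 0"
proof -
  define n where "n = \<lfloor>t / pi_hat p\<rfloor>"
  have "of_int n \<le> t / pi_hat p" "t / pi_hat p < of_int n + 1" unfolding n_def by linarith+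
  then have n: "of_int n * pi_hat p \<le> t" "t < of_int (n + 1) * pi_hat p"
    using pi_hat_pos by (auto simp: field_simps)
  define \<theta> where "\<theta> = flow \<mu> t"
  have \<theta>: "ac_deriv 0 1 \<theta> (\<lambda>x. 1 + angle_coeff \<mu> x * gpot (\<theta> x))" unfolding \<theta>_def by (rule flow_ac)
  have \<theta>01: "\<theta> 0 = t" "\<theta> 1 = t" using t by (auto simp: \<theta>_def flow_0 turn_def)
  note cross = angle_crosses_upwards[OF \<theta> angle_coeff zero_less_one]
  have lo: "of_int n * pi_hat p < \<theta> x" if "x \<in> {0..1}" for x
    using cross[of 0 x n] cross[of 0 1 n] that n(1) \<theta>01 by (cases "x = 0") auto
  have hi: "\<theta> x < of_int (n + 1) * pi_hat p" if "x \<in> {0..1}" for x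
  proof (rule ccontr)
    assume *: "\<not> \<theta> x < of_int (n + 1) * pi_hat p"
    then have "x \<noteq> 1" using n(2) \<theta>01 by auto
    then show False using cross[of x 1 "n + 1"] * that n(2) \<theta>01 by auto
  qed
  have nz: "gsin (\<theta> x) \<noteq> 0" if "x \<in> {0..1}" for x using gsin_nonzero_between[OF lo hi] that by auto
  define w where "w x = gcot (\<theta> x)" for x
  have w: "ac_deriv 0 1 w (\<lambda>x. (p - 1) * (q x - \<mu> - \<bar>w x\<bar> powr (p / (p - 1))))"
    unfolding w_def using riccati[OF \<theta> nz] .
  have wc: "continuous_on {0..1} (\<lambda>x. \<bar>w x\<bar> powr (p / (p - 1)))"
    using p ac_deriv_continuous[OF w] by (intro continuous_on_powr' continuous_intros) auto
  have qi: "q integrable_on {0..1}" using q by (simp add: absolutely_integrable_on_def)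
  have "((\<lambda>x. (p - 1) * (q x - \<mu> - \<bar>w x\<bar> powr (p / (p - 1)))) has_integral 0) {0..1}"
    using ac_deriv_ftc[OF w] \<theta>01 by (simp add: w_def)
  moreover have "((\<lambda>x. (p - 1) * (q x - \<mu> - \<bar>w x\<bar> powr (p / (p - 1)))) has_integral
     (p - 1) * (integral {0..1} q - \<mu> - integral {0..1} (\<lambda>x. \<bar>w x\<bar> powr (p / (p - 1))))) {0..1}"
    using has_integral_const_real[of \<mu> 0 1]
    by (intro has_integral_mult_right has_integral_diff integrable_integral qi integrable_continuous_interval wc) simp
  ultimately have "(p - 1) * (integral {0..1} q - \<mu> - integral {0..1} (\<lambda>x. \<bar>w x\<bar> powr (p / (p - 1)))) = 0"
    using has_integral_unique by blast
  then have I: "integral {0..1} (\<lambda>x. \<bar>w x\<bar> powr (p / (p - 1))) = - \<mu>" using mean p by simp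
  moreover have "integral {0..1} (\<lambda>x. \<bar>w x\<bar> powr (p / (p - 1))) \<ge> 0"
    by (rule integral_nonneg[OF integrable_continuous_interval[OF wc]]) simp
  ultimately show "\<mu> \<le> 0" by simp
  assume "\<mu> = 0"
  then have "\<forall>x\<in>{0..1}. \<bar>w x\<bar> powr (p / (p - 1)) = 0"
    using I integral_eq_0_iff[OF wc] by simp
  then have w0: "w x = 0" if "x \<in> {0..1}" for x using that by simp
  have "ac_deriv 0 1 w (\<lambda>x. (p - 1) * q x)"
    by (rule ac_deriv_cong[OF w]) (use w0 \<open>\<mu> = 0\<close> in auto)
  from ac_deriv_constant_imp_ae_zero[OF ac_deriv_subinterval[OF this], of _ _ 0]
  have "AE x in lebesgue. x \<in> {a<..<b} \<longrightarrow> (p - 1) * q x = 0" if "0 < a" "b < 1" for a b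
    using that w0 by auto
  then show "AE x in lebesgue. x \<in> {0..1} \<longrightarrow> q x = 0"
    using p by (intro ae_zero_exhaust) simp
qed

text \<open>
  For very negative \<open>\<mu>\<close> the solution of \<open>\<theta>' = - q |S\<^sub>p(\<theta>)|\<^sup>p\<close>, whose cotangent is \<open>(p - 1) \<integral> q\<close>, is
  a periodic upper solution of the angle equation.
\<close>

lemma turn_nonpos_exists:
  assumes mean: "integral {0..1} q = 0"
  obtains \<mu>0 where "\<mu>0 \<le> 0" "\<And>\<mu>. \<mu> \<le> \<mu>0 \<Longrightarrow> \<exists>t. turn \<mu> t \<le> 0"
proof -
  \<comment> \<open>A quarter turn, the zero of the cotangent; as \<open>\<integral> q = 0\<close>,
    the auxiliary solution returns to it.\<close>
  define h where "h = gen_angle (pi / 2)"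
  have h: "0 < h" "h < pi_hat p" "gmom h = 0"
    using gen_angle_strict_mono[of 0 "pi / 2"] gen_angle_strict_mono[of "pi / 2" pi] gen_angle_add_pi[of 0]
    by (auto simp: h_def gmom_def)
  have h_unique: "t = h" if "0 < t" "t < pi_hat p" "gmom t = 0" for t
  proof -
    have "0 < std_angle t" "std_angle t < pi"
      using std_angle_less[of 0 t] std_angle_less[of t "pi_hat p"] std_angle_add_pi_hat[of 0] that by auto
    moreover have "cos (std_angle t) = 0" using that(3) by (simp add: gmom_def)
    ultimately have "std_angle t = pi / 2"
      using cos_inj_pi[of "std_angle t" "pi / 2"] by simp
    then show ?thesis unfolding h_def by (metis gen_std)
  qed
  have mq: "(\<lambda>x. - q x) absolutely_integrable_on {0..1}" using absolutely_integrable_cmult[OF q, of "-1"] by simp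
  obtain \<beta> where \<beta>0: "\<beta> 0 = h" and \<beta>: "ac_deriv 0 1 \<beta> (\<lambda>x. 0 + - q x * gpot (\<beta> x))"
    using caratheodory_ode_exists[OF gpot_lipschitz _ mq, of h 0] p by auto
  have const: "ac_deriv 0 1 (\<lambda>x. c) (\<lambda>x. 0 + - q x * gpot c)" if "gpot c = 0" for c
    using ac_deriv_const[of 0 1 c] that by simp
  have gpi: "gpot (pi_hat p) = 0" using gpot_add_pi_hat[of 0] by simp
  have range: "0 < \<beta> x" "\<beta> x < pi_hat p" if x: "x \<in> {0..1}" for x
  proof -
    have "(\<beta> x - 0) * exp (- integral {0..x} (\<lambda>x. - q x * slope gpot gpot' (\<beta> x) 0)) = \<beta> 0"
      using ac_deriv_eq_integral[OF angle_difference(1)[OF \<beta> const[of 0] mq] x] by simp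
    then have "\<beta> x * exp (- integral {0..x} (\<lambda>x. - q x * slope gpot gpot' (\<beta> x) 0)) > 0" using h(1) by (simp only: \<beta>0 diff_0_right)
    then show "0 < \<beta> x" by (simp add: zero_less_mult_iff)
    have "(pi_hat p - \<beta> x) * exp (- integral {0..x} (\<lambda>x. - q x * slope gpot gpot' (pi_hat p) (\<beta> x))) = pi_hat p - \<beta> 0"
      using ac_deriv_eq_integral[OF angle_difference(1)[OF const[OF gpi] \<beta> mq] x] by simp
    then have "(pi_hat p - \<beta> x) * exp (- integral {0..x} (\<lambda>x. - q x * slope gpot gpot' (pi_hat p) (\<beta> x))) > 0"
      using h(2) by (simp only: \<beta>0)
    then show "\<beta> x < pi_hat p" by (simp add: zero_less_mult_iff)
  qed
  have nz: "gsin (\<beta> x) \<noteq> 0" if "x \<in> {0..1}" for x using gsin_pos[OF range[OF that]] by simp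
  define w where "w x = gcot (\<beta> x)" for x
  have w: "ac_deriv 0 1 w (\<lambda>x. (p - 1) * q x)"
    unfolding w_def by (rule ac_deriv_cong[OF gcot_ac_deriv[OF \<beta> nz]]) (auto simp: algebra_simps)
  have w0: "w 0 = 0" using h(3) by (simp add: w_def \<beta>0 gcot_def)
  have wx: "w x = (p - 1) * integral {0..x} q" if "x \<in> {0..1}" for x
    using ac_deriv_eq_integral[OF w that] w0 by simp
  define M where "M = (p - 1) * integral {0..1} (\<lambda>x. \<bar>q x\<bar>)"
  have wM: "\<bar>w x\<bar> \<le> M" if x: "x \<in> {0..1}" for x
    using abs_integral_q_mult_le[of "\<lambda>_. 1" 1 x] x p by (simp add: wx[OF x] M_def abs_mult)
  have "gmom (\<beta> 1) = 0" using wx[of 1] mean nz[of 1] by (simp add: w_def gcot_def)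
  then have \<beta>1: "\<beta> 1 = h" using h_unique range[of 1] by simp
  show thesis
  proof (rule that)
    show "- (M powr (p / (p - 1))) \<le> 0" by simp
    fix \<mu> assume \<mu>: "\<mu> \<le> - (M powr (p / (p - 1)))"
    \<comment> \<open>\<open>\<beta>\<close> solves the angle equation with the constant
      \<open>1\<close> replaced by \<open>(1 - \<mu>) gpot(\<beta>)\<close>. This is at least
      \<open>1\<close> exactly when \<open>\<bar>w\<bar>^(p/(p-1)) \<le> - \<mu>\<close>, which
      explains the threshold.\<close>
    have 2: "ac_deriv 0 1 \<beta> (\<lambda>x. (1 - \<mu>) * gpot (\<beta> x) + angle_coeff \<mu> x * gpot (\<beta> x))"
      by (rule ac_deriv_cong[OF \<beta>]) (auto simp: angle_coeff_def algebra_simps)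
    define E where "E x = integral {0..x} (\<lambda>x. angle_coeff \<mu> x * slope gpot gpot' (\<beta> x) (flow \<mu> h x))" for x
    have ac: "ac_deriv 0 1 (\<lambda>x. (\<beta> x - flow \<mu> h x) * exp (- E x)) (\<lambda>x. ((1 - \<mu>) * gpot (\<beta> x) - 1) * exp (- E x))"
      unfolding E_def using angle_difference(1)[OF 2 flow_ac angle_coeff] .
    have "(\<beta> 0 - flow \<mu> h 0) * exp (- E 0) \<le> (\<beta> 1 - flow \<mu> h 1) * exp (- E 1)"
    proof (rule ac_deriv_mono[OF ac])
      fix x :: real assume "x \<in> {0<..<1}"
      then have x: "x \<in> {0..1}" by auto
      have "\<bar>w x\<bar> powr (p / (p - 1)) \<le> M powr (p / (p - 1))"
        using wM[OF x] p by (intro powr_mono2) auto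
      then have "1 / gpot (\<beta> x) - 1 \<le> - \<mu>" using \<mu> unfolding w_def abs_gcot_powr[OF nz[OF x]] by linarith
      then have "1 \<le> (1 - \<mu>) * gpot (\<beta> x)" using gpot_pos[OF nz[OF x]] by (simp add: field_simps)
      then show "0 \<le> ((1 - \<mu>) * gpot (\<beta> x) - 1) * exp (- E x)" by simp
    qed simp
    then have "(h - flow \<mu> h 1) * exp (- E 1) \<ge> 0" by (simp add: flow_0 \<beta>0 \<beta>1)
    then have "flow \<mu> h 1 \<le> h" by (simp add: zero_le_mult_iff)
    then show "\<exists>t. turn \<mu> t \<le> 0" by (intro exI[of _ h]) (simp add: turn_def)
  qed
qed

lemma continuous_turn_1: "continuous_on UNIV (\<lambda>\<mu>. turn \<mu> s)"
  using continuous_on_compose2[OF continuous_turn continuous_on_Pair[OF continuous_on_id continuous_on_const[of _ s]]]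
  by simp

lemma continuous_turn_2: "continuous_on UNIV (turn \<mu>)"
  using continuous_on_compose2[OF continuous_turn continuous_on_Pair[OF continuous_on_const[of _ \<mu>] continuous_on_id]]
  by simp

text \<open>The pairs of parameter and reduced starting angle with nonpositive displacement form a
  compact set \<open>K\<close>. At its largest parameter \<open>l\<close> the minimal displacement
  is \<open>0\<close>, so \<open>l\<close> is an eigenvalue; the hypothesis gives
  \<open>l \<ge> 0\<close> and the Riccati equation \<open>l \<le> 0\<close>.\<close>

lemma periodic_case:
  assumes mean: "integral {0..1} q = 0" and least: "\<And>\<mu>. \<mu> \<in> periodic_eigenvalues p q \<Longrightarrow> 0 \<le> \<mu>"
  shows "AE x in lebesgue. x \<in> {0..1} \<longrightarrow> q x = 0"
proof -
  obtain \<mu>0 where \<mu>0: "\<mu>0 \<le> 0" "\<And>\<mu>. \<mu> \<le> \<mu>0 \<Longrightarrow> \<exists>t. turn \<mu> t \<le> 0"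
    using turn_nonpos_exists[OF mean] by blast
  have bound: "\<mu> \<le> 0" if "turn \<mu> t \<le> 0" for \<mu> t
  proof -
    obtain s where s: "0 \<le> s" "turn \<mu> s = turn \<mu> t" using turn_reduce by metis
    have "\<exists>z. 0 \<le> z \<and> z \<le> s \<and> turn \<mu> z = 0"
      using that s turn_0_pos[of \<mu>] by (intro IVT2' continuous_on_subset[OF continuous_turn_2]) auto
    then show ?thesis using turn_zero(1)[OF _ mean] by blast
  qed
  define K where "K = ({\<mu>0..0} \<times> {0..pi_hat p}) \<inter> {z. turn (fst z) (snd z) \<le> 0}"
  have K: "compact K" unfolding K_def
    by (intro compact_Int_closed compact_Times compact_Icc closed_Collect_le continuous_turn continuous_on_const)
  obtain t where "turn \<mu>0 t \<le> 0" using \<mu>0(2)[of \<mu>0] by auto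
  moreover obtain s where "0 \<le> s" "s \<le> pi_hat p" "turn \<mu>0 s = turn \<mu>0 t" by (rule turn_reduce)
  ultimately have "(\<mu>0, s) \<in> K" using \<mu>0(1) by (simp add: K_def)
  then have "K \<noteq> {}" by auto
  with K obtain z where z: "z \<in> K" "\<And>y. y \<in> K \<Longrightarrow> fst y \<le> fst z"
    using continuous_attains_sup[of K fst, OF _ _ continuous_on_fst[OF continuous_on_id]] by blast
  obtain l u where lu: "z = (l, u)" by (cases z)
  have lu1: "\<mu>0 \<le> l" "turn l u \<le> 0" using z(1) lu by (auto simp: K_def)
  \<comment> \<open>A negative displacement would persist for slightly larger parameters. By
    \<open>bound\<close> these are still at most \<open>0\<close>, so they would give points of
    \<open>K\<close> beyond \<open>l\<close>.\<close>
  have min: "0 \<le> turn l s" for s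
  proof (rule ccontr)
    assume "\<not> 0 \<le> turn l s"
    then have "\<forall>\<^sub>F \<mu> in at_right l. turn \<mu> s < 0"
      using continuous_turn_1[of s] by (intro order_tendstoD(2)[of _ "turn l s"])
        (auto simp: continuous_on_eq_continuous_at isCont_def intro: tendsto_within_subset)
    then obtain b where b: "b > l" "\<And>\<mu>. l < \<mu> \<Longrightarrow> \<mu> < b \<Longrightarrow> turn \<mu> s < 0"
      unfolding eventually_at_right_field by blast
    define \<mu> where "\<mu> = (l + b) / 2"
    have \<mu>: "l < \<mu>" "turn \<mu> s < 0" using b by (auto simp: \<mu>_def)
    obtain s' where "0 \<le> s'" "s' \<le> pi_hat p" "turn \<mu> s' = turn \<mu> s" by (rule turn_reduce)
    then have "(\<mu>, s') \<in> K" using \<mu> bound[of \<mu> s] lu1 by (auto simp: K_def)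
    then show False using z(2)[of "(\<mu>, s')"] lu \<mu> by simp
  qed
  have zero: "turn l u = 0" using lu1(2) min[of u] by simp
  have "l \<in> periodic_eigenvalues p q"
    using turn_extremum_eigenvalue[of l u 0] min zero by simp
  then have "l = 0" using least turn_zero(1)[OF zero mean] by fastforce
  then show ?thesis using turn_zero(2)[OF zero mean] by blast
qed

text \<open>If the bound failed, there would be a smallest parameter \<open>l \<le> L\<close> at
  which a displacement of \<open>pi_hat p\<close> is reached. It is then the maximal displacement,
  \<open>l\<close> is an antiperiodic eigenvalue, and \<open>l = L\<close> contradicts the
  failure.\<close>

lemma antiperiodic_turn:
  assumes mean: "integral {0..1} q = 0" and least: "\<And>\<mu>. \<mu> \<in> antiperiodic_eigenvalues p q \<Longrightarrow> L \<le> \<mu>"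
    and L: "L \<ge> 0"
  shows "turn L t \<le> pi_hat p"
proof (rule ccontr)
  assume "\<not> turn L t \<le> pi_hat p"
  then have big: "turn L t > pi_hat p" by simp
  obtain \<mu>0 where \<mu>0: "\<mu>0 \<le> 0" "\<And>\<mu>. \<mu> \<le> \<mu>0 \<Longrightarrow> \<exists>t. turn \<mu> t \<le> 0"
    using turn_nonpos_exists[OF mean] by blast
  \<comment> \<open>Given \<open>u\<close> with nonpositive displacement, monotonicity of the flow
    keeps every angle that starts in \<open>[u, u + pi_hat p)\<close> below
    \<open>u + pi_hat p\<close>, so none gains a half turn. The search for \<open>l\<close>
    therefore has a lower bound.\<close>
  have low: "turn \<mu> s < pi_hat p" if \<mu>: "\<mu> \<le> \<mu>0" for \<mu> s
  proof -
    obtain u where u: "turn \<mu> u \<le> 0" using \<mu>0(2)[OF \<mu>] by blast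
    define n where "n = \<lfloor>(s - u) / pi_hat p\<rfloor>"
    have "of_int n \<le> (s - u) / pi_hat p" "(s - u) / pi_hat p < of_int n + 1" unfolding n_def by linarith+
    then have n: "of_int n * pi_hat p \<le> s - u" "s - u < of_int n * pi_hat p + pi_hat p"
      using pi_hat_pos by (auto simp: field_simps)
    define s' where "s' = s - of_int n * pi_hat p"
    have s': "u \<le> s'" "s' < u + of_int 1 * pi_hat p" using n by (auto simp: s'_def)
    have "flow \<mu> s' 1 < flow \<mu> (u + of_int 1 * pi_hat p) 1" by (rule flow_mono[OF s'(2)]) simp
    also have "\<dots> = flow \<mu> u 1 + of_int 1 * pi_hat p" by (rule flow_add_pi_hat) simp
    also have "\<dots> \<le> s' + pi_hat p" using u s' by (simp add: turn_def)
    finally have "turn \<mu> s' < pi_hat p" by (simp add: turn_def)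
    then show ?thesis using turn_add_pi_hat[of \<mu> s' n] by (simp add: s'_def)
  qed
  define K where "K = ({\<mu>0..L} \<times> {0..pi_hat p}) \<inter> {z. pi_hat p \<le> turn (fst z) (snd z)}"
  have K: "compact K" unfolding K_def
    by (intro compact_Int_closed compact_Times compact_Icc closed_Collect_le continuous_turn continuous_on_const)
  obtain s where "0 \<le> s" "s \<le> pi_hat p" "turn L s = turn L t" by (rule turn_reduce)
  then have "(L, s) \<in> K" using \<mu>0(1) L big by (simp add: K_def)
  then have "K \<noteq> {}" by auto
  with K obtain z where z: "z \<in> K" "\<And>y. y \<in> K \<Longrightarrow> fst z \<le> fst y"
    using continuous_attains_inf[of K fst, OF _ _ continuous_on_fst[OF continuous_on_id]] by blast
  obtain l u where lu: "z = (l, u)" by (cases z)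
  have lu1: "l \<le> L" "pi_hat p \<le> turn l u" using z(1) lu by (auto simp: K_def)
  have l0: "\<mu>0 < l" using low[of l u] lu1(2) by (meson not_le)
  have max: "turn l s \<le> pi_hat p" for s
  proof (rule ccontr)
    assume "\<not> turn l s \<le> pi_hat p"
    then have "\<forall>\<^sub>F \<mu> in at_left l. turn \<mu> s > pi_hat p"
      using continuous_turn_1[of s] by (intro order_tendstoD(1)[of _ "turn l s"])
        (auto simp: continuous_on_eq_continuous_at isCont_def intro: tendsto_within_subset)
    then obtain b where b: "b < l" "\<And>\<mu>. b < \<mu> \<Longrightarrow> \<mu> < l \<Longrightarrow> turn \<mu> s > pi_hat p"
      unfolding eventually_at_left_field by blast
    define \<mu> where "\<mu> = (l + b) / 2"
    have \<mu>: "\<mu> < l" "turn \<mu> s > pi_hat p" using b by (auto simp: \<mu>_def)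
    then have "\<mu>0 < \<mu>" using low[of \<mu> s] by (meson not_le order_less_asym)
    obtain s' where "0 \<le> s'" "s' \<le> pi_hat p" "turn \<mu> s' = turn \<mu> s" by (rule turn_reduce)
    then have "(\<mu>, s') \<in> K" using \<mu> lu1 \<open>\<mu>0 < \<mu>\<close> by (auto simp: K_def)
    then show False using z(2)[of "(\<mu>, s')"] lu \<mu> by simp
  qed
  have "turn l u = pi_hat p" using lu1(2) max[of u] by simp
  then have "l \<in> antiperiodic_eigenvalues p q"
    using turn_extremum_eigenvalue[of l u 1] max by simp
  then have "l = L" using least lu1 by fastforce
  then show False using max[of t] big by simp
qed

end

section \<open>Rigidity\<close>

lemma spow_divide: "spow (x / y) r = spow x r / spow y r"
proof -
  have "sgn (x / y) = sgn x / sgn y"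
    by (cases y "0::real" rule: linorder_cases) (simp_all add: sgn_divide)
  then show ?thesis by (simp only: spow_def abs_divide powr_divide abs_ge_zero times_divide_times_eq)
qed

context half_linear_potential
begin

text \<open>
  Picone's identity for \<open>u = S\<^sub>p(\<pi>\<^sub>p x)\<close> against the solution with \<open>y(0) = 0\<close>, written for the Riccati
  variables \<open>v\<close> of \<open>u\<close> and \<open>w\<close> of \<open>y\<close>: \<open>(p - 1) \<integral> q |u|\<^sup>p - |u|\<^sup>p (w - v)\<close> is nondecreasing, and it
  vanishes at both ends.
\<close>

lemma picone_rigidity:
  assumes turn: "turn (pi_hat p powr p) 0 \<le> pi_hat p"
    and test: "integral {0..1} (\<lambda>x. q x * gpot (pi_hat p * x)) = 0"
  shows "AE x in lebesgue. x \<in> {0..1} \<longrightarrow> q x = 0"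
proof -
  define k where "k = pi_hat p"
  have k: "k > 0" using pi_hat_pos by (simp add: k_def)
  define L where "L = k powr p"
  define \<theta> where "\<theta> = flow L 0"
  have \<theta>: "ac_deriv 0 1 \<theta> (\<lambda>x. 1 + angle_coeff L x * gpot (\<theta> x))" unfolding \<theta>_def by (rule flow_ac)
  have \<theta>c: "continuous_on {0..1} \<theta>" by (rule ac_deriv_continuous[OF \<theta>])
  have \<theta>01: "\<theta> 0 = 0" "\<theta> 1 \<le> k" using turn by (auto simp: \<theta>_def L_def k_def flow_0 turn_def)
  note cross = angle_crosses_upwards[OF \<theta> angle_coeff zero_less_one]
  have range: "0 < \<theta> x" "\<theta> x < k" if x: "0 < x" "x < 1" for x
  proof -
    show "0 < \<theta> x" using cross[of 0 x 0] x \<theta>01 by simp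
    show "\<theta> x < k"
    proof (rule ccontr)
      assume "\<not> \<theta> x < k"
      then have "\<theta> 1 > of_int 1 * pi_hat p" using x by (intro cross[of x 1 1]) (auto simp: k_def)
      then show False using \<theta>01 by (simp add: k_def)
    qed
  qed
  have g\<theta>: "gsin (\<theta> x) > 0" if "0 < x" "x < 1" for x using gsin_pos range[OF that] by (simp add: k_def)
  have gk: "gsin (k * x) > 0" if "0 < x" "x < 1" for x
    using that k by (intro gsin_pos) (auto simp: k_def)
  define r where "r = p / (p - 1)"
  have r: "r > 1" "r - 1 = 1 / (p - 1)" "(p - 1) * r = p" using p by (auto simp: r_def field_simps)
  define u where "u x = gpot (k * x)" for x
  \<comment> \<open>The factor comes from differentiating \<open>gsin (k * x)\<close>. Because
    \<open>(k^(p-1))^(p/(p-1)) = L\<close>, \<open>v\<close> satisfies the Riccati equation of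
    \<open>w\<close> with zero potential.\<close>
  define v where "v x = k powr (p - 1) * gcot (k * x)" for x
  define w where "w x = gcot (\<theta> x)" for x
  define B where "B x = \<bar>w x\<bar> powr r - \<bar>v x\<bar> powr r - r * spow (v x) (r - 1) * (w x - v x)" for x
  have upos: "u x > 0" if "0 < x" "x < 1" for x unfolding u_def using gk[OF that] by (intro gpot_pos) simp
  have kx: "ac_deriv a b (\<lambda>x. k * x) (\<lambda>x. k + 0 * gpot (k * x))" for a b
    by (rule ac_deriv_C1) (auto intro!: derivative_eq_intros)
  have w: "ac_deriv a b w (\<lambda>x. (p - 1) * (q x - L - \<bar>w x\<bar> powr r))" if ab: "0 < a" "b < 1" for a b
    unfolding w_def r_def
  proof (rule riccati[OF ac_deriv_subinterval[OF \<theta>]])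
    show "gsin (\<theta> x) \<noteq> 0" if "x \<in> {a..b}" for x using g\<theta>[of x] ab that by force
  qed (use ab in auto)
  have v: "ac_deriv a b v (\<lambda>x. - (p - 1) * (L + \<bar>v x\<bar> powr r))" if ab: "0 < a" "b < 1" for a b
  proof -
    have nz: "gsin (k * x) \<noteq> 0" if "x \<in> {a..b}" for x using gk[of x] ab that by force
    show ?thesis
    proof (rule ac_deriv_cong[OF ac_deriv_mult[OF ac_deriv_const[of a b "k powr (p - 1)"] gcot_ac_deriv[OF kx nz]]])
      fix x assume "x \<in> {a<..<b}"
      then have x: "gsin (k * x) \<noteq> 0" using nz by auto
      have kp: "k powr (p - 1) * k = L" using powr_add[of k "p - 1" 1] k by (simp add: L_def)
      have "(k powr (p - 1)) powr r = L" unfolding powr_powr r(3) L_def ..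
      then have "\<bar>v x\<bar> powr r = L * (1 / gpot (k * x) - 1)"
        using abs_gcot_powr[OF x] unfolding v_def abs_mult powr_mult r_def by simp
      then have "L + \<bar>v x\<bar> powr r = k powr (p - 1) * k / gpot (k * x)" unfolding kp by (simp add: algebra_simps)
      then show "0 * gcot (k * x) + k powr (p - 1) * (- (p - 1) * (k / gpot (k * x) + 0)) = - (p - 1) * (L + \<bar>v x\<bar> powr r)"
        by simp
    qed (simp_all add: v_def)
  qed
  have u: "ac_deriv a b u (\<lambda>x. p * u x * spow (v x) (r - 1))" if ab: "0 < a" "b < 1" for a b
  proof (rule ac_deriv_cong[OF ac_deriv_chain[OF kx gpot_has_derivative]])
    fix x assume "x \<in> {a<..<b}"
    then have x: "gsin (k * x) \<noteq> 0" using gk[of x] ab by force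
    have "spow (k powr (p - 1)) (r - 1) = k"
      using k p by (simp add: r(2) spow_pos powr_powr)
    then have sv: "spow (v x) (r - 1) = k * (gcos (k * x) / gsin (k * x))"
      unfolding v_def spow_mult gcot_def spow_divide by (simp add: r(2) gcos_gmom[symmetric] spow_conjugate)
    have "u x = gsin (k * x) * spow (gsin (k * x)) (p - 1)"
      using mult_spow[of "gsin (k * x)" "p - 1"] by (simp add: u_def gpot_def)
    then show "gpot' (k * x) * (k + 0 * gpot (k * x)) = p * u x * spow (v x) (r - 1)"
      unfolding sv gpot'_def using x by simp
  qed (auto simp: u_def intro: continuous_on_subset[OF continuous_gpot'])
  \<comment> \<open>As \<open>(p - 1) r = p\<close>, the derivative of \<open>u\<close> supplies
    exactly the tangent term of \<open>B\<close>; besides \<open>q u\<close> only the nonnegative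
    \<open>u B\<close> is left.\<close>
  define \<Phi> where "\<Phi> x = u x * (w x - v x)" for x
  have \<Phi>: "ac_deriv a b \<Phi> (\<lambda>x. (p - 1) * (q x * u x) - (p - 1) * (u x * B x))" if ab: "0 < a" "b < 1" for a b
    unfolding \<Phi>_def
  proof (rule ac_deriv_cong[OF ac_deriv_mult[OF u[OF ab] ac_deriv_diff[OF w[OF ab] v[OF ab]]]])
    fix x
    have "(p - 1) * r * (u x * spow (v x) (r - 1) * (w x - v x)) = p * (u x * spow (v x) (r - 1) * (w x - v x))"
      by (simp only: r(3))
    then have "p * u x * spow (v x) (r - 1) * (w x - v x) = (p - 1) * (u x * (r * spow (v x) (r - 1) * (w x - v x)))"
      by (simp only: mult_ac)
    then show "p * u x * spow (v x) (r - 1) * (w x - v x) + u x * ((p - 1) * (q x - L - \<bar>w x\<bar> powr r) - - (p - 1) * (L + \<bar>v x\<bar> powr r))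
       = (p - 1) * (q x * u x) - (p - 1) * (u x * B x)"
      unfolding B_def by (simp add: algebra_simps)
  qed simp
  have uc: "continuous_on A u" for A unfolding u_def
    by (intro continuous_on_compose2[OF continuous_gpot] continuous_intros) auto
  have qu: "(\<lambda>x. q x * u x) absolutely_integrable_on {0..1}"
    by (rule absolutely_integrable_continuous_mult[OF q uc])
  define h where "h x = integral {0..x} (\<lambda>x. q x * u x)" for x
  have h: "ac_deriv 0 1 h (\<lambda>x. q x * u x)" unfolding h_def by (rule ac_deriv_integral[OF qu])
  have h01: "h 0 = 0" "h 1 = 0" using test by (auto simp: h_def u_def k_def)
  define \<Psi> where "\<Psi> x = (p - 1) * h x - \<Phi> x" for x
  have \<Psi>: "ac_deriv a b \<Psi> (\<lambda>x. (p - 1) * (u x * B x))" if ab: "0 < a" "b < 1" for a b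
    unfolding \<Psi>_def
    by (rule ac_deriv_cong[OF ac_deriv_diff[OF ac_deriv_mult[OF ac_deriv_const ac_deriv_subinterval[OF h]] \<Phi>[OF ab]]])
      (use ab in auto)
  have Bn: "B x \<ge> 0" for x unfolding B_def by (rule strict_convex_bregman(1)[OF r(1)])
  have mono: "\<Psi> a \<le> \<Psi> b" if "0 < a" "a \<le> b" "b < 1" for a b
  proof (rule ac_deriv_mono[OF \<Psi>])
    fix x assume "x \<in> {a<..<b}"
    then have "u x > 0" using upos[of x] that by auto
    then show "0 \<le> (p - 1) * (u x * B x)" using p Bn by simp
  qed (use that in auto)
  \<comment> \<open>The amplitude of the solution \<open>y\<close> whose angle is
    \<open>\<theta>\<close>. The derivative of \<open>y\<close> is available at both end points, and
    passing from \<open>gsin (\<theta> x)\<close> to \<open>y\<close> costs only a continuous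
    positive factor.\<close>
  define \<rho> where "\<rho> x = exp (- (1 / p) * integral {0..x} (\<lambda>x. angle_coeff L x * gpot' (\<theta> x)))" for x
  have \<rho>c: "continuous_on {0..1} \<rho>"
  proof -
    have "(\<lambda>x. angle_coeff L x * gpot' (\<theta> x)) absolutely_integrable_on {0..1}"
      by (intro absolutely_integrable_continuous_mult[OF angle_coeff] continuous_on_compose2[OF continuous_gpot' \<theta>c]) auto
    from ac_deriv_continuous[OF ac_deriv_integral[OF this]] show ?thesis
      unfolding \<rho>_def by (intro continuous_intros)
  qed
  have yder: "((\<lambda>x. \<rho> x * gsin (\<theta> x)) has_real_derivative \<rho> x * gcos (\<theta> x)) (at x within {0..1})" if "x \<in> {0..1}" for x
    using flow_solution[of L 0] that unfolding half_linear_solution_def \<rho>_def \<theta>_def by blast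
  have gk01: "gsin (k * x0) = 0" if "x0 = 0 \<or> x0 = 1" for x0
    using that gsin_add_pi_hat[of 0] by (auto simp: k_def)
  \<comment> \<open>\<open>u w = gsin (k x) R^(p-1) gmom(\<theta>)\<close>: once \<open>R\<close>
    has finite limits, the product vanishes at the ends even where \<open>w\<close> is
    unbounded.\<close>
  define R where "R x = gsin (k * x) / gsin (\<theta> x)" for x
  have sub: "{0<..<1} \<subseteq> {0..1::real}" by auto
  have \<Psi>0: "(\<Psi> \<longlongrightarrow> 0) (at x0 within {0<..<1})" if x0: "x0 = 0 \<or> x0 = 1" for x0
  proof -
    have x01: "x0 \<in> {0..1}" using x0 by auto
    have cont: "(f \<longlongrightarrow> f x0) (at x0 within {0..1})" if "continuous_on {0..1} f" for f :: "real \<Rightarrow> real"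
      using that x01 by (simp add: continuous_on_def)
    have ksin: "continuous_on {0..1} (\<lambda>x. gsin (k * x))"
      by (intro continuous_on_compose2[OF continuous_gsin] continuous_intros) auto
    have \<theta>sin: "continuous_on {0..1} (\<lambda>x. gsin (\<theta> x))"
      by (intro continuous_on_compose2[OF continuous_gsin \<theta>c]) auto
    have \<theta>mom: "continuous_on {0..1} (\<lambda>x. gmom (\<theta> x))"
      by (intro continuous_on_compose2[OF continuous_gmom \<theta>c]) auto
    have kmom: "continuous_on {0..1} (\<lambda>x. gmom (k * x))"
      by (intro continuous_on_compose2[OF continuous_gmom] continuous_intros) auto
    \<comment> \<open>Numerator and denominator both vanish at \<open>0\<close>, and at
      \<open>1\<close> when \<open>\<theta> 1 = k\<close>; if \<open>\<theta> 1 < k\<close>, the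
      denominator is nonzero at \<open>1\<close>.\<close>
    have "\<exists>l. (R \<longlongrightarrow> l) (at x0 within {0..1})"
    proof (cases "gsin (\<theta> x0) = 0")
      case False
      then show ?thesis unfolding R_def using tendsto_divide[OF cont[OF ksin] cont[OF \<theta>sin]] by blast
    next
      case True
      then have nz: "\<rho> x0 * gcos (\<theta> x0) \<noteq> 0" using gpyth[of "\<theta> x0"] p by (auto simp: \<rho>_def)
      have "((\<lambda>x. gsin (k * x)) has_real_derivative gcos (k * x0) * k) (at x0)"
        by (rule DERIV_chain2[OF gsin_has_derivative]) (auto intro!: derivative_eq_intros)
      from tendsto_ratio_of_zeros[OF has_field_derivative_at_within[OF this] yder[OF x01] gk01[OF x0] _ nz] True
      have "((\<lambda>x. gsin (k * x) / (\<rho> x * gsin (\<theta> x))) \<longlongrightarrow> gcos (k * x0) * k / (\<rho> x0 * gcos (\<theta> x0))) (at x0 within {0..1})"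
        by simp
      from tendsto_mult[OF cont[OF \<rho>c] this]
      have "((\<lambda>x. \<rho> x * (gsin (k * x) / (\<rho> x * gsin (\<theta> x)))) \<longlongrightarrow> \<rho> x0 * (gcos (k * x0) * k / (\<rho> x0 * gcos (\<theta> x0)))) (at x0 within {0..1})" .
      moreover have "\<rho> x * (gsin (k * x) / (\<rho> x * gsin (\<theta> x))) = R x" for x by (simp add: R_def \<rho>_def)
      ultimately show ?thesis by auto
    qed
    then obtain l where l: "(R \<longlongrightarrow> l) (at x0 within {0..1})" by blast
    have "((\<lambda>x. spow (R x) (p - 1)) \<longlongrightarrow> spow l (p - 1)) (at x0 within {0..1})"
      using isCont_tendsto_compose[OF isCont_spow l, of "p - 1"] p by simp
    from tendsto_mult[OF tendsto_mult[OF cont[OF ksin] this] cont[OF \<theta>mom]]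
    have uw: "((\<lambda>x. gsin (k * x) * spow (R x) (p - 1) * gmom (\<theta> x)) \<longlongrightarrow> 0) (at x0 within {0..1})"
      by (simp add: gk01[OF x0])
    have uv: "((\<lambda>x. k powr (p - 1) * (gsin (k * x) * gmom (k * x))) \<longlongrightarrow> 0) (at x0 within {0..1})"
      using tendsto_mult[OF tendsto_const tendsto_mult[OF cont[OF ksin] cont[OF kmom]], of "k powr (p - 1)"]
      by (simp add: gk01[OF x0])
    have "((\<lambda>x. (p - 1) * h x) \<longlongrightarrow> (p - 1) * h x0) (at x0 within {0..1})"
      by (intro tendsto_mult tendsto_const cont ac_deriv_continuous[OF h])
    then have hl: "((\<lambda>x. (p - 1) * h x) \<longlongrightarrow> 0) (at x0 within {0..1})" using x0 h01 by auto
    have "((\<lambda>x. (p - 1) * h x - (gsin (k * x) * spow (R x) (p - 1) * gmom (\<theta> x) - k powr (p - 1) * (gsin (k * x) * gmom (k * x)))) \<longlongrightarrow> 0 - (0 - 0)) (at x0 within {0..1})"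
      by (intro tendsto_diff hl uw uv)
    then have "((\<lambda>x. (p - 1) * h x - (gsin (k * x) * spow (R x) (p - 1) * gmom (\<theta> x) - k powr (p - 1) * (gsin (k * x) * gmom (k * x)))) \<longlongrightarrow> 0) (at x0 within {0<..<1})"
      using tendsto_within_subset[OF _ sub] by simp
    moreover have "(p - 1) * h x - (gsin (k * x) * spow (R x) (p - 1) * gmom (\<theta> x) - k powr (p - 1) * (gsin (k * x) * gmom (k * x))) = \<Psi> x"
      if x: "x \<in> {0<..<1}" for x
    proof -
      have s: "gsin (k * x) > 0" "gsin (\<theta> x) > 0" using gk[of x] g\<theta>[of x] x by auto
      have gp: "gpot (k * x) = gsin (k * x) * spow (gsin (k * x)) (p - 1)"
        using mult_spow[of "gsin (k * x)" "p - 1"] by (simp add: gpot_def)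
      have "u x * w x = gsin (k * x) * spow (R x) (p - 1) * gmom (\<theta> x)"
        unfolding u_def w_def gcot_def R_def spow_divide gp by simp
      moreover have "u x * v x = k powr (p - 1) * (gsin (k * x) * gmom (k * x))"
        unfolding u_def v_def gcot_def gp using s by simp
      ultimately show ?thesis by (simp add: \<Psi>_def \<Phi>_def right_diff_distrib)
    qed
    then have "\<forall>\<^sub>F x in at x0 within {0<..<1}. (p - 1) * h x - (gsin (k * x) * spow (R x) (p - 1) * gmom (\<theta> x) - k powr (p - 1) * (gsin (k * x) * gmom (k * x))) = \<Psi> x"
      unfolding eventually_at_filter by (intro always_eventually) auto
    ultimately show ?thesis by (rule Lim_transform_eventually)
  qed
  have ev01: "\<forall>\<^sub>F y in at x0 within {0<..<1}. y \<in> {0<..<1}" for x0 :: real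
    unfolding eventually_at_filter by (intro always_eventually) auto
  \<comment> \<open>A nondecreasing function on \<open>(0, 1)\<close> with limit \<open>0\<close> at
    both ends.\<close>
  have \<Psi>_zero: "\<Psi> x = 0" if x: "0 < x" "x < 1" for x
  proof (rule antisym)
    have "\<forall>\<^sub>F y in at 1 within {0<..<1}. x < y" using x by (intro order_tendstoD(1)[OF tendsto_ident_at])
    with ev01[of 1] have "\<forall>\<^sub>F y in at 1 within {0<..<1}. \<Psi> x \<le> \<Psi> y"
      by eventually_elim (use mono x in auto)
    moreover have "at (1::real) within {0<..<1} \<noteq> bot"
      using islimpt_greaterThanLessThan2[of 0 "1::real"] by (simp add: trivial_limit_within)
    ultimately show "\<Psi> x \<le> 0" using tendsto_lowerbound[OF \<Psi>0[of 1]] by simp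
    have "\<forall>\<^sub>F y in at 0 within {0<..<1}. y < x" using x by (intro order_tendstoD(2)[OF tendsto_ident_at])
    with ev01[of 0] have "\<forall>\<^sub>F y in at 0 within {0<..<1}. \<Psi> y \<le> \<Psi> x"
      by eventually_elim (use mono x in auto)
    moreover have "at (0::real) within {0<..<1} \<noteq> bot"
      using islimpt_greaterThanLessThan1[of 0 "1::real"] by (simp add: trivial_limit_within)
    ultimately show "0 \<le> \<Psi> x" using tendsto_upperbound[OF \<Psi>0[of 0]] by simp
  qed
  show ?thesis
  proof (rule ae_zero_exhaust)
    fix a b :: real assume ab: "0 < a" "a < b" "b < 1"
    have cw: "continuous_on {a..b} w" "continuous_on {a..b} v"
      using ac_deriv_continuous[OF w] ac_deriv_continuous[OF v] ab by auto
    have cB: "continuous_on {a..b} (\<lambda>x. (p - 1) * (u x * B x))"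
    proof -
      have "continuous_on {a..b} (\<lambda>x. \<bar>f x\<bar> powr r)" if "continuous_on {a..b} f" for f
        using r(1) by (intro continuous_on_powr' continuous_on_rabs continuous_on_const that) auto
      then show ?thesis
        unfolding B_def using r(1) cw by (intro continuous_on_mult continuous_on_diff continuous_on_const uc cw continuous_on_spow) simp_all
    qed
    have "integral {a..b} (\<lambda>x. (p - 1) * (u x * B x)) = 0"
      using ac_deriv_integral_eq[OF \<Psi>, of a b b] \<Psi>_zero ab by simp
    then have "\<forall>x\<in>{a..b}. (p - 1) * (u x * B x) = 0"
      using integral_eq_0_iff[OF cB] upos Bn p ab by (auto simp: less_imp_le)
    then have "B x = 0" if "x \<in> {a..b}" for x using that upos[of x] p ab by force
    then have wv: "w x = v x" if "x \<in> {a..b}" for x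
      using strict_convex_bregman(2)[OF r(1)] that unfolding B_def by blast
    \<comment> \<open>With \<open>w = v\<close> the nonlinear terms and \<open>L\<close> cancel
      between the two Riccati equations; only \<open>(p - 1) q\<close> remains.\<close>
    have "ac_deriv a b (\<lambda>x. w x - v x) (\<lambda>x. (p - 1) * q x)"
      by (rule ac_deriv_cong[OF ac_deriv_diff[OF w v]]) (use ab wv in \<open>auto simp: algebra_simps\<close>)
    from ac_deriv_constant_imp_ae_zero[OF this, of 0]
    show "AE x in lebesgue. x \<in> {a<..<b} \<longrightarrow> q x = 0" using wv p by simp
  qed
qed

text \<open>The choice \<open>\<kappa> = \<omega>\<close> satisfies
  \<open>\<omega>^p \<kappa>^(1-p) = \<kappa>\<close>, so the spectral parameter drops out of the
  coefficient of \<open>gpot\<close>, leaving \<open>q\<close> with the factor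
  \<open>\<omega>^(1-p)\<close>, which is small for large \<open>\<omega>\<close>.\<close>

lemma scaled_eigen_angle:
  assumes "\<omega> > 0" and "\<omega> powr p \<in> periodic_eigenvalues p q \<or> \<omega> powr p \<in> antiperiodic_eigenvalues p q"
  shows "\<exists>\<theta> n. ac_deriv 0 1 \<theta> (\<lambda>x. \<omega> - \<omega> powr (1 - p) * (q x * gpot (\<theta> x))) \<and> \<theta> 1 = \<theta> 0 + of_int n * pi_hat p"
proof -
  obtain y y' where y: "half_linear_solution p (\<omega> powr p) q {0..1} y y'" "\<exists>x\<in>{0..1}. y x \<noteq> 0"
    "(y 0 = y 1 \<and> y' 0 = y' 1) \<or> (y 0 = - y 1 \<and> y' 0 = - y' 1)"
    using assms(2) unfolding periodic_eigenvalues_def antiperiodic_eigenvalues_def by blast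
  obtain \<theta> n where \<theta>: "ac_deriv 0 1 \<theta> (\<lambda>x. \<omega> + ((\<omega> powr p - q x) * \<omega> powr (1 - p) - \<omega>) * gpot (\<theta> x))"
    "\<theta> 1 = \<theta> 0 + of_int n * pi_hat p"
    by (rule eigen_angle[OF y assms(1)])
  have \<omega>: "\<omega> powr p * \<omega> powr (1 - p) = \<omega>" using assms(1) by (simp add: powr_add[symmetric])
  have "(\<omega> powr p - q x) * \<omega> powr (1 - p) - \<omega> = - (\<omega> powr (1 - p) * q x)" for x
  proof -
    have "(A - c) * W - z = - (W * c)" if "A * W = z" for A W c z :: real
      using that by (simp add: algebra_simps)
    then show ?thesis using \<omega> by blast
  qed
  then have "\<omega> + ((\<omega> powr p - q x) * \<omega> powr (1 - p) - \<omega>) * gpot (\<theta> x) = \<omega> - \<omega> powr (1 - p) * (q x * gpot (\<theta> x))" for x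
    by simp
  then show ?thesis using \<theta> by auto
qed

end

theorem theorem1p3:
  fixes p :: real and q :: "real \<Rightarrow> real"
  assumes "p > 1"
    and "\<And>x. q (x + 1) = q x"
    and "q absolutely_integrable_on {0..1}"
  shows
    "({(2 * real n * pi_hat p) powr p | n :: nat. True} \<subseteq> periodic_eigenvalues p q \<and>
      0 \<in> periodic_eigenvalues p q \<and> (\<forall>\<mu>\<in>periodic_eigenvalues p q. 0 \<le> \<mu>)
      \<longrightarrow> (AE x in lebesgue. x \<in> {0..1} \<longrightarrow> q x = 0))
     \<and>
     ({((2 * real n - 1) * pi_hat p) powr p | n :: nat. n \<ge> 1} \<subseteq> antiperiodic_eigenvalues p q \<and>
      pi_hat p powr p \<in> antiperiodic_eigenvalues p q \<and>
      (\<forall>\<mu>\<in>antiperiodic_eigenvalues p q. pi_hat p powr p \<le> \<mu>) \<and>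
      (LINT t:{0..1}|lebesgue. q t *
         deriv (\<lambda>s. S_p p (pi_hat p * s) * spow (deriv (S_p p) (pi_hat p * s)) (p - 1)) t) = 0
      \<longrightarrow> (AE x in lebesgue. x \<in> {0..1} \<longrightarrow> q x = 0))"
proof -
  interpret half_linear_potential p q by unfold_locales (use assms in auto)
  show ?thesis
  proof (intro conjI impI)
    assume "{(2 * real n * pi_hat p) powr p | n :: nat. True} \<subseteq> periodic_eigenvalues p q \<and>
      0 \<in> periodic_eigenvalues p q \<and> (\<forall>\<mu>\<in>periodic_eigenvalues p q. 0 \<le> \<mu>)"
    then have ev: "\<And>n::nat. (2 * real n * pi_hat p) powr p \<in> periodic_eigenvalues p q"
      and least: "\<And>\<mu>. \<mu> \<in> periodic_eigenvalues p q \<Longrightarrow> 0 \<le> \<mu>" by blast+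
    have "integral {0..1} q = 0"
    proof (rule mean_zero[of "\<lambda>k. 2 * k"])
      fix k :: nat assume "k \<ge> 1"
      then show "\<exists>\<theta> n. ac_deriv 0 1 \<theta> (\<lambda>x. real (2 * k) * pi_hat p - (real (2 * k) * pi_hat p) powr (1 - p) * (q x * gpot (\<theta> x)))
       \<and> \<theta> 1 = \<theta> 0 + of_int n * pi_hat p"
        using ev[of k] pi_hat_pos by (intro scaled_eigen_angle) auto
    qed simp
    then show "AE x in lebesgue. x \<in> {0..1} \<longrightarrow> q x = 0" using periodic_case least by blast
  next
    assume asm: "{((2 * real n - 1) * pi_hat p) powr p | n :: nat. n \<ge> 1} \<subseteq> antiperiodic_eigenvalues p q \<and>
      pi_hat p powr p \<in> antiperiodic_eigenvalues p q \<and>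
      (\<forall>\<mu>\<in>antiperiodic_eigenvalues p q. pi_hat p powr p \<le> \<mu>) \<and>
      (LINT t:{0..1}|lebesgue. q t *
         deriv (\<lambda>s. S_p p (pi_hat p * s) * spow (deriv (S_p p) (pi_hat p * s)) (p - 1)) t) = 0"
    then have ev: "\<And>n::nat. n \<ge> 1 \<Longrightarrow> ((2 * real n - 1) * pi_hat p) powr p \<in> antiperiodic_eigenvalues p q"
      and least: "\<And>\<mu>. \<mu> \<in> antiperiodic_eigenvalues p q \<Longrightarrow> pi_hat p powr p \<le> \<mu>" by blast+
    have mean: "integral {0..1} q = 0"
    \<comment> \<open>Truncated subtraction gives \<open>0\<close> at \<open>k = 0\<close>, so
      \<open>N k \<ge> k\<close> holds for all \<open>k\<close>; eigenvalues are called on for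
      \<open>k \<ge> 1\<close> only.\<close>
    proof (rule mean_zero[of "\<lambda>k. 2 * k - 1"])
      fix k :: nat assume "k \<ge> 1"
      then have "real (2 * k - 1) = 2 * real k - 1" by (simp add: of_nat_diff)
      then show "\<exists>\<theta> n. ac_deriv 0 1 \<theta> (\<lambda>x. real (2 * k - 1) * pi_hat p - (real (2 * k - 1) * pi_hat p) powr (1 - p) * (q x * gpot (\<theta> x)))
       \<and> \<theta> 1 = \<theta> 0 + of_int n * pi_hat p"
        using ev[OF \<open>k \<ge> 1\<close>] pi_hat_pos \<open>k \<ge> 1\<close> by (intro scaled_eigen_angle) auto
    qed simp
    have "deriv gsin = gcos" using gsin_has_derivative DERIV_imp_deriv by blast
    then have "deriv (\<lambda>s. S_p p (pi_hat p * s) * spow (deriv (S_p p) (pi_hat p * s)) (p - 1)) t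
      = (1 - p * gpot (pi_hat p * t)) * pi_hat p" for t
      using DERIV_imp_deriv[OF scaled_gsin_gmom_has_derivative[of 0 "pi_hat p" t]]
      by (simp add: S_p_eq_gsin gmom_gcos)
    then have lint: "(LINT t:{0..1}|lebesgue. q t * ((1 - p * gpot (pi_hat p * t)) * pi_hat p)) = 0"
      using asm by simp
    have Gc: "continuous_on {0..1} (\<lambda>t. gpot (pi_hat p * t))"
      by (intro continuous_on_compose2[OF continuous_gpot] continuous_intros) auto
    have "(\<lambda>t. q t * ((1 - p * gpot (pi_hat p * t)) * pi_hat p)) absolutely_integrable_on {0..1}"
      by (intro absolutely_integrable_continuous_mult q continuous_intros Gc)
    from set_lebesgue_integral_eq_integral(2)[OF this] lint
    have "integral {0..1} (\<lambda>t. q t * ((1 - p * gpot (pi_hat p * t)) * pi_hat p)) = 0" by simp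
    also have "integral {0..1} (\<lambda>t. q t * ((1 - p * gpot (pi_hat p * t)) * pi_hat p))
      = integral {0..1} (\<lambda>t. pi_hat p * q t - (pi_hat p * p) * (q t * gpot (pi_hat p * t)))"
      by (rule integral_cong) (simp add: algebra_simps)
    also have "\<dots> = pi_hat p * integral {0..1} q - (pi_hat p * p) * integral {0..1} (\<lambda>t. q t * gpot (pi_hat p * t))"
      using q q_mult_integrable[OF Gc]
      by (simp add: integral_diff integrable_on_mult_right absolutely_integrable_on_def)
    \<comment> \<open>The integral hypothesis is \<open>pi_hat p\<close> times
      \<open>\<integral> q - p \<integral> q gpot\<close>, and \<open>\<integral> q\<close> is
      already known to vanish.\<close>
    finally have "integral {0..1} (\<lambda>t. q t * gpot (pi_hat p * t)) = 0"
      using mean pi_hat_pos p by simp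
    moreover have "turn (pi_hat p powr p) 0 \<le> pi_hat p"
      using antiperiodic_turn[OF mean least] by simp
    ultimately show "AE x in lebesgue. x \<in> {0..1} \<longrightarrow> q x = 0" by (intro picone_rigidity)
  qed
qed

end
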